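(* Let $(H_n)_{n\in\omega}$ be a sequence of countable discrete abelian groups and let $G\le\prod_n H_n$ be a tame closed subgroup such that for all $n\in\mathbb{N}_+$, $G_{\langle n\rangle}/G_{\langle n+1\rangle}$ is torsion. Then every group tree $S\subseteq T_G$ satisfies $\mathrm{ht}(S)\le\omega\cdot 3$, and every coset tree $S\subseteq T_G$ satisfies $\mathrm{ht}(S)<\omega\cdot 4$.
   Context: A Polish group is tame if every orbit equivalence relation induced by a Borel action of it on a Polish space is Borel. Let $\pi_k:\prod_nH_n\to H_k$ be the projections. Set $G_{\langle 0\rangle}=G$ and for $m\ge1$, $G_{\langle m\rangle}=\{x\in G:\pi_k(x)=0\text{ for all }k<m\}$. For $n\ge1$ let $H^n=H_0\times\cdots\times H_{n-1}$ (a group) and $T_H=\bigcup_{n\ge1}H^n$; for $\sigma\in H^n$, $\mathrm{lh}(\sigma)=n$, and $\sigma\subseteq\tau$ means $\sigma$ is the restriction of $\tau$ to its first $\mathrm{lh}(\sigma)$ coordinates; similarly $\sigma\subseteq x$ for $x\in\prod_nH_n$. A tree is a subset $S\subseteq T_H$ closed under restriction. $T_G=\{\sigma\in T_H:\exists x\in G\ \sigma\subseteq x\}$. A group tree is a tree $S$ with $S\cap H^m$ a subgroup of $H^m$ for every $m\ge1$; a coset tree is a tree $S$ such that for each $m\ge1$, $S\cap H^m$ is empty or a coset of a subgroup of $H^m$. The derivative of a tree is $D(S)=\{\sigma\in S:\exists\tau\in S\ (\sigma\subseteq\tau,\ \mathrm{lh}(\sigma)<\mathrm{lh}(\tau))\}$;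 $D^0(S)=S$, $D^{\alpha+1}(S)=D(D^\alpha(S))$, $D^\lambda(S)=\bigcap_{\alpha<\lambda}D^\alpha(S)$ for limit $\lambda$. The height $\mathrm{ht}(S)$ is the least ordinal $\alpha$ with $D^{\alpha+1}(S)=D^\alpha(S)$. *)

theory Defs
  imports
    "HOL-Analysis.Analysis"
    "HOL-Algebra.Group_Action"
    "HOL-Algebra.Product_Groups"
    "HOL-Algebra.Weak_Morphisms"
    "HOL-Library.Sublist"
begin

section \<open>Tame groups\<close>

definition polish_topology :: "'a topology \<Rightarrow> bool" where
  "polish_topology X \<longleftrightarrow> completely_metrizable_space X \<and> separable_space X"

definition borel_of :: "'a topology \<Rightarrow> 'a measure" where
  "borel_of X = sigma (topspace X) {U. openin X U}"

definition borel_action ::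
    "('g, 'm) monoid_scheme \<Rightarrow> 'g topology \<Rightarrow> 'x topology \<Rightarrow> ('g \<Rightarrow> 'x \<Rightarrow> 'x) \<Rightarrow> bool" where
  "borel_action G T X \<phi> \<longleftrightarrow>
     group_action G (topspace X) \<phi> \<and>
     (\<lambda>(g, x). \<phi> g x) \<in> borel_of (prod_topology T X) \<rightarrow>\<^sub>M borel_of X"

definition orbit_eqrel ::
    "('g, 'm) monoid_scheme \<Rightarrow> 'x topology \<Rightarrow> ('g \<Rightarrow> 'x \<Rightarrow> 'x) \<Rightarrow> ('x \<times> 'x) set" where
  "orbit_eqrel G X \<phi> = {(x, y). x \<in> topspace X \<and> y \<in> orbit G \<phi> x}"

text \<open>
  \<open>T\<close> is the topology of the group \<open>G\<close>; its underlying set is meant to be the carrier of \<open>G\<close>.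
  The quantifier over all Polish spaces ranges over the Polish topologies whose underlying set is
  an arbitrary set of reals. Nothing is lost by this: a Polish space has at most continuum many
  points, so it is homeomorphic to a space of this kind.
\<close>

definition tame :: "('g, 'm) monoid_scheme \<Rightarrow> 'g topology \<Rightarrow> bool" where
  "tame G T \<longleftrightarrow>
     (\<forall>(X :: real topology) \<phi>. polish_topology X \<and> borel_action G T X \<phi> \<longrightarrow>
        orbit_eqrel G X \<phi> \<in> sets (borel_of (prod_topology X X)))"

section \<open>Closed subgroups of the product\<close>

abbreviation prod_discrete :: "(nat \<Rightarrow> 'a monoid) \<Rightarrow> (nat \<Rightarrow> 'a) topology" where
  "prod_discrete H \<equiv> product_topology (\<lambda>n. discrete_topology (carrier (H n))) UNIV"

abbreviation subgroup_of_prod :: "(nat \<Rightarrow> 'a monoid) \<Rightarrow> (nat \<Rightarrow> 'a) set \<Rightarrow> (nat \<Rightarrow> 'a) monoid" where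
  "subgroup_of_prod H K \<equiv> (product_group UNIV H)\<lparr>carrier := K\<rparr>"

definition level :: "(nat \<Rightarrow> 'a monoid) \<Rightarrow> (nat \<Rightarrow> 'a) set \<Rightarrow> nat \<Rightarrow> (nat \<Rightarrow> 'a) set" where
  "level H G m = {x \<in> G. \<forall>k<m. x k = \<one>\<^bsub>H k\<^esub>}"

definition torsion_group :: "('g, 'm) monoid_scheme \<Rightarrow> bool" where
  "torsion_group Q \<longleftrightarrow> (\<forall>x \<in> carrier Q. \<exists>k::nat. k > 0 \<and> x [^]\<^bsub>Q\<^esub> k = \<one>\<^bsub>Q\<^esub>)"

section \<open>Trees\<close>

text \<open>Elements of \<open>H\<^sub>0 \<times> \<dots> \<times> H\<^sub>n\<^sub>-\<^sub>1\<close> are lists of length \<open>n\<close>; the relation \<open>\<sigma> \<subseteq> \<tau>\<close> is \<open>prefix \<sigma> \<tau>\<close>.\<close>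

definition fin_prod :: "(nat \<Rightarrow> 'a monoid) \<Rightarrow> nat \<Rightarrow> 'a list monoid" where
  "fin_prod H n = DirProd_list (map H [0..<n])"

lemma carrier_fin_prod:
  "\<sigma> \<in> carrier (fin_prod H n) \<longleftrightarrow> length \<sigma> = n \<and> (\<forall>i<n. \<sigma> ! i \<in> carrier (H i))"
  using DirProd_list_carrier_mem[of \<sigma> "map H [0..<n]"]
        DirProd_list_carrier_memI[of \<sigma> "map H [0..<n]"]
  unfolding fin_prod_def by auto

definition nodes :: "(nat \<Rightarrow> 'a monoid) \<Rightarrow> 'a list set" where
  "nodes H = (\<Union>n\<in>{1..}. carrier (fin_prod H n))"

definition nodes_of :: "(nat \<Rightarrow> 'a monoid) \<Rightarrow> (nat \<Rightarrow> 'a) set \<Rightarrow> 'a list set" where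
  "nodes_of H G = {\<sigma> \<in> nodes H. \<exists>x\<in>G. \<sigma> = map x [0..<length \<sigma>]}"

definition tree :: "(nat \<Rightarrow> 'a monoid) \<Rightarrow> 'a list set \<Rightarrow> bool" where
  "tree H S \<longleftrightarrow> S \<subseteq> nodes H \<and> (\<forall>\<tau>\<in>S. \<forall>\<sigma>\<in>nodes H. prefix \<sigma> \<tau> \<longrightarrow> \<sigma> \<in> S)"

definition group_tree :: "(nat \<Rightarrow> 'a monoid) \<Rightarrow> 'a list set \<Rightarrow> bool" where
  "group_tree H S \<longleftrightarrow> tree H S \<and>
     (\<forall>m\<ge>1. subgroup (S \<inter> carrier (fin_prod H m)) (fin_prod H m))"

definition coset_tree :: "(nat \<Rightarrow> 'a monoid) \<Rightarrow> 'a list set \<Rightarrow> bool" where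
  "coset_tree H S \<longleftrightarrow> tree H S \<and>
     (\<forall>m\<ge>1. S \<inter> carrier (fin_prod H m) = {} \<or>
        (\<exists>K. subgroup K (fin_prod H m) \<and>
             S \<inter> carrier (fin_prod H m) \<in> rcosets\<^bsub>fin_prod H m\<^esub> K))"

definition tree_deriv :: "'a list set \<Rightarrow> 'a list set" where
  "tree_deriv S = {\<sigma> \<in> S. \<exists>\<tau>\<in>S. prefix \<sigma> \<tau> \<and> length \<sigma> < length \<tau>}"

section \<open>Countable ordinals\<close>

text \<open>
  The successor cardinal of \<open>natLeq\<close> is a well-order of type \<open>\<omega>\<^sub>1\<close>, so the elements of its field
  stand for the countable ordinals. These suffice to define the height: the derivatives of a tree
  on countable sets decrease, hence are constant from some countable ordinal on
  (lemma \<open>tree_deriv_iter_stable\<close> below).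
\<close>

typedef ctble_ord = "Field (cardSuc natLeq)"
proof -
  have "infinite (Field (cardSuc natLeq))"
    using cardSuc_finite[OF natLeq_Card_order] Field_natLeq by (metis infinite_UNIV_nat)
  then show ?thesis by (metis ex_in_conv finite.emptyI)
qed

lemma Well_order_cardSuc_natLeq: "Well_order (cardSuc natLeq)"
  using cardSuc_Card_order[OF natLeq_Card_order] card_order_on_well_order_on by blast

instantiation ctble_ord :: wellorder
begin

definition less_eq_ctble_ord :: "ctble_ord \<Rightarrow> ctble_ord \<Rightarrow> bool" where
  "\<alpha> \<le> \<beta> \<longleftrightarrow> (Rep_ctble_ord \<alpha>, Rep_ctble_ord \<beta>) \<in> cardSuc natLeq"

definition less_ctble_ord :: "ctble_ord \<Rightarrow> ctble_ord \<Rightarrow> bool" where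
  "\<alpha> < \<beta> \<longleftrightarrow> \<alpha> \<le> \<beta> \<and> \<alpha> \<noteq> (\<beta> :: ctble_ord)"

instance
proof
  let ?r = "cardSuc natLeq"
  interpret wo_rel ?r
    using Well_order_cardSuc_natLeq by (simp add: wo_rel_def)
  have antisym: "\<alpha> \<le> \<beta> \<Longrightarrow> \<beta> \<le> \<alpha> \<Longrightarrow> \<alpha> = \<beta>" for \<alpha> \<beta> :: ctble_ord
    using ANTISYM unfolding less_eq_ctble_ord_def antisym_def by (meson Rep_ctble_ord_inject)
  show "\<alpha> < \<beta> \<longleftrightarrow> \<alpha> \<le> \<beta> \<and> \<not> \<beta> \<le> \<alpha>" for \<alpha> \<beta> :: ctble_ord
    using antisym REFL Rep_ctble_ord unfolding less_ctble_ord_def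
    by (metis less_eq_ctble_ord_def refl_on_def)
  show "\<alpha> \<le> \<alpha>" for \<alpha> :: ctble_ord
    using REFL Rep_ctble_ord unfolding less_eq_ctble_ord_def refl_on_def by blast
  show "\<alpha> \<le> \<beta> \<Longrightarrow> \<beta> \<le> \<gamma> \<Longrightarrow> \<alpha> \<le> \<gamma>" for \<alpha> \<beta> \<gamma> :: ctble_ord
    using TRANS unfolding less_eq_ctble_ord_def trans_def by blast
  show "\<alpha> \<le> \<beta> \<Longrightarrow> \<beta> \<le> \<alpha> \<Longrightarrow> \<alpha> = \<beta>" for \<alpha> \<beta> :: ctble_ord
    by (fact antisym)
  show "\<alpha> \<le> \<beta> \<or> \<beta> \<le> \<alpha>" for \<alpha> \<beta> :: ctble_ord
    using TOTALS Rep_ctble_ord unfolding less_eq_ctble_ord_def by blast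
  show "P \<alpha>" if step: "\<And>\<alpha>. (\<And>\<beta>. \<beta> < \<alpha> \<Longrightarrow> P \<beta>) \<Longrightarrow> P \<alpha>" for P and \<alpha> :: ctble_ord
  proof -
    have "wf (inv_image (?r - Id) Rep_ctble_ord)"
      using WF by (rule wf_inv_image)
    then show ?thesis
    proof (induction \<alpha> rule: wf_induct_rule)
      case (less \<alpha>)
      show ?case
      proof (rule step)
        fix \<beta> assume "\<beta> < \<alpha>"
        then have "(\<beta>, \<alpha>) \<in> inv_image (?r - Id) Rep_ctble_ord"
          by (simp add: less_ctble_ord_def less_eq_ctble_ord_def Rep_ctble_ord_inject)
        then show "P \<beta>" by (rule less)
      qed
    qed
  qed
qed

end

instantiation ctble_ord :: zero
begin
definition zero_ctble_ord :: ctble_ord where "(0 :: ctble_ord) = (LEAST \<alpha>. True)"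
instance ..
end

definition ord_suc :: "ctble_ord \<Rightarrow> ctble_ord" where
  "ord_suc \<alpha> = (LEAST \<beta>. \<alpha> < \<beta>)"

text \<open>\<open>omega_times k\<close> is \<open>\<omega> \<cdot> k\<close>, with \<open>\<omega> \<cdot> (k + 1) = \<omega> \<cdot> k + \<omega>\<close> the supremum of the \<open>\<omega> \<cdot> k + n\<close>.\<close>

primrec omega_times :: "nat \<Rightarrow> ctble_ord" where
  "omega_times 0 = 0"
| "omega_times (Suc k) = (LEAST \<beta>. \<forall>n. (ord_suc ^^ n) (omega_times k) \<le> \<beta>)"

lemma zero_le_ctble_ord [simp]: "0 \<le> (\<alpha> :: ctble_ord)"
  unfolding zero_ctble_ord_def by (rule Least_le) simp

context
  includes cardinal_syntax
begin

lemma countable_lessThan_ctble_ord: "countable {..<\<alpha> :: ctble_ord}"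
proof -
  let ?r = "cardSuc natLeq"
  let ?U = "underS ?r (Rep_ctble_ord \<alpha>)"
  have "|?U| <o ?r"
    by (rule card_of_underS[OF cardSuc_Card_order[OF natLeq_Card_order] Rep_ctble_ord])
  then have "|?U| \<le>o natLeq"
    using cardSuc_ordLeq_ordLess[OF natLeq_Card_order card_of_Card_order] by blast
  then have "|?U| \<le>o |UNIV :: nat set|"
    using card_of_nat ordIso_symmetric ordLeq_ordIso_trans by blast
  then have "countable ?U"
    by (metis card_of_ordLeq countableI')
  moreover have "Rep_ctble_ord ` {..<\<alpha>} \<subseteq> ?U"
    by (auto simp: underS_def less_ctble_ord_def less_eq_ctble_ord_def Rep_ctble_ord_inject)
  ultimately have "countable (Rep_ctble_ord ` {..<\<alpha>})"
    using countable_subset by blast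
  then show ?thesis
    by (rule countable_image_inj_on) (simp add: inj_on_def Rep_ctble_ord_inject)
qed

lemma uncountable_ctble_ord: "uncountable (UNIV :: ctble_ord set)"
proof
  assume "countable (UNIV :: ctble_ord set)"
  then have "countable (range Rep_ctble_ord)" by blast
  then have "countable (Field (cardSuc natLeq))"
    by (simp add: type_definition.Rep_range[OF type_definition_ctble_ord])
  then have "|Field (cardSuc natLeq)| \<le>o |UNIV :: nat set|"
    by (metis card_of_ordLeq countable_def subset_UNIV)
  then have "cardSuc natLeq \<le>o natLeq"
    using card_of_Field_ordIso[OF cardSuc_Card_order[OF natLeq_Card_order]] card_of_nat
    by (meson ordIso_ordLeq_trans ordIso_symmetric ordLeq_ordIso_trans)
  then show False
    using cardSuc_greater[OF natLeq_Card_order] not_ordLess_ordLeq by blast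
qed

end

lemma countable_bounded_ctble_ord:
  assumes "countable (A :: ctble_ord set)"
  shows "\<exists>\<beta>. \<forall>\<alpha>\<in>A. \<alpha> < \<beta>"
proof (rule ccontr)
  assume "\<nexists>\<beta>. \<forall>\<alpha>\<in>A. \<alpha> < \<beta>"
  then have "(UNIV :: ctble_ord set) \<subseteq> (\<Union>\<alpha>\<in>A. insert \<alpha> {..<\<alpha>})"
    by (force simp: not_less le_less)
  moreover have "countable (\<Union>\<alpha>\<in>A. insert \<alpha> {..<\<alpha>})"
    using assms countable_lessThan_ctble_ord by blast
  ultimately show False
    using uncountable_ctble_ord countable_subset by blast
qed

lemma less_ord_suc: "\<alpha> < ord_suc \<alpha>"
  unfolding ord_suc_def
  using countable_bounded_ctble_ord[of "{\<alpha>}"] by (auto intro: LeastI_ex)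

lemma less_ord_suc_iff: "\<alpha> < ord_suc \<beta> \<longleftrightarrow> \<alpha> \<le> \<beta>"
  using less_ord_suc[of \<beta>] not_less_Least[of \<alpha> "\<lambda>\<gamma>. \<beta> < \<gamma>"]
  unfolding ord_suc_def[symmetric] by force

lemma ord_suc_inject [simp]: "ord_suc \<alpha> = ord_suc \<beta> \<longleftrightarrow> \<alpha> = \<beta>"
  by (metis less_ord_suc less_ord_suc_iff order_antisym)

lemma ord_suc_neq_0 [simp]: "ord_suc \<alpha> \<noteq> 0"
  by (metis less_ord_suc not_less zero_le_ctble_ord)

lemma omega_times_Suc_upper: "(ord_suc ^^ n) (omega_times k) \<le> omega_times (Suc k)"
proof -
  have "\<exists>\<beta>. \<forall>n. (ord_suc ^^ n) (omega_times k) \<le> \<beta>"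
    using countable_bounded_ctble_ord[of "range (\<lambda>n. (ord_suc ^^ n) (omega_times k))"]
    by (auto intro: less_imp_le)
  then show ?thesis
    unfolding omega_times.simps by (rule LeastI2_ex) blast
qed

section \<open>Iterated derivatives and height\<close>

function tree_deriv_iter :: "ctble_ord \<Rightarrow> 'a list set \<Rightarrow> 'a list set" where
  "tree_deriv_iter \<alpha> S =
     (if \<alpha> = 0 then S
      else if \<exists>\<beta>. \<alpha> = ord_suc \<beta> then tree_deriv (tree_deriv_iter (THE \<beta>. \<alpha> = ord_suc \<beta>) S)
      else (\<Inter>\<beta>\<in>{..<\<alpha>}. tree_deriv_iter \<beta> S))"
  by pat_completeness auto
termination
  by (relation "inv_image {(\<alpha>, \<beta>). \<alpha> < \<beta>} fst") (auto simp: wf less_ord_suc)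

declare tree_deriv_iter.simps [simp del]

lemma tree_deriv_iter_0: "tree_deriv_iter 0 S = S"
  by (subst tree_deriv_iter.simps) simp

lemma tree_deriv_iter_suc: "tree_deriv_iter (ord_suc \<alpha>) S = tree_deriv (tree_deriv_iter \<alpha> S)"
  by (subst tree_deriv_iter.simps) simp

lemma tree_deriv_iter_limit:
  assumes "\<alpha> \<noteq> 0" and "\<nexists>\<beta>. \<alpha> = ord_suc \<beta>"
  shows "tree_deriv_iter \<alpha> S = (\<Inter>\<beta>\<in>{..<\<alpha>}. tree_deriv_iter \<beta> S)"
  using assms by (subst tree_deriv_iter.simps) simp

lemma tree_deriv_iter_antimono:
  "\<alpha> \<le> \<beta> \<Longrightarrow> tree_deriv_iter \<beta> S \<subseteq> tree_deriv_iter \<alpha> S"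
proof (induction \<beta> arbitrary: \<alpha> rule: less_induct)
  case (less \<beta>)
  consider "\<alpha> = \<beta>" | \<gamma> where "\<alpha> < \<beta>" "\<beta> = ord_suc \<gamma>" | "\<alpha> < \<beta>" "\<nexists>\<gamma>. \<beta> = ord_suc \<gamma>"
    using less.prems by fastforce
  then show ?case
  proof cases
    case 2
    then have "tree_deriv_iter \<gamma> S \<subseteq> tree_deriv_iter \<alpha> S"
      using less.IH less_ord_suc less_ord_suc_iff by blast
    then show ?thesis
      using 2 by (auto simp: tree_deriv_iter_suc tree_deriv_def)
  next
    case 3
    then have "\<beta> \<noteq> 0" by (metis not_less zero_le_ctble_ord)
    with 3 show ?thesis by (auto simp: tree_deriv_iter_limit)
  qed simp
qed

lemma tree_deriv_iter_stable:
  assumes "countable S"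
  shows "\<exists>\<alpha>. tree_deriv_iter (ord_suc \<alpha>) S = tree_deriv_iter \<alpha> S"
proof (rule ccontr)
  assume "\<nexists>\<alpha>. tree_deriv_iter (ord_suc \<alpha>) S = tree_deriv_iter \<alpha> S"
  then have "\<forall>\<alpha>. \<exists>\<sigma>. \<sigma> \<in> tree_deriv_iter \<alpha> S - tree_deriv_iter (ord_suc \<alpha>) S"
    using tree_deriv_iter_antimono[OF less_imp_le[OF less_ord_suc]] by blast
  then obtain f where f: "\<And>\<alpha>. f \<alpha> \<in> tree_deriv_iter \<alpha> S - tree_deriv_iter (ord_suc \<alpha>) S"
    by metis
  have neq: "f \<alpha> \<noteq> f \<beta>" if "\<alpha> < \<beta>" for \<alpha> \<beta>
  proof -
    have "ord_suc \<alpha> \<le> \<beta>"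
      using that unfolding ord_suc_def by (rule Least_le)
    then have "f \<beta> \<in> tree_deriv_iter (ord_suc \<alpha>) S"
      using f[of \<beta>] tree_deriv_iter_antimono[of "ord_suc \<alpha>" \<beta> S] by blast
    then show ?thesis using f[of \<alpha>] by auto
  qed
  then have "inj f" by (metis injI linorder_neqE)
  moreover have "range f \<subseteq> S"
    using f tree_deriv_iter_antimono[OF zero_le_ctble_ord] by (fastforce simp: tree_deriv_iter_0)
  ultimately show False
    using assms uncountable_ctble_ord countable_image_inj_on[of f UNIV]
      countable_subset[of "range f" S] by simp
qed

definition ht :: "'a list set \<Rightarrow> ctble_ord" where
  "ht S = (LEAST \<alpha>. tree_deriv_iter (ord_suc \<alpha>) S = tree_deriv_iter \<alpha> S)"

end

theory Submission
  imports Defs "HOL-Number_Theory.Cong" "HOL-Library.Nat_Bijection"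
begin

text \<open>
  Suppose that, for a prime \<open>p\<close>, the quotients \<open>N\<^sub>j / N\<^sub>j\<^sub>+\<^sub>1\<close> of consecutive level subgroups have an
  infinite \<open>p\<close>-socle for infinitely many \<open>j\<close>. Then there are elements \<open>x\<^sub>s\<close> of \<open>G\<close>, indexed by the
  finite sequences \<open>s\<close> of naturals, which lie in deeper and deeper levels as the length of \<open>s\<close> grows
  and are independent modulo \<open>p\<close>. For a set \<open>T\<close> of finite sequences consider the truncated sums of
  the \<open>a\<^sub>s x\<^sub>s\<close> where \<open>a\<close> is supported on \<open>T\<close>, the coefficient of each node is modulo \<open>p\<close> the sum of
  those of its children, and the coefficient at the root is \<open>0\<close> or \<open>1\<close> modulo \<open>p\<close>. An element of \<open>G\<close>
  translates the first family of sums to the second if and only if \<open>T\<close> has an infinite branch. Having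
  an infinite branch is not a Borel property, so \<open>G\<close> would not be tame.

  Hence for each \<open>p\<close> almost all of these socles are finite, which gives the descending chain condition
  for the \<open>p\<close>-parts of these quotients. Let \<open>S\<close> be a group tree and \<open>K\<close> the subtree of sequences with
  trivial first entry. The \<open>p\<close>-part of \<open>D\<^sup>\<omega>(K)\<close> has the extension property from some level on,
  so \<open>D\<^sup>\<omega>\<^sup>\<cdot>\<^sup>2(K)\<close> is pruned, and \<open>D\<^sup>\<omega>\<^sup>\<cdot>\<^sup>3(S)\<close> is pruned because the fibres over the
  first entry are cosets of \<open>K\<close>. For a coset tree the same derivative is pruned or has an empty level.
\<close>

section \<open>Non-measurability of ill-foundedness\<close>

text \<open>The quotient of \<open>G\<close> by its first level subgroup need not be torsion, so the
  filtration \<open>N\<close> starts with the level subgroup of index 1 and the first coordinate is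
  treated separately; this costs the third limit. The second limit is needed because the level from
  which the \<open>p\<close>-socles are finite depends on \<open>p\<close>: a node of
  \<open>p\<close>-power order is first approximated beyond that level, and only then are the primes
  recombined by Bezout.

  The delicate point is the choice of the independent elements. For a new element \<open>w\<close>
  the multiple \<open>p w\<close> may agree, modulo a deeper level, with a combination of the old
  elements, and then a relation with coefficient \<open>p\<close> at \<open>w\<close> need not have
  all its coefficients divisible by \<open>p\<close>. This is prevented by requiring
  \<open>p w\<close> to lie in subgroups \<open>B m\<close> that meet the span of the old elements
  only in its \<open>p\<close>-multiples. They are chosen maximal, so that the quotients by them
  have finite socles; hence an infinite socle at the current level still offers a suitable
  \<open>w\<close>.

  Tameness is applied to a continuous action on the power set of a countable set of cosets, on which
  \<open>G\<close> acts with open stabilisers.\<close>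

definition ill_founded :: "'a list set \<Rightarrow> bool" where
  "ill_founded T \<longleftrightarrow> (\<exists>f. \<forall>n. map f [0..<n] \<in> T)"

definition member_algebra :: "'i set \<Rightarrow> 'i set measure" where
  "member_algebra I = sigma UNIV ((\<lambda>i. {S. i \<in> S}) ` I)"

text \<open>Index \<open>0\<close> stands for the whole space, so that a scheme need not impose a condition at every node.\<close>

definition basic_set :: "nat \<Rightarrow> nat list set set" where
  "basic_set k = (if k = 0 then UNIV else if even k then {y. from_nat (k div 2 - 1) \<in> y}
     else {y. from_nat (k div 2) \<notin> y})"

definition souslin :: "(nat list \<Rightarrow> nat) \<Rightarrow> nat list set set" where
  "souslin c = {y. \<exists>f. \<forall>n. y \<in> basic_set (c (map f [0..<n]))}"

section \<open>Closure properties of Souslin sets\<close>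

lemma souslin_basic: "souslin (\<lambda>s. k) = basic_set k"
  by (auto simp: souslin_def)

text \<open>The first entry of the argument selects a member of the union; the remaining entries are
  the argument for that member.\<close>

lemma souslin_Union:
  fixes c :: "nat \<Rightarrow> nat list \<Rightarrow> nat"
  shows "\<exists>c'. souslin c' = (\<Union>i. souslin (c i))"
proof -
  \<comment> \<open>At the root no member is selected yet, so it gets index \<open>0\<close> and
    imposes no condition.\<close>
  let ?c = "\<lambda>s. case s of [] \<Rightarrow> 0 | i # s' \<Rightarrow> c i s'"
  have *: "(\<forall>n. y \<in> basic_set (?c (map f [0..<n]))) \<longleftrightarrow>
    (\<forall>n. y \<in> basic_set (c (f 0) (map (\<lambda>k. f (Suc k)) [0..<n])))" (is "?l \<longleftrightarrow> ?r") for y f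
  proof -
    have m: "map f [0..<Suc n] = f 0 # map (\<lambda>k. f (Suc k)) [0..<n]" for n
      by (simp only: map_upt_Suc)
    have "?l \<longleftrightarrow> y \<in> basic_set (?c (map f [0..<0])) \<and>
        (\<forall>n. y \<in> basic_set (?c (map f [0..<Suc n])))"
      by (metis not0_implies_Suc)
    also have "\<dots> \<longleftrightarrow> ?r"
      unfolding m by (simp add: basic_set_def)
    finally show ?thesis .
  qed
  have "souslin ?c = (\<Union>i. souslin (c i))"
  proof (intro equalityI subsetI)
    fix y assume "y \<in> souslin ?c"
    then show "y \<in> (\<Union>i. souslin (c i))"
      unfolding souslin_def mem_Collect_eq * by blast
  next
    fix y assume "y \<in> (\<Union>i. souslin (c i))"
    then obtain i f where f: "\<forall>n. y \<in> basic_set (c i (map f [0..<n]))"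
      unfolding souslin_def by blast
    let ?f = "\<lambda>k. case k of 0 \<Rightarrow> i | Suc k \<Rightarrow> f k"
    have "\<forall>n. y \<in> basic_set (?c (map ?f [0..<n]))"
      unfolding * using f by simp
    then show "y \<in> souslin ?c" unfolding souslin_def by blast
  qed
  then show ?thesis by blast
qed

text \<open>Ensures that a node of length \<open>prod_encode (i, n)\<close> already contains the
  first \<open>n\<close> entries of the \<open>i\<close>-th of the sequences interleaved by the
  pairing function.\<close>

lemma prod_encode_strict_mono: "j < n \<Longrightarrow> prod_encode (i, j) < prod_encode (i, n)"
proof (induction n)
  case (Suc n)
  have "prod_encode (i, n) < prod_encode (i, Suc n)"
    by (simp add: prod_encode_def)
  with Suc show ?case by (auto simp: less_Suc_eq)
qed simp

text \<open>One sequence interleaves an argument for every \<open>i\<close>. Each length is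
  \<open>prod_encode (i, n)\<close> for exactly one pair, and the nodes of this length carry the
  condition of the \<open>i\<close>-th scheme at depth \<open>n\<close>.\<close>

lemma souslin_Inter:
  fixes c :: "nat \<Rightarrow> nat list \<Rightarrow> nat"
  shows "\<exists>c'. souslin c' = (\<Inter>i. souslin (c i))"
proof -
  define sel where "sel i n s = map (\<lambda>j. s ! prod_encode (i, j)) [0..<n]" for i n and s :: "nat list"
  define c' where "c' s = (case prod_decode (length s) of (i, n) \<Rightarrow> c i (sel i n s))" for s
  have sel: "sel i n (map f [0..<prod_encode (i, n)]) = map (\<lambda>j. f (prod_encode (i, j))) [0..<n]"
    for i n and f :: "nat \<Rightarrow> nat"
    using prod_encode_strict_mono[of _ n i] by (simp add: sel_def)
  have *: "(\<forall>n. y \<in> basic_set (c' (map f [0..<n]))) \<longleftrightarrow>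
    (\<forall>i n. y \<in> basic_set (c i (map (\<lambda>j. f (prod_encode (i, j))) [0..<n])))" (is "?l \<longleftrightarrow> ?r") for y f
  proof
    assume l: ?l
    show ?r
    proof (intro allI)
      fix i n
      show "y \<in> basic_set (c i (map (\<lambda>j. f (prod_encode (i, j))) [0..<n]))"
        using l[rule_format, of "prod_encode (i, n)"] by (simp add: c'_def sel del: map_map)
    qed
  next
    assume r: ?r
    show ?l
    proof
      fix m
      obtain i n where "m = prod_encode (i, n)" by (metis prod_decode_inverse surj_pair)
      then show "y \<in> basic_set (c' (map f [0..<m]))"
        using r by (simp add: c'_def sel del: map_map)
    qed
  qed
  have "souslin c' = (\<Inter>i. souslin (c i))"
  proof (intro equalityI subsetI)
    fix y assume "y \<in> souslin c'"
    then show "y \<in> (\<Inter>i. souslin (c i))"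
      unfolding souslin_def mem_Collect_eq * by blast
  next
    fix y assume "y \<in> (\<Inter>i. souslin (c i))"
    then have "\<forall>i. \<exists>f. \<forall>n. y \<in> basic_set (c i (map f [0..<n]))"
      unfolding souslin_def by blast
    then obtain f where f: "\<And>i n. y \<in> basic_set (c i (map (f i) [0..<n]))"
      by metis
    have "\<forall>n. y \<in> basic_set (c' (map (\<lambda>k. case prod_decode k of (i, j) \<Rightarrow> f i j) [0..<n]))"
      unfolding * using f by simp
    then show "y \<in> souslin c'" unfolding souslin_def by blast
  qed
  then show ?thesis by blast
qed

text \<open>Souslin sets are closed under countable unions and intersections but not under
  complements, so the induction over the sigma-algebra carries the complement along.\<close>

lemma measurable_imp_souslin:
  assumes "A \<in> sets (member_algebra UNIV)"
  shows "(\<exists>c. souslin c = A) \<and> (\<exists>c. souslin c = - A)"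
proof -
  have "A \<in> sigma_sets UNIV (range (\<lambda>i. {S. i \<in> S}))"
    using assms by (simp add: member_algebra_def)
  then show ?thesis
  proof induction
    case (Basic A)
    then obtain s :: "nat list" where A: "A = {S. s \<in> S}" by blast
    have "souslin (\<lambda>_. 2 * to_nat s + 2) = A" "souslin (\<lambda>_. 2 * to_nat s + 1) = - A"
      by (auto simp: souslin_basic basic_set_def A)
    then show ?case by blast
  next
    case Empty
    have "souslin (\<lambda>_. 0) = - {}"
      by (auto simp: souslin_basic basic_set_def)
    \<comment> \<open>The root requires \<open>[]\<close> to be an element and every longer node
      forbids it, so no branch satisfies all conditions.\<close>
    moreover have "souslin (\<lambda>s. if s = [] then 2 * to_nat ([] :: nat list) + 2 else 2 * to_nat ([] :: nat list) + 1) = {}"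
    proof -
      have "\<not> (\<forall>n. y \<in> basic_set (if map f [0..<n] = [] then 2 * to_nat ([] :: nat list) + 2
          else 2 * to_nat ([] :: nat list) + 1))" for y and f :: "nat \<Rightarrow> nat"
      proof
        assume a: "\<forall>n. y \<in> basic_set (if map f [0..<n] = [] then 2 * to_nat ([] :: nat list) + 2
          else 2 * to_nat ([] :: nat list) + 1)"
        show False using a[rule_format, of 0] a[rule_format, of 1] by (auto simp: basic_set_def)
      qed
      then show ?thesis unfolding souslin_def by blast
    qed
    ultimately show ?case by blast
  next
    case (Compl A)
    then show ?case by (simp add: Compl_eq_Diff_UNIV[symmetric])
  next
    case (Union A)
    then have "\<forall>i. \<exists>c. souslin c = A i" "\<forall>i. \<exists>c. souslin c = - A i" by auto
    then obtain c d where "\<And>i. souslin (c i) = A i" "\<And>i. souslin (d i) = - A i" by metis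
    then have "(\<Union>i. A i) = (\<Union>i. souslin (c i))" "- (\<Union>i. A i) = (\<Inter>i. souslin (d i))" by auto
    then show ?case using souslin_Union[of c] souslin_Inter[of d] by auto
  qed
qed

lemma basic_set_measurable: "basic_set k \<in> sets (member_algebra UNIV)"
proof -
  have *: "{y. s \<in> y} \<in> sets (member_algebra UNIV)" for s :: "nat list"
    by (auto simp: member_algebra_def)
  have sp: "space (member_algebra UNIV) = (UNIV :: nat list set set)"
    by (simp add: member_algebra_def space_measure_of_conv)
  have "- {y. s \<in> y} \<in> sets (member_algebra UNIV)" for s :: "nat list"
    using sets.compl_sets[OF *[of s]] by (simp add: sp Compl_eq_Diff_UNIV)
  then have "{y. s \<notin> y} \<in> sets (member_algebra UNIV)" for s :: "nat list"
    by (simp add: Compl_eq)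
  with * show ?thesis
    using sets.top[of "member_algebra (UNIV :: nat list set)"]
    unfolding basic_set_def sp by auto
qed

text \<open>Diagonal argument: a point codes both a Souslin scheme and an argument for it.\<close>

theorem ill_founded_not_measurable:
  "{T :: nat list set. ill_founded T} \<notin> sets (member_algebra UNIV)"
proof
  assume IF: "{T :: nat list set. ill_founded T} \<in> sets (member_algebra UNIV)"
  let ?M = "member_algebra (UNIV :: nat list set)"
  have sp: "space (member_algebra UNIV) = (UNIV :: nat list set set)"
    by (simp add: member_algebra_def space_measure_of_conv)
  \<comment> \<open>A point \<open>y\<close> attaches to the node \<open>s\<close> the labels
    \<open>k\<close> with \<open>k # s\<close> in \<open>y\<close>. The set \<open>tr y\<close>
    keeps the nodes having a label whose condition \<open>y\<close> itself satisfies.\<close>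
  define tr where "tr y = {s. \<exists>k. k # s \<in> y \<and> y \<in> basic_set k}" for y :: "nat list set"
  have gen: "{y. s \<in> y} \<in> sets ?M" for s by (auto simp: member_algebra_def)
  have "tr \<in> ?M \<rightarrow>\<^sub>M ?M"
    unfolding member_algebra_def[of UNIV]
  proof (rule measurable_measure_of, goal_cases)
    case (3 A)
    then obtain s where A: "A = {S. s \<in> S}" by blast
    have "tr -` A = (\<Union>k. {y. k # s \<in> y} \<inter> basic_set k)"
      by (auto simp: A tr_def)
    also have "\<dots> \<in> sets ?M"
      using gen basic_set_measurable by (intro sets.countable_UN sets.Int) auto
    finally show ?case by (simp add: space_measure_of_conv member_algebra_def)
  qed auto
  then have "tr -` {T. ill_founded T} \<inter> space ?M \<in> sets ?M"
    using IF by (rule measurable_sets)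
  then have "{y. ill_founded (tr y)} \<in> sets ?M"
    by (simp add: sp vimage_def)
  then obtain c where c: "souslin c = - {y. ill_founded (tr y)}"
    using measurable_imp_souslin by blast
  \<comment> \<open>This point attaches exactly the label \<open>c s\<close> to \<open>s\<close>. A
    branch of \<open>tr y\<close> is therefore an argument for \<open>y\<close> in
    \<open>souslin c\<close>, which by the choice of \<open>c\<close> says that there is no such
    branch.\<close>
  define y where "y = range (\<lambda>s. c s # s)"
  have "tr y = {s. y \<in> basic_set (c s)}"
    by (auto simp: tr_def y_def)
  then have "ill_founded (tr y) \<longleftrightarrow> y \<in> souslin c"
    by (simp add: ill_founded_def souslin_def)
  then show False using c by auto
qed

section \<open>Orbit equivalence relations of tame groups\<close>

text \<open>The power set of \<open>I\<close> with its product topology, carried by an injection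
  \<open>e\<close> to a set of reals because \<open>tame\<close> speaks about Polish topologies on
  sets of reals.\<close>

definition power_topology :: "('i set \<Rightarrow> real) \<Rightarrow> 'i set \<Rightarrow> real topology" where
  "power_topology e I = pullback_topology (e ` Pow I) (\<lambda>r. \<lambda>i\<in>I. i \<in> inv_into (Pow I) e r)
     (product_topology (\<lambda>_. discrete_topology UNIV) I)"

lemma topspace_power_topology: "topspace (power_topology e I) = e ` Pow I"
  by (auto simp: power_topology_def topspace_pullback_topology)

text \<open>Subsets have neighbourhood bases of cylinders, each fixing the membership of finitely
  many indices. Continuity and measurability are checked below in this form.\<close>

lemma openin_power_topology:
  assumes e: "inj_on e (Pow I)"
  shows "openin (power_topology e I) V \<longleftrightarrow> V \<subseteq> e ` Pow I \<and>
    (\<forall>S. S \<subseteq> I \<and> e S \<in> V \<longrightarrow> (\<exists>F. finite F \<and> F \<subseteq> I \<and> (\<forall>S'. S' \<subseteq> I \<and> S' \<inter> F = S \<inter> F \<longrightarrow> e S' \<in> V)))"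
    (is "?l \<longleftrightarrow> ?r")
proof
  let ?f = "\<lambda>r. \<lambda>i\<in>I. i \<in> inv_into (Pow I) e r"
  have f: "?f (e S) = (\<lambda>i\<in>I. i \<in> S)" if "S \<subseteq> I" for S
    using e that by (simp add: inv_into_f_f)
  {
    assume ?l
    then obtain W where W: "openin (product_topology (\<lambda>_. discrete_topology UNIV) I) W"
      and V: "V = ?f -` W \<inter> e ` Pow I"
      unfolding power_topology_def openin_pullback_topology by blast
    show ?r
    proof (intro conjI allI impI)
      show "V \<subseteq> e ` Pow I" using V by blast
      fix S assume S: "S \<subseteq> I \<and> e S \<in> V"
      then have "?f (e S) \<in> W" using V by blast
      then have "(\<lambda>i\<in>I. i \<in> S) \<in> W" using S f[of S] by simp
      then obtain U where U: "finite {i \<in> I. U i \<noteq> UNIV}" "(\<lambda>i\<in>I. i \<in> S) \<in> Pi\<^sub>E I U" "Pi\<^sub>E I U \<subseteq> W"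
        using W[unfolded openin_product_topology_alt] by auto
      show "\<exists>F. finite F \<and> F \<subseteq> I \<and> (\<forall>S'. S' \<subseteq> I \<and> S' \<inter> F = S \<inter> F \<longrightarrow> e S' \<in> V)"
      proof (intro exI conjI allI impI)
        show "finite {i \<in> I. U i \<noteq> UNIV}" by fact
        fix S' assume S': "S' \<subseteq> I \<and> S' \<inter> {i \<in> I. U i \<noteq> UNIV} = S \<inter> {i \<in> I. U i \<noteq> UNIV}"
        have "(\<lambda>i\<in>I. i \<in> S') \<in> Pi\<^sub>E I U"
        proof (rule PiE_I)
          fix i assume i: "i \<in> I"
          show "(\<lambda>i\<in>I. i \<in> S') i \<in> U i"
          proof (cases "U i = UNIV")
            case False
            then have "i \<in> S' \<longleftrightarrow> i \<in> S" using S' i by blast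
            moreover have "(\<lambda>i\<in>I. i \<in> S) i \<in> U i" using U(2) i by (rule PiE_mem)
            ultimately show ?thesis using i by simp
          qed simp
        qed simp
        then have "(\<lambda>i\<in>I. i \<in> S') \<in> W" using U by blast
        then show "e S' \<in> V" using V S' f[of S'] by auto
      qed blast
    qed
  }
  assume r: ?r
  define W where "W = {h \<in> extensional I. e {i \<in> I. h i} \<in> V}"
  have "openin (product_topology (\<lambda>_. discrete_topology UNIV) I) W"
    unfolding openin_product_topology_alt
  proof
    fix h assume h: "h \<in> W"
    then obtain F where F: "finite F" "F \<subseteq> I"
      "\<forall>S'. S' \<subseteq> I \<and> S' \<inter> F = {i \<in> I. h i} \<inter> F \<longrightarrow> e S' \<in> V"
      using r[THEN conjunct2, THEN spec, of "{i \<in> I. h i}"] unfolding W_def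
      by (elim impE exE conjE) auto
    let ?U = "\<lambda>i. if i \<in> F then {h i} else UNIV"
    have "Pi\<^sub>E I ?U \<subseteq> W"
    proof
      fix h' assume h': "h' \<in> Pi\<^sub>E I ?U"
      then have "h' i = h i" if "i \<in> F" for i
        using that F(2) PiE_mem[OF h', of i] by auto
      then have "{i \<in> I. h' i} \<inter> F = {i \<in> I. h i} \<inter> F" by auto
      then have "e {i \<in> I. h' i} \<in> V" using F(3) by simp
      then show "h' \<in> W" using h' by (simp add: W_def PiE_def)
    qed
    moreover have "finite {i \<in> I. ?U i \<noteq> topspace (discrete_topology UNIV)}"
      by (rule finite_subset[OF _ F(1)]) auto
    moreover have "h \<in> Pi\<^sub>E I ?U" using h by (auto simp: W_def PiE_def)
    ultimately show "\<exists>U. finite {i \<in> I. U i \<noteq> topspace (discrete_topology UNIV)} \<and>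
        (\<forall>i\<in>I. openin (discrete_topology UNIV) (U i)) \<and> h \<in> Pi\<^sub>E I U \<and> Pi\<^sub>E I U \<subseteq> W"
      by (intro exI[of _ ?U]) auto
  qed
  moreover have "V = ?f -` W \<inter> e ` Pow I"
  proof -
    have "e S \<in> V \<longleftrightarrow> ?f (e S) \<in> W" if "S \<subseteq> I" for S
    proof -
      have "{i \<in> I. (\<lambda>i\<in>I. i \<in> S) i} = S" using that by auto
      then show ?thesis unfolding f[OF that] W_def by auto
    qed
    then show ?thesis using r by auto
  qed
  ultimately show ?l
    unfolding power_topology_def openin_pullback_topology by blast
qed

lemma homeomorphic_power_topology:
  assumes e: "inj_on e (Pow I)"
  shows "power_topology e I homeomorphic_space product_topology (\<lambda>_. discrete_topology (UNIV :: bool set)) I"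
proof -
  let ?f = "\<lambda>r. \<lambda>i\<in>I. i \<in> inv_into (Pow I) e r"
  let ?P = "product_topology (\<lambda>_. discrete_topology (UNIV :: bool set)) I"
  let ?g = "\<lambda>h. e {i \<in> I. h i}"
  have 1: "continuous_map (power_topology e I) ?P ?f"
    unfolding power_topology_def
    using continuous_map_pullback[OF continuous_map_id, of "e ` Pow I" ?f ?P] by simp
  have fg: "?f (?g h) = h" if "h \<in> topspace ?P" for h
  proof -
    have "inv_into (Pow I) e (?g h) = {i \<in> I. h i}"
      by (rule inv_into_f_f[OF e]) blast
    then show ?thesis using that by (auto simp: fun_eq_iff PiE_def extensional_def)
  qed
  have "continuous_map ?P ?P (?f \<circ> ?g)"
    by (rule continuous_map_eq[OF continuous_map_id]) (use fg in auto)
  then have 2: "continuous_map ?P (power_topology e I) ?g"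
    unfolding power_topology_def by (rule continuous_map_pullback') auto
  have gf: "?g (?f r) = r" if "r \<in> topspace (power_topology e I)" for r
  proof -
    have "inv_into (Pow I) e r \<in> Pow I"
      using that unfolding topspace_power_topology by (rule inv_into_into)
    then have "{i \<in> I. ?f r i} = inv_into (Pow I) e r" by auto
    then show ?thesis using that by (simp add: f_inv_into_f topspace_power_topology)
  qed
  show ?thesis
    unfolding homeomorphic_space_def homeomorphic_maps_def using 1 2 fg gf by blast
qed

lemma polish_power_topology:
  assumes e: "inj_on e (Pow I)" and I: "countable I"
  shows "polish_topology (power_topology e I)"
  unfolding polish_topology_def
proof
  show "completely_metrizable_space (power_topology e I)"
    unfolding homeomorphic_completely_metrizable_space[OF homeomorphic_power_topology[OF e]]
    unfolding completely_metrizable_space_product_topology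
    using I by (simp add: completely_metrizable_space_discrete_topology)
  \<comment> \<open>The finite subsets are dense: a cylinder around \<open>S\<close> that fixes the
    indices in a finite \<open>F\<close> contains \<open>S \<inter> F\<close>.\<close>
  let ?C = "e ` {S. S \<subseteq> I \<and> finite S}"
  have dense: "r \<in> (power_topology e I) closure_of ?C" if r: "r \<in> topspace (power_topology e I)" for r
    unfolding in_closure_of
  proof (intro conjI allI impI r)
    fix V assume V: "r \<in> V \<and> openin (power_topology e I) V"
    obtain S where S: "S \<subseteq> I" "r = e S" using r by (auto simp: topspace_power_topology)
    then obtain F where F: "finite F" "F \<subseteq> I" "\<And>S'. S' \<subseteq> I \<Longrightarrow> S' \<inter> F = S \<inter> F \<Longrightarrow> e S' \<in> V"
      using V[THEN conjunct2, unfolded openin_power_topology[OF e], THEN conjunct2, THEN spec, of S] V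
      by (elim impE exE conjE) auto
    have "e (S \<inter> F) \<in> V" by (rule F(3)) (use F in auto)
    moreover have "e (S \<inter> F) \<in> ?C" using F(1) S(1) by (intro imageI) auto
    ultimately show "\<exists>y. y \<in> ?C \<and> y \<in> V" by (intro exI conjI)
  qed
  have "(power_topology e I) closure_of ?C = topspace (power_topology e I)"
    by (intro equalityI[OF closure_of_subset_topspace] subsetI dense)
  moreover have "countable ?C"
    using countable_Collect_finite_subset[OF I] by (simp add: conj_commute)
  moreover have "?C \<subseteq> topspace (power_topology e I)" by (auto simp: topspace_power_topology)
  ultimately show "separable_space (power_topology e I)"
    unfolding separable_space_def by (intro exI conjI)
qed

lemma ex_inj_on_Pow_real:
  assumes "countable I"
  shows "\<exists>e :: 'i set \<Rightarrow> real. inj_on e (Pow I)"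
proof -
  obtain f :: "nat set \<Rightarrow> real" where f: "bij f"
    using nat_sets_eqpoll_reals unfolding eqpoll_def by blast
  obtain c :: "'i \<Rightarrow> nat" where "inj_on c I" using assms countable_def by blast
  then have "inj_on (image c) (Pow I)" by (rule inj_on_image_Pow)
  then have "inj_on (f \<circ> image c) (Pow I)"
    using f by (intro comp_inj_on) (auto simp: bij_def inj_on_def)
  then show ?thesis by blast
qed

lemma measurable_borel_of:
  assumes "\<And>y. y \<in> space M \<Longrightarrow> f y \<in> topspace X"
    and "\<And>U. openin X U \<Longrightarrow> f -` U \<inter> space M \<in> sets M"
  shows "f \<in> M \<rightarrow>\<^sub>M borel_of X"
  unfolding borel_of_def
  by (rule measurable_measure_of) (use assms in \<open>auto dest: openin_subset[THEN subsetD]\<close>)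

lemma space_borel_of: "space (borel_of X) = topspace X"
  by (simp add: borel_of_def space_measure_of_conv)

lemma openin_borel_of: "openin X U \<Longrightarrow> U \<in> sets (borel_of X)"
  unfolding borel_of_def by (subst sets_measure_of) (auto dest: openin_subset)

section \<open>The induced action on subsets\<close>

context group_action
begin

lemma image_image_action:
  assumes "S \<subseteq> E" "g \<in> carrier G" "h \<in> carrier G"
  shows "\<phi> (g \<otimes> h) ` S = \<phi> g ` \<phi> h ` S"
  unfolding image_image using composition_rule assms by (intro image_cong) auto

lemma mem_image_action:
  assumes "S \<subseteq> E" "g \<in> carrier G" "x \<in> E"
  shows "x \<in> \<phi> g ` S \<longleftrightarrow> \<phi> (inv g) x \<in> S"
proof
  assume "x \<in> \<phi> g ` S"
  then obtain y where y: "y \<in> S" "x = \<phi> g y" by blast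
  then show "\<phi> (inv g) x \<in> S" using orbit_sym_aux[of g y x] assms by auto
next
  interpret group G by (rule group_hom.axioms(1)[OF group_hom])
  assume *: "\<phi> (inv g) x \<in> S"
  have "\<phi> g (\<phi> (inv g) x) = x"
    using orbit_sym_aux[of "inv g" x "\<phi> (inv g) x"] assms by simp
  then show "x \<in> \<phi> g ` S" using * by (metis imageI)
qed

lemma image_action_one:
  assumes "S \<subseteq> E"
  shows "\<phi> \<one> ` S = S"
proof -
  have "\<phi> \<one> ` S = (\<lambda>x. x) ` S"
    using assms by (intro image_cong) (auto simp: id_eq_one[symmetric])
  then show ?thesis by simp
qed

lemma image_action_subset: "S \<subseteq> E \<Longrightarrow> g \<in> carrier G \<Longrightarrow> \<phi> g ` S \<subseteq> E"
  using surj_prop by blast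

end

text \<open>Restricted to the copy of the power set, since the elements of \<open>BijGroup\<close>
  are extensional functions.\<close>

definition power_action :: "('i set \<Rightarrow> real) \<Rightarrow> 'i set \<Rightarrow> ('g \<Rightarrow> 'i \<Rightarrow> 'i) \<Rightarrow> 'g \<Rightarrow> real \<Rightarrow> real" where
  "power_action e I \<phi> g = (\<lambda>r\<in>e ` Pow I. e (\<phi> g ` inv_into (Pow I) e r))"

lemma power_action_apply:
  "inj_on e (Pow I) \<Longrightarrow> S \<subseteq> I \<Longrightarrow> power_action e I \<phi> g (e S) = e (\<phi> g ` S)"
  by (simp add: power_action_def inv_into_f_f)

lemma power_action_group_action:
  fixes G (structure)
  assumes e: "inj_on e (Pow I)" and act: "group_action G I \<phi>"
  shows "group_action G (e ` Pow I) (power_action e I \<phi>)"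
proof -
  interpret group_action G I \<phi> by (rule act)
  interpret group G by (rule group_hom.axioms(1)[OF group_hom])
  let ?\<psi> = "power_action e I \<phi>"
  have inv: "?\<psi> h (?\<psi> g (e S)) = e S" if "S \<subseteq> I" "g \<in> carrier G" "h \<in> carrier G" "h \<otimes> g = \<one>" for S g h
    using that image_image_action[of S h g]
    by (simp add: power_action_apply[OF e] image_action_subset image_action_one)
  have bij: "?\<psi> g \<in> Bij (e ` Pow I)" if g: "g \<in> carrier G" for g
  proof -
    have maps: "?\<psi> h r \<in> e ` Pow I" if "r \<in> e ` Pow I" "h \<in> carrier G" for r h
      using that image_action_subset by (auto simp: power_action_apply[OF e])
    have "bij_betw (?\<psi> g) (e ` Pow I) (e ` Pow I)"
      by (rule bij_betwI[where g = "?\<psi> (inv g)"])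
        (use g maps in \<open>auto simp: inv\<close>)
    then show ?thesis by (simp add: Bij_def power_action_def)
  qed
  have "?\<psi> (g \<otimes> h) = compose (e ` Pow I) (?\<psi> g) (?\<psi> h)" if "g \<in> carrier G" "h \<in> carrier G" for g h
  proof (rule extensionalityI)
    show "?\<psi> (g \<otimes> h) \<in> extensional (e ` Pow I)" by (simp add: power_action_def)
    fix r assume "r \<in> e ` Pow I"
    then obtain S where S: "S \<subseteq> I" "r = e S" by auto
    then show "?\<psi> (g \<otimes> h) r = compose (e ` Pow I) (?\<psi> g) (?\<psi> h) r"
      using that by (simp add: compose_def power_action_apply[OF e] image_image_action image_action_subset)
  qed simp
  then have "?\<psi> \<in> hom G (BijGroup (e ` Pow I))"
    using bij by (auto simp: hom_def BijGroup_def)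
  then show ?thesis
    unfolding group_action_def group_hom_def group_hom_axioms_def
    by (simp add: group_BijGroup is_group)
qed

lemma mem_iff_of_Int_eq: "A \<inter> F = B \<inter> F \<Longrightarrow> x \<in> F \<Longrightarrow> x \<in> A \<longleftrightarrow> x \<in> B"
  by blast

text \<open>The action is even continuous. An index \<open>i\<close> lies in the image of
  \<open>S\<close> under \<open>g\<close> if and only if \<open>inv g\<close> moves it into
  \<open>S\<close>; so membership for \<open>i\<close> in a finite \<open>F\<close> depends only on
  the trace of \<open>S\<close> on the finite set of these preimages, and it is unchanged for all
  \<open>h\<close> that move the same preimages to the same indices. These \<open>h\<close> form an
  open set by \<open>op\<close>.\<close>

lemma power_action_borel:
  fixes G (structure)
  assumes e: "inj_on e (Pow I)" and act: "group_action G I \<phi>"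
    and T: "topspace T = carrier G"
    and op: "\<And>i j. i \<in> I \<Longrightarrow> j \<in> I \<Longrightarrow> openin T {g \<in> carrier G. \<phi> g i = j}"
  shows "borel_action G T (power_topology e I) (power_action e I \<phi>)"
  unfolding borel_action_def topspace_power_topology
proof
  show "group_action G (e ` Pow I) (power_action e I \<phi>)"
    by (rule power_action_group_action[OF e act])
  interpret group_action G I \<phi> by (rule act)
  interpret group G by (rule group_hom.axioms(1)[OF group_hom])
  let ?X = "power_topology e I" and ?\<psi> = "power_action e I \<phi>"
  show "(\<lambda>(g, x). ?\<psi> g x) \<in> borel_of (prod_topology T ?X) \<rightarrow>\<^sub>M borel_of ?X"
  proof (rule measurable_borel_of)
    show "(case y of (g, x) \<Rightarrow> ?\<psi> g x) \<in> topspace ?X" if "y \<in> space (borel_of (prod_topology T ?X))" for y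
      using that image_action_subset
      by (auto simp: space_borel_of topspace_power_topology T power_action_apply[OF e])
    fix U assume U: "openin ?X U"
    let ?W = "(\<lambda>(g, x). ?\<psi> g x) -` U \<inter> topspace (prod_topology T ?X)"
    have "openin (prod_topology T ?X) ?W"
      unfolding openin_prod_topology_alt
    proof (intro allI impI)
      fix g r assume gr: "(g, r) \<in> ?W"
      then obtain S where S: "S \<subseteq> I" "r = e S" and g: "g \<in> carrier G"
        by (auto simp: topspace_power_topology T)
      have gS: "\<phi> g ` S \<subseteq> I" by (rule image_action_subset[OF S(1) g])
      have "e (\<phi> g ` S) \<in> U" using gr S by (simp add: power_action_apply[OF e])
      then obtain F where F: "finite F" "F \<subseteq> I"
        "\<And>S'. S' \<subseteq> I \<Longrightarrow> S' \<inter> F = \<phi> g ` S \<inter> F \<Longrightarrow> e S' \<in> U"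
        using U[unfolded openin_power_topology[OF e], THEN conjunct2, THEN spec, of "\<phi> g ` S"] gS
        by (elim impE exE conjE) auto
      let ?A = "{h \<in> carrier G. \<forall>i\<in>F. \<phi> h (\<phi> (inv g) i) = i}"
      let ?F' = "\<phi> (inv g) ` F"
      let ?B = "{e S' |S'. S' \<subseteq> I \<and> S' \<inter> ?F' = S \<inter> ?F'}"
      have F': "?F' \<subseteq> I" by (rule image_action_subset) (use F g in auto)
      have "?A = carrier G \<inter> (\<Inter>i\<in>F. {h \<in> carrier G. \<phi> h (\<phi> (inv g) i) = i})" by auto
      moreover have "openin T \<dots>"
      proof (cases "F = {}")
        case True
        then show ?thesis using openin_topspace[of T] T by simp
      next
        case False
        have "openin T {h \<in> carrier G. \<phi> h (\<phi> (inv g) i) = i}" if "i \<in> F" for i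
          by (rule op) (use that F(2) F' in auto)
        then show ?thesis
          using False F(1) T openin_topspace[of T] by (intro openin_Int openin_INT2) simp_all
      qed
      ultimately have A: "openin T ?A" by simp
      have B: "openin ?X ?B"
        unfolding openin_power_topology[OF e]
      proof (intro conjI allI impI)
        fix S' assume S': "S' \<subseteq> I \<and> e S' \<in> ?B"
        then have "S' \<inter> ?F' = S \<inter> ?F'" using e by (auto dest: inj_onD)
        then show "\<exists>F. finite F \<and> F \<subseteq> I \<and> (\<forall>S''. S'' \<subseteq> I \<and> S'' \<inter> F = S' \<inter> F \<longrightarrow> e S'' \<in> ?B)"
          using F' F(1) by (intro exI[of _ ?F']) auto
      qed auto
      have gA: "g \<in> ?A"
      proof -
        have "\<phi> g (\<phi> (inv g) i) = i" if "i \<in> F" for i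
          using orbit_sym_aux[of "inv g" i "\<phi> (inv g) i"] that g F(2) by auto
        then show ?thesis using g by blast
      qed
      have "?A \<times> ?B \<subseteq> ?W"
      proof clarify
        fix h S' assume h: "h \<in> carrier G" "\<forall>i\<in>F. \<phi> h (\<phi> (inv g) i) = i"
          and S': "S' \<subseteq> I" "S' \<inter> ?F' = S \<inter> ?F'"
        have hS': "\<phi> h ` S' \<subseteq> I" by (rule image_action_subset[OF S'(1) h(1)])
        have "i \<in> \<phi> h ` S' \<longleftrightarrow> i \<in> \<phi> g ` S" if i: "i \<in> F" for i
        proof -
          have iI: "i \<in> I" "\<phi> (inv g) i \<in> I" using i F F' by auto
          have "\<phi> (inv h) i = \<phi> (inv g) i"
            using orbit_sym_aux[OF h(1) iI(2)] h(2) i by auto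
          then have "i \<in> \<phi> h ` S' \<longleftrightarrow> \<phi> (inv g) i \<in> S'"
            using mem_image_action[OF S'(1) h(1) iI(1)] by simp
          moreover have "\<phi> (inv g) i \<in> ?F'" using i by (rule imageI)
          with S'(2) have "\<phi> (inv g) i \<in> S' \<longleftrightarrow> \<phi> (inv g) i \<in> S" by (rule mem_iff_of_Int_eq)
          ultimately show ?thesis using mem_image_action[OF S(1) g iI(1)] by simp
        qed
        then have "\<phi> h ` S' \<inter> F = \<phi> g ` S \<inter> F" by blast
        then have "e (\<phi> h ` S') \<in> U" by (rule F(3)[OF hS'])
        then show "(h, e S') \<in> ?W"
          using h S' T by (simp add: power_action_apply[OF e] topspace_power_topology)
      qed
      moreover have "(g, r) \<in> ?A \<times> ?B" using gA S by auto
      ultimately show "\<exists>U V. openin T U \<and> openin ?X V \<and> g \<in> U \<and> r \<in> V \<and> U \<times> V \<subseteq> ?W"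
        using A B by blast
    qed
    then show "(\<lambda>(g, x). ?\<psi> g x) -` U \<inter> space (borel_of (prod_topology T ?X)) \<in> sets (borel_of (prod_topology T ?X))"
      unfolding space_borel_of by (rule openin_borel_of)
  qed
qed

text \<open>An index set has only countably many finite subsets if it is countable, so an open set
  of pairs is a countable union of products of cylinders, and cylinders have measurable preimages by
  the hypotheses on single indices.\<close>

lemma power_pair_measurable:
  assumes e: "inj_on e (Pow I)" and I: "countable I"
    and F: "\<And>y. F y \<subseteq> I" "\<And>i. i \<in> I \<Longrightarrow> {y \<in> space M. i \<in> F y} \<in> sets M"
    and F': "\<And>y. F' y \<subseteq> I" "\<And>i. i \<in> I \<Longrightarrow> {y \<in> space M. i \<in> F' y} \<in> sets M"
  shows "(\<lambda>y. (e (F y), e (F' y))) \<in> M \<rightarrow>\<^sub>M borel_of (prod_topology (power_topology e I) (power_topology e I))"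
proof (rule measurable_borel_of)
  let ?X = "power_topology e I"
  show "(e (F y), e (F' y)) \<in> topspace (prod_topology ?X ?X)" for y
    using F F' by (auto simp: topspace_power_topology)
  fix U assume U: "openin (prod_topology ?X ?X) U"
  define \<F> where "\<F> = {A. finite A \<and> A \<subseteq> I}"
  define cyl where "cyl A B H = {y \<in> space M. H y \<inter> A = B \<inter> A}" for A B :: "'a set" and H :: "'b \<Rightarrow> 'a set"
  \<comment> \<open>A triple stands for the product of the cylinders around \<open>B\<close> and
    \<open>C\<close> that fix the indices in \<open>A\<close>; \<open>P\<close> collects those
    triples whose product lies in \<open>U\<close>.\<close>
  define P where "P = {(A, B, C). A \<in> \<F> \<and> B \<in> \<F> \<and> C \<in> \<F> \<and>
    (\<forall>S S'. S \<subseteq> I \<and> S' \<subseteq> I \<and> S \<inter> A = B \<inter> A \<and> S' \<inter> A = C \<inter> A \<longrightarrow> (e S, e S') \<in> U)}"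
  have cF: "countable \<F>"
    using countable_Collect_finite_subset[OF I] by (simp add: \<F>_def)
  have cP: "countable P"
    by (rule countable_subset[of _ "\<F> \<times> \<F> \<times> \<F>"]) (use cF in \<open>auto simp: P_def\<close>)
  have cyl: "cyl A B H \<in> sets M" if "A \<in> \<F>" and H: "\<And>i. i \<in> I \<Longrightarrow> {y \<in> space M. i \<in> H y} \<in> sets M" for A B H
  proof -
    have "{y \<in> space M. i \<in> H y \<longleftrightarrow> i \<in> B} \<in> sets M" if "i \<in> I" for i
    proof (cases "i \<in> B")
      case False
      have "{y \<in> space M. i \<notin> H y} = space M - {y \<in> space M. i \<in> H y}" by auto
      then show ?thesis using False H[OF that] by auto
    qed (use H[OF that] in simp)
    moreover have "cyl A B H = space M \<inter> (\<Inter>i\<in>A. {y \<in> space M. i \<in> H y \<longleftrightarrow> i \<in> B})"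
      by (auto simp: cyl_def)
    ultimately show ?thesis
      using that(1) unfolding \<F>_def by (cases "A = {}") (auto intro!: sets.finite_INT sets.Int)
  qed
  have "(\<lambda>y. (e (F y), e (F' y))) -` U \<inter> space M = (\<Union>(A, B, C)\<in>P. cyl A B F \<inter> cyl A C F')"
  proof (intro equalityI subsetI)
    fix y assume y: "y \<in> (\<lambda>y. (e (F y), e (F' y))) -` U \<inter> space M"
    then obtain V V' where V: "openin ?X V" "openin ?X V'" "e (F y) \<in> V" "e (F' y) \<in> V'" "V \<times> V' \<subseteq> U"
      using U[unfolded openin_prod_topology_alt, rule_format, of "e (F y)" "e (F' y)"] by auto
    obtain A where A: "finite A" "A \<subseteq> I" "\<And>S. S \<subseteq> I \<Longrightarrow> S \<inter> A = F y \<inter> A \<Longrightarrow> e S \<in> V"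
      using V(1)[unfolded openin_power_topology[OF e], THEN conjunct2, THEN spec, of "F y"] V(3) F(1)[of y]
      by (elim impE exE conjE) auto
    obtain A' where A': "finite A'" "A' \<subseteq> I" "\<And>S. S \<subseteq> I \<Longrightarrow> S \<inter> A' = F' y \<inter> A' \<Longrightarrow> e S \<in> V'"
      using V(2)[unfolded openin_power_topology[OF e], THEN conjunct2, THEN spec, of "F' y"] V(4) F'(1)[of y]
      by (elim impE exE conjE) auto
    let ?A = "A \<union> A'"
    have "(e S, e S') \<in> U" if "S \<subseteq> I" "S' \<subseteq> I" "S \<inter> ?A = (F y \<inter> ?A) \<inter> ?A" "S' \<inter> ?A = (F' y \<inter> ?A) \<inter> ?A" for S S'
    proof -
      have "S \<inter> A = F y \<inter> A" "S' \<inter> A' = F' y \<inter> A'" using that by auto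
      then have "e S \<in> V" "e S' \<in> V'" using A(3) A'(3) that by simp_all
      then show ?thesis using V(5) by blast
    qed
    moreover have "?A \<in> \<F>" "F y \<inter> ?A \<in> \<F>" "F' y \<inter> ?A \<in> \<F>"
      using A(1,2) A'(1,2) by (auto simp: \<F>_def)
    ultimately have "(?A, F y \<inter> ?A, F' y \<inter> ?A) \<in> P"
      unfolding P_def by blast
    moreover have "y \<in> cyl ?A (F y \<inter> ?A) F \<inter> cyl ?A (F' y \<inter> ?A) F'"
      using y by (auto simp: cyl_def)
    ultimately show "y \<in> (\<Union>(A, B, C)\<in>P. cyl A B F \<inter> cyl A C F')" by blast
  next
    fix y assume "y \<in> (\<Union>(A, B, C)\<in>P. cyl A B F \<inter> cyl A C F')"
    then show "y \<in> (\<lambda>y. (e (F y), e (F' y))) -` U \<inter> space M"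
      using F(1) F'(1) by (auto simp: P_def cyl_def)
  qed
  also have "\<dots> \<in> sets M"
    using cyl F(2) F'(2) by (intro sets.countable_UN'[OF cP]) (auto simp: P_def)
  finally show "(\<lambda>y. (e (F y), e (F' y))) -` U \<inter> space M \<in> sets M" .
qed

text \<open>The condition on \<open>y\<close> says that \<open>F y\<close> and \<open>F' y\<close>
  lie in one orbit of the action on subsets of \<open>I\<close>, so it defines the preimage of an
  orbit equivalence relation under a measurable map. Tameness enters the proof only here.\<close>

theorem tame_transporter_measurable:
  fixes G (structure)
  assumes tame: "tame G T" and act: "group_action G I \<phi>" and I: "countable I"
    and T: "topspace T = carrier G"
    and op: "\<And>i j. i \<in> I \<Longrightarrow> j \<in> I \<Longrightarrow> openin T {g \<in> carrier G. \<phi> g i = j}"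
    and F: "\<And>y. F y \<subseteq> I" "\<And>i. i \<in> I \<Longrightarrow> {y \<in> space M. i \<in> F y} \<in> sets M"
    and F': "\<And>y. F' y \<subseteq> I" "\<And>i. i \<in> I \<Longrightarrow> {y \<in> space M. i \<in> F' y} \<in> sets M"
  shows "{y \<in> space M. \<exists>g\<in>carrier G. \<phi> g ` F y = F' y} \<in> sets M"
proof -
  obtain e where e: "inj_on (e :: _ \<Rightarrow> real) (Pow I)"
    using ex_inj_on_Pow_real[OF I] by blast
  let ?X = "power_topology e I" and ?\<psi> = "power_action e I \<phi>"
  have "orbit_eqrel G ?X ?\<psi> \<in> sets (borel_of (prod_topology ?X ?X))"
    using tame polish_power_topology[OF e I] power_action_borel[OF e act T op]
    unfolding tame_def by blast
  moreover have "(\<lambda>y. (e (F y), e (F' y))) \<in> M \<rightarrow>\<^sub>M borel_of (prod_topology ?X ?X)"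
    by (rule power_pair_measurable[OF e I F F'])
  ultimately have "(\<lambda>y. (e (F y), e (F' y))) -` orbit_eqrel G ?X ?\<psi> \<inter> space M \<in> sets M"
    by (rule measurable_sets[rotated])
  moreover have "(e (F y), e (F' y)) \<in> orbit_eqrel G ?X ?\<psi> \<longleftrightarrow> (\<exists>g\<in>carrier G. \<phi> g ` F y = F' y)" for y
  proof -
    interpret group_action G I \<phi> by (rule act)
    have "e (F' y) = ?\<psi> g (e (F y)) \<longleftrightarrow> \<phi> g ` F y = F' y" if g: "g \<in> carrier G" for g
    proof -
      have "e (F' y) = e (\<phi> g ` F y) \<longleftrightarrow> F' y = \<phi> g ` F y"
        by (rule inj_on_eq_iff[OF e]) (use F'(1) image_action_subset[OF F(1) g] in auto)
      then show ?thesis unfolding power_action_apply[OF e F(1)] by metis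
    qed
    moreover have "e (F y) \<in> topspace ?X" using F(1) by (simp add: topspace_power_topology)
    ultimately show ?thesis
      unfolding orbit_eqrel_def orbit_def mem_Collect_eq prod.case by (metis (no_types, lifting))
  qed
  then have "(\<lambda>y. (e (F y), e (F' y))) -` orbit_eqrel G ?X ?\<psi> \<inter> space M =
      {y \<in> space M. \<exists>g\<in>carrier G. \<phi> g ` F y = F' y}"
    by (simp add: vimage_def Int_def conj_commute)
  ultimately show ?thesis by simp
qed

section \<open>Finite socles in abelian groups\<close>

lemma finite_decreasing_stable:
  assumes fin: "finite (A 0)" and dec: "\<And>n. A (Suc n) \<subseteq> A n"
  shows "\<exists>k. \<forall>j\<ge>k. A j = (A :: nat \<Rightarrow> 'b set) k"
proof -
  have mono: "A j \<subseteq> A i" if "i \<le> j" for i j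
    using lift_Suc_antimono_le[of A] dec that by blast
  obtain k where k: "\<And>j. card (A k) \<le> card (A j)"
    using ex_least_nat_le[of "\<lambda>n. \<exists>j. card (A j) = n"] by (metis (mono_tags) exists_least_iff linorder_not_le)
  have "A j = A k" if "k \<le> j" for j
    using card_seteq[OF finite_subset[OF mono[of 0 k] fin] mono[OF that] k] by simp
  then show ?thesis by blast
qed

context comm_group
begin

section \<open>Congruence and finiteness modulo a subgroup\<close>

definition cg :: "'a set \<Rightarrow> 'a \<Rightarrow> 'a \<Rightarrow> bool" where
  "cg B x y \<longleftrightarrow> x \<in> carrier G \<and> y \<in> carrier G \<and> x \<otimes> inv y \<in> B"

definition fin_mod :: "'a set \<Rightarrow> 'a set \<Rightarrow> bool" where
  "fin_mod B X \<longleftrightarrow> finite ((\<lambda>x. B #> x) ` X)"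

text \<open>For subgroups \<open>B\<close> and \<open>Q\<close> with \<open>B \<subseteq> Q\<close>
  and a prime \<open>p\<close> this is finiteness of the \<open>p\<close>-socle of
  \<open>Q / B\<close>, the subgroup of its elements killed by \<open>p\<close>.\<close>

definition fin_socle :: "nat \<Rightarrow> 'a set \<Rightarrow> 'a set \<Rightarrow> bool" where
  "fin_socle p Q B \<longleftrightarrow> fin_mod B {x \<in> Q. x [^] p \<in> B}"

lemma cg_closed: "cg B x y \<Longrightarrow> x \<in> carrier G \<and> y \<in> carrier G"
  by (simp add: cg_def)

lemma inv_cancel:
  assumes "x \<in> carrier G" "y \<in> carrier G"
  shows "inv x \<otimes> (x \<otimes> y) = y" "x \<otimes> (inv x \<otimes> y) = y"
  using assms by (simp_all add: m_assoc[symmetric])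

lemma subgroup_nat_pow_closed: "subgroup B G \<Longrightarrow> x \<in> B \<Longrightarrow> x [^] (n::nat) \<in> B"
  by (induction n) (auto simp: subgroup.one_closed subgroup.m_closed)

lemma cg_refl: "subgroup B G \<Longrightarrow> x \<in> carrier G \<Longrightarrow> cg B x x"
  by (simp add: cg_def subgroup.one_closed)

lemma cg_mult:
  assumes "subgroup B G" "cg B x y" "cg B u v"
  shows "cg B (x \<otimes> u) (y \<otimes> v)"
proof -
  have "(x \<otimes> u) \<otimes> inv (y \<otimes> v) = (x \<otimes> inv y) \<otimes> (u \<otimes> inv v)"
    using assms by (simp add: cg_def inv_mult m_ac)
  then show ?thesis
    using assms by (simp add: cg_def subgroup.m_closed)
qed

lemma cg_inv:
  assumes "subgroup B G" "cg B x y"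
  shows "cg B (inv x) (inv y)"
proof -
  have "inv x \<otimes> inv (inv y) = inv (x \<otimes> inv y)"
    using assms by (simp add: cg_def inv_mult)
  then show ?thesis
    using assms by (simp add: cg_def subgroup.m_inv_closed)
qed

lemma cg_sym:
  assumes "subgroup B G" "cg B x y"
  shows "cg B y x"
proof -
  have "y \<otimes> inv x = inv (x \<otimes> inv y)"
    using assms by (simp add: cg_def inv_mult m_comm)
  then show ?thesis
    using assms by (simp add: cg_def subgroup.m_inv_closed)
qed

lemma cg_trans:
  assumes "subgroup B G" "cg B x y" "cg B y z"
  shows "cg B x z"
proof -
  have "x \<otimes> inv z = (x \<otimes> inv y) \<otimes> (y \<otimes> inv z)"
    using assms by (simp add: cg_def m_assoc inv_cancel)
  then show ?thesis
    using assms by (simp add: cg_def subgroup.m_closed)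
qed

lemma cg_pow:
  assumes "subgroup B G" "cg B x y"
  shows "cg B (x [^] (n::nat)) (y [^] n)"
  by (induction n) (use assms in \<open>auto simp: cg_closed intro: cg_mult cg_refl\<close>)

lemma cg_mono: "cg B x y \<Longrightarrow> B \<subseteq> C \<Longrightarrow> cg C x y"
  by (auto simp: cg_def)

lemma cg_mult_right: "subgroup B G \<Longrightarrow> x \<in> carrier G \<Longrightarrow> d \<in> B \<Longrightarrow> cg B (x \<otimes> d) x"
proof -
  assume a: "subgroup B G" "x \<in> carrier G" "d \<in> B"
  then have "d \<in> carrier G" by (simp add: subgroup.mem_carrier)
  then have "x \<otimes> d \<otimes> inv x = d" using a by (simp add: m_comm[of x d] m_assoc)
  then show ?thesis using a \<open>d \<in> carrier G\<close> by (simp add: cg_def)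
qed

lemma cg_one: "subgroup B G \<Longrightarrow> cg B x \<one> \<longleftrightarrow> x \<in> B"
  by (auto simp: cg_def subgroup.mem_carrier)

lemma cg_mem: "subgroup B G \<Longrightarrow> cg B x y \<Longrightarrow> x \<in> B \<longleftrightarrow> y \<in> B"
  by (metis cg_one cg_sym cg_trans)

lemma cg_diff: "cg B x y \<Longrightarrow> x \<otimes> inv y \<in> B"
  by (simp add: cg_def)

lemma cg_iff: "x \<in> carrier G \<Longrightarrow> y \<in> carrier G \<Longrightarrow> cg B x y \<longleftrightarrow> x \<otimes> inv y \<in> B"
  by (simp add: cg_def)

lemma rcos_eq_iff_cg:
  assumes B: "subgroup B G" and xy: "x \<in> carrier G" "y \<in> carrier G"
  shows "B #> x = B #> y \<longleftrightarrow> cg B x y"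
proof
  assume "B #> x = B #> y"
  then have "x \<in> B #> y" using rcos_self[OF xy(1) B] by simp
  then show "cg B x y"
    using subgroup.rcos_module_imp[OF B is_group xy(2), of x] xy by (simp add: cg_def)
next
  assume "cg B x y"
  then have "x \<in> B #> y"
    using subgroup.rcos_module_rev[OF B is_group xy(2) xy(1)] by (simp add: cg_def)
  then show "B #> x = B #> y"
    using repr_independence[OF _ xy(2) B] by simp
qed

lemma fin_modD:
  assumes "fin_mod B X" "subgroup B G" "X \<subseteq> carrier G"
  shows "finite ((#>) B ` X)"
    and "\<And>x y. x \<in> X \<Longrightarrow> y \<in> X \<Longrightarrow> B #> x = B #> y \<Longrightarrow> cg B x y"
proof -
  show "finite ((#>) B ` X)" using assms(1) by (simp add: fin_mod_def)
  show "cg B x y" if "x \<in> X" "y \<in> X" "B #> x = B #> y" for x y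
    using that assms(3) rcos_eq_iff_cg[OF assms(2), of x y] by auto
qed

lemma fin_modI:
  assumes B: "subgroup B G" and X: "X \<subseteq> carrier G" and "finite (h ` X)"
    and h: "\<And>x y. x \<in> X \<Longrightarrow> y \<in> X \<Longrightarrow> h x = h y \<Longrightarrow> cg B x y"
  shows "fin_mod B X"
proof -
  have "(\<lambda>x. B #> x) ` X \<subseteq> (\<lambda>v. B #> inv_into X h v) ` h ` X"
  proof
    fix C assume "C \<in> (\<lambda>x. B #> x) ` X"
    then obtain x where x: "x \<in> X" "C = B #> x" by blast
    have "inv_into X h (h x) \<in> X" "h (inv_into X h (h x)) = h x"
      using x by (auto intro: inv_into_into simp: f_inv_into_f)
    then have "B #> x = B #> inv_into X h (h x)"
      using rcos_eq_iff_cg[OF B] h x X by (metis subset_iff)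
    then show "C \<in> (\<lambda>v. B #> inv_into X h v) ` h ` X" using x by blast
  qed
  then show ?thesis
    unfolding fin_mod_def using assms(3) finite_subset by blast
qed

text \<open>Subtracting a fixed representative maps each of the finitely many fibres of
  \<open>h\<close> into \<open>Y\<close>, and \<open>Y\<close> meets only finitely many cosets of
  \<open>B\<close>.\<close>

lemma fin_mod_fiber:
  assumes B: "subgroup B G" and X: "X \<subseteq> carrier G" and fin: "finite (h ` X)"
    and Y: "fin_mod B Y" "Y \<subseteq> carrier G"
    and h: "\<And>x y. x \<in> X \<Longrightarrow> y \<in> X \<Longrightarrow> h x = h y \<Longrightarrow> x \<otimes> inv y \<in> Y"
  shows "fin_mod B X"
proof -
  define g where "g = (#>) B"
  note g = fin_modD[OF Y(1) B Y(2), folded g_def]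
  define c where "c v = inv_into X h v" for v
  have c: "c (h x) \<in> X" "h (c (h x)) = h x" if "x \<in> X" for x
    using that by (auto simp: c_def intro: inv_into_into f_inv_into_f)
  define f where "f x = (h x, g (x \<otimes> inv (c (h x))))" for x
  have xc: "x \<otimes> inv (c (h x)) \<in> Y" if "x \<in> X" for x
    using h[of x "c (h x)"] c[OF that] that by simp
  show ?thesis
  proof (rule fin_modI[OF B X])
    have "f ` X \<subseteq> h ` X \<times> g ` Y" using xc by (auto simp: f_def)
    then show "finite (f ` X)" using fin g(1) finite_subset by blast
    fix x y assume xy: "x \<in> X" "y \<in> X" "f x = f y"
    let ?c = "c (h x)"
    have cc: "?c \<in> carrier G" using c[OF xy(1)] X by blast
    have xyc: "x \<in> carrier G" "y \<in> carrier G" using xy X by auto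
    have "cg B (x \<otimes> inv ?c) (y \<otimes> inv ?c)"
      using g(2) xc xy by (metis f_def prod.inject)
    then have "cg B ((x \<otimes> inv ?c) \<otimes> ?c) ((y \<otimes> inv ?c) \<otimes> ?c)"
      by (rule cg_mult[OF B _ cg_refl[OF B cc]])
    then show "cg B x y" using cc xyc by (simp add: m_assoc)
  qed
qed

lemma fin_mod_subset: "fin_mod B X \<Longrightarrow> Y \<subseteq> X \<Longrightarrow> fin_mod B Y"
  unfolding fin_mod_def by (meson finite_subset image_mono)

text \<open>As \<open>C\<close> lies in every \<open>A n\<close>, the part of \<open>X\<close> in
  \<open>A n\<close> is determined by the cosets of \<open>C\<close> that it meets. These form a
  decreasing sequence of finite sets of cosets.\<close>

lemma fin_mod_stable:
  assumes C: "subgroup C G" and fin: "fin_mod C (X \<inter> A 0)" and X: "X \<subseteq> carrier G"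
    and A: "\<And>n. subgroup (A n) G" "\<And>n. C \<subseteq> A n" "\<And>n. A (Suc n) \<subseteq> A n"
  shows "\<exists>k. \<forall>j\<ge>k. X \<inter> A k \<subseteq> A j"
proof -
  obtain k where k: "\<forall>j\<ge>k. (\<lambda>x. C #> x) ` (X \<inter> A j) = (\<lambda>x. C #> x) ` (X \<inter> A k)"
    using finite_decreasing_stable[of "\<lambda>n. (\<lambda>x. C #> x) ` (X \<inter> A n)"] fin A(3)
    unfolding fin_mod_def by (metis Int_mono image_mono order_refl)
  have "x \<in> A j" if x: "x \<in> X" "x \<in> A k" "k \<le> j" for x j
  proof -
    have "C #> x \<in> (\<lambda>x. C #> x) ` (X \<inter> A j)" using k x by blast
    then obtain y where y: "y \<in> X" "y \<in> A j" "C #> x = C #> y" by blast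
    then have "cg C x y" using rcos_eq_iff_cg[OF C] x X by blast
    then show ?thesis using cg_mem[OF A(1) cg_mono[OF _ A(2)]] y by blast
  qed
  then show ?thesis by blast
qed

section \<open>The chain condition from a finite socle\<close>

lemma subgroup_pow_mult:
  assumes B: "subgroup B G" and N: "subgroup N G"
  shows "subgroup {b [^] (k::nat) \<otimes> n |b n. b \<in> B \<and> n \<in> N} G"
proof (rule subgroupI)
  note Bc = subgroup.mem_carrier[OF B] and Nc = subgroup.mem_carrier[OF N]
  show "{b [^] k \<otimes> n |b n. b \<in> B \<and> n \<in> N} \<subseteq> carrier G" using Bc Nc by auto
  show "{b [^] k \<otimes> n |b n. b \<in> B \<and> n \<in> N} \<noteq> {}"
    using subgroup.one_closed[OF B] subgroup.one_closed[OF N] by blast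
  fix x assume "x \<in> {b [^] k \<otimes> n |b n. b \<in> B \<and> n \<in> N}"
  then obtain b n where x: "b \<in> B" "n \<in> N" "x = b [^] k \<otimes> n" by blast
  have "inv x = (inv b) [^] k \<otimes> inv n" using x Bc Nc by (simp add: inv_mult nat_pow_inv)
  then show "inv x \<in> {b [^] k \<otimes> n |b n. b \<in> B \<and> n \<in> N}"
    using x subgroup.m_inv_closed[OF B] subgroup.m_inv_closed[OF N] by blast
  fix y assume "y \<in> {b [^] k \<otimes> n |b n. b \<in> B \<and> n \<in> N}"
  then obtain c m where y: "c \<in> B" "m \<in> N" "y = c [^] k \<otimes> m" by blast
  have "x \<otimes> y = (b \<otimes> c) [^] k \<otimes> (n \<otimes> m)"
    using x y Bc Nc by (simp add: nat_pow_distrib m_ac)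
  then show "x \<otimes> y \<in> {b [^] k \<otimes> n |b n. b \<in> B \<and> n \<in> N}"
    using x y subgroup.m_closed[OF B] subgroup.m_closed[OF N] by blast
qed

text \<open>The power \<open>p ^ k\<close> of an element killed by \<open>p ^ Suc k\<close> modulo
  \<open>N\<close> lies in the socle, and two such elements with congruent powers differ by an
  element killed by \<open>p ^ k\<close>. So finiteness passes from \<open>k\<close> to
  \<open>Suc k\<close>.\<close>

lemma fin_mod_pow_torsion:
  assumes N: "subgroup N G" and Q: "subgroup Q G" and fin: "fin_socle p Q N"
  shows "fin_mod N {x \<in> Q. x [^] (p ^ k) \<in> N}"
proof (induction k)
  case 0
  note Qc = subgroup.mem_carrier[OF Q]
  show ?case
    by (rule fin_modI[OF N, where h = "\<lambda>_. ()"])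
      (use Qc subgroup.m_closed[OF N] subgroup.m_inv_closed[OF N] in \<open>auto simp: cg_def\<close>)
next
  case (Suc k)
  note Qc = subgroup.mem_carrier[OF Q]
  let ?X = "{x \<in> Q. x [^] (p ^ k) \<in> N}" and ?X' = "{x \<in> Q. x [^] (p ^ Suc k) \<in> N}"
  let ?S = "{x \<in> Q. x [^] p \<in> N}"
  have Sc: "?S \<subseteq> carrier G" using Qc by blast
  define h where "h = (#>) N"
  note h = fin_modD[OF fin[unfolded fin_socle_def] N Sc, folded h_def]
  have S: "x [^] (p ^ k) \<in> ?S" if "x \<in> ?X'" for x
    using that Qc subgroup.m_closed[OF Q] subgroup_nat_pow_closed[OF Q]
    by (simp add: nat_pow_pow mult.commute)
  show ?case
  proof (rule fin_mod_fiber[OF N, where h = "\<lambda>x. h (x [^] (p ^ k))" and Y = ?X])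
    have "(\<lambda>x. h (x [^] (p ^ k))) ` ?X' \<subseteq> h ` ?S" using S by blast
    then show "finite ((\<lambda>x. h (x [^] (p ^ k))) ` ?X')" using h(1) finite_subset by blast
    fix x y assume xy: "x \<in> ?X'" "y \<in> ?X'" "h (x [^] (p ^ k)) = h (y [^] (p ^ k))"
    then have "cg N (x [^] (p ^ k)) (y [^] (p ^ k))" using h(2) S by blast
    then have "(x \<otimes> inv y) [^] (p ^ k) \<in> N"
      using cg_diff xy Qc by (fastforce simp: nat_pow_distrib nat_pow_inv)
    then show "x \<otimes> inv y \<in> ?X"
      using xy subgroup.m_closed[OF Q] subgroup.m_inv_closed[OF Q] by blast
  qed (use Suc Qc in auto)
qed

text \<open>The subgroups \<open>p\<^sup>k B + N\<close> have eventually constant socle modulo \<open>N\<close>, so \<open>p\<^sup>k B + N\<close> is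
  divisible modulo \<open>N\<close> for large \<open>k\<close>; hence \<open>B / (p B + N)\<close> is finite.\<close>

lemma fin_mod_cofactor:
  assumes N: "subgroup N G" and B: "subgroup B G" and Q: "subgroup Q G"
    and le: "N \<subseteq> B" "B \<subseteq> Q"
    and tors: "\<And>x. x \<in> Q \<Longrightarrow> \<exists>e. x [^] (p ^ e :: nat) \<in> N"
    and fin: "fin_socle p Q N"
  shows "fin_mod {b [^] p \<otimes> n |b n. b \<in> B \<and> n \<in> N} B"
proof -
  note Qc = subgroup.mem_carrier[OF Q] and Bc = subgroup.mem_carrier[OF B]
    and Nc = subgroup.mem_carrier[OF N]
  define P where "P k = {b [^] (p ^ k) \<otimes> n |b n. b \<in> B \<and> n \<in> N}" for k
  let ?S = "{x \<in> Q. x [^] p \<in> N}"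
  have P: "subgroup (P k) G" for k
    unfolding P_def by (rule subgroup_pow_mult[OF B N])
  have NP: "N \<subseteq> P k" for k
  proof
    fix n assume "n \<in> N"
    moreover have "n = \<one> [^] (p ^ k) \<otimes> n" using Nc[OF \<open>n \<in> N\<close>] by simp
    ultimately show "n \<in> P k" using subgroup.one_closed[OF B] unfolding P_def by blast
  qed
  have powP: "b [^] (p ^ k) \<in> P k" if "b \<in> B" for b k
  proof -
    have "b [^] (p ^ k) = b [^] (p ^ k) \<otimes> \<one>" using that Bc by simp
    then show ?thesis using that subgroup.one_closed[OF N] unfolding P_def by blast
  qed
  have Pdec: "P (Suc k) \<subseteq> P k" for k
  proof
    fix x assume "x \<in> P (Suc k)"
    then obtain b n where x: "b \<in> B" "n \<in> N" "x = b [^] (p ^ Suc k) \<otimes> n"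
      unfolding P_def by blast
    then have "x = (b [^] p) [^] (p ^ k) \<otimes> n" using Bc by (simp add: nat_pow_pow)
    then show "x \<in> P k" using x subgroup_nat_pow_closed[OF B] unfolding P_def by blast
  qed
  have PQ: "P k \<subseteq> Q" for k
  proof
    fix x assume "x \<in> P k"
    then obtain b n where x: "b \<in> B" "n \<in> N" "x = b [^] (p ^ k) \<otimes> n"
      unfolding P_def by blast
    then show "x \<in> Q"
      using le subgroup_nat_pow_closed[OF Q] subgroup.m_closed[OF Q] by (metis subsetD)
  qed
  have "fin_mod N (?S \<inter> P 0)"
    by (rule fin_mod_subset[OF fin[unfolded fin_socle_def]]) blast
  moreover have "?S \<subseteq> carrier G" using Qc by blast
  ultimately obtain k where k: "\<forall>j\<ge>k. ?S \<inter> P k \<subseteq> P j"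
    using fin_mod_stable[of N ?S P, OF N _ _ P NP Pdec] by blast
  \<comment> \<open>Divisibility by induction on the exponent. The power
    \<open>x [^] (p ^ j)\<close> lies in the socle part of \<open>P k\<close>, hence in
    \<open>P (j + Suc k)\<close>; so it is congruent to the \<open>p ^ j\<close>-th power of some
    \<open>w\<close> in \<open>P (Suc k)\<close>, and the quotient of \<open>x\<close> by
    \<open>w\<close> is killed already by \<open>p ^ j\<close>.\<close>
  have div: "x \<in> P (Suc k)" if "x \<in> P k" "x [^] (p ^ j) \<in> N" for x j
    using that
  proof (induction j arbitrary: x)
    case 0
    moreover have "x \<in> carrier G" using 0 PQ Qc by blast
    ultimately have "x \<in> N" by simp
    then show ?case using NP by blast
  next
    case (Suc j)
    have xQ: "x \<in> Q" and xc: "x \<in> carrier G" using Suc.prems PQ Qc by auto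
    have "x [^] (p ^ j) \<in> ?S \<inter> P k"
      using Suc.prems xQ xc subgroup_nat_pow_closed[OF Q] subgroup_nat_pow_closed[OF P]
      by (simp add: nat_pow_pow mult.commute)
    then have "x [^] (p ^ j) \<in> P (j + Suc k)" using k[rule_format, of "j + Suc k"] by auto
    then obtain b n where b: "b \<in> B" "n \<in> N" "x [^] (p ^ j) = b [^] (p ^ (j + Suc k)) \<otimes> n"
      unfolding P_def by blast
    define w where "w = b [^] (p ^ Suc k)"
    have w: "w \<in> P (Suc k)" "w \<in> carrier G"
      using powP[OF b(1), of "Suc k"] Bc[OF b(1)] unfolding w_def by simp_all
    have wj: "x [^] (p ^ j) = w [^] (p ^ j) \<otimes> n"
      using b Bc by (simp add: w_def nat_pow_pow power_add mult_ac)
    have "cg N (x [^] (p ^ j)) (w [^] (p ^ j))"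
      unfolding wj by (rule cg_mult_right[OF N]) (use w b in auto)
    then have "(x \<otimes> inv w) [^] (p ^ j) \<in> N"
      using cg_diff xc w by (fastforce simp: nat_pow_distrib nat_pow_inv)
    moreover have "x \<otimes> inv w \<in> P k"
      using Suc.prems w Pdec subgroup.m_closed[OF P] subgroup.m_inv_closed[OF P] by (meson subsetD)
    ultimately have "x \<otimes> inv w \<in> P (Suc k)" using Suc.IH by blast
    then have "(x \<otimes> inv w) \<otimes> w \<in> P (Suc k)" using w subgroup.m_closed[OF P] by blast
    then show ?case using xc w by (simp add: m_assoc)
  qed
  \<comment> \<open>Divisibility applied to \<open>b [^] (p ^ k)\<close>: it is congruent to
    \<open>c [^] (p ^ Suc k)\<close>, so \<open>b\<close> differs from a \<open>p\<close>-th power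
    by an element killed by \<open>p ^ k\<close>.\<close>
  have "\<exists>c\<in>B. (b \<otimes> inv (c [^] p)) [^] (p ^ k) \<in> N" if b: "b \<in> B" for b
  proof -
    have "b [^] (p ^ k) \<in> P k" by (rule powP[OF b])
    moreover obtain j where "(b [^] (p ^ k)) [^] (p ^ j) \<in> N"
      using tors[of "b [^] (p ^ k)"] PQ calculation by blast
    ultimately have "b [^] (p ^ k) \<in> P (Suc k)" by (rule div)
    then obtain c n where c: "c \<in> B" "n \<in> N" "b [^] (p ^ k) = c [^] (p ^ Suc k) \<otimes> n"
      unfolding P_def by blast
    have eq: "b [^] (p ^ k) = (c [^] p) [^] (p ^ k) \<otimes> n"
      using c Bc by (simp add: nat_pow_pow)
    have "cg N (b [^] (p ^ k)) ((c [^] p) [^] (p ^ k))"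
      unfolding eq by (rule cg_mult_right[OF N]) (use c Bc in auto)
    then have "(b \<otimes> inv (c [^] p)) [^] (p ^ k) \<in> N"
      using cg_diff b c Bc by (fastforce simp: nat_pow_distrib nat_pow_inv)
    then show ?thesis using c by blast
  qed
  then obtain c where c: "\<And>b. b \<in> B \<Longrightarrow> c b \<in> B"
    "\<And>b. b \<in> B \<Longrightarrow> (b \<otimes> inv (c b [^] p)) [^] (p ^ k) \<in> N"
    by metis
  let ?X = "{x \<in> Q. x [^] (p ^ k) \<in> N}"
  have Xc: "?X \<subseteq> carrier G" using Qc by blast
  define h where "h = (#>) N"
  note h = fin_modD[OF fin_mod_pow_torsion[OF N Q fin] N Xc, folded h_def]
  have X: "b \<otimes> inv (c b [^] p) \<in> ?X" if "b \<in> B" for b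
  proof -
    have "b \<otimes> inv (c b [^] p) \<in> B"
      using that c(1) subgroup_nat_pow_closed[OF B] subgroup.m_closed[OF B] subgroup.m_inv_closed[OF B]
      by blast
    then show ?thesis using c(2)[OF that] le by blast
  qed
  \<comment> \<open>Modulo \<open>P 1\<close> the element \<open>b\<close> equals
    \<open>b \<otimes> inv (c b [^] p)\<close>, and for the latter there are only finitely many
    classes modulo \<open>N\<close>.\<close>
  have "fin_mod (P 1) B"
  proof (rule fin_modI[OF P, where h = "\<lambda>b. h (b \<otimes> inv (c b [^] p))"])
    have "(\<lambda>b. h (b \<otimes> inv (c b [^] p))) ` B \<subseteq> h ` ?X" using X by blast
    then show "finite ((\<lambda>b. h (b \<otimes> inv (c b [^] p))) ` B)" using h(1) finite_subset by blast
    fix x y assume xy: "x \<in> B" "y \<in> B" "h (x \<otimes> inv (c x [^] p)) = h (y \<otimes> inv (c y [^] p))"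
    have *: "cg (P 1) (b \<otimes> inv (c b [^] p)) b" if "b \<in> B" for b
      by (rule cg_mult_right[OF P])
        (use that c(1)[OF that] Bc powP[of "c b" 1] subgroup.m_inv_closed[OF P] in auto)
    have "cg N (x \<otimes> inv (c x [^] p)) (y \<otimes> inv (c y [^] p))" using h(2) X xy by blast
    then have "cg (P 1) (x \<otimes> inv (c x [^] p)) (y \<otimes> inv (c y [^] p))" using NP by (rule cg_mono)
    then show "cg (P 1) x y"
      using cg_trans[OF P cg_trans[OF P cg_sym[OF P *[OF xy(1)]]] *[OF xy(2)]] by blast
  qed (use Bc in auto)
  then show ?thesis by (simp add: P_def)
qed

text \<open>In additive terms, let \<open>p x\<close> be in \<open>B\<close>. There are finitely
  many classes of \<open>p x\<close> modulo \<open>p B + N\<close> by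
  \<open>fin_mod_cofactor\<close>. If \<open>x\<close> and \<open>y\<close> have the same class,
  then \<open>p (x - y) = p d + n\<close> with \<open>d\<close> in \<open>B\<close> and
  \<open>n\<close> in \<open>N\<close>, so \<open>x - y - d\<close> lies in the socle modulo
  \<open>N\<close>. Hence the differences, collected in \<open>Y\<close>, have finitely many classes
  modulo \<open>B\<close>.\<close>

lemma fin_socle_quotient:
  assumes N: "subgroup N G" and B: "subgroup B G" and Q: "subgroup Q G"
    and le: "N \<subseteq> B" "B \<subseteq> Q"
    and tors: "\<And>x. x \<in> Q \<Longrightarrow> \<exists>e. x [^] (p ^ e :: nat) \<in> N"
    and fin: "fin_socle p Q N"
  shows "fin_socle p Q B"
  unfolding fin_socle_def
proof -
  note Qc = subgroup.mem_carrier[OF Q] and Bc = subgroup.mem_carrier[OF B]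
    and Nc = subgroup.mem_carrier[OF N]
  let ?P = "{b [^] p \<otimes> n |b n. b \<in> B \<and> n \<in> N}" and ?X = "{x \<in> Q. x [^] p \<in> B}"
    and ?S = "{x \<in> Q. x [^] p \<in> N}"
  define Y where "Y = {z \<in> Q. \<exists>b\<in>B. (z \<otimes> inv b) [^] p \<in> N}"
  have P: "subgroup ?P G" by (rule subgroup_pow_mult[OF B N])
  have Sc: "?S \<subseteq> carrier G" using Qc by blast
  define h where "h = (#>) ?P"
  note h = fin_modD[OF fin_mod_cofactor[OF N B Q le tors fin] P subgroup.subset[OF B], folded h_def]
  define g where "g = (#>) N"
  note g = fin_modD[OF fin[unfolded fin_socle_def] N Sc, folded g_def]
  have "\<forall>z\<in>Y. \<exists>b. b \<in> B \<and> (z \<otimes> inv b) [^] p \<in> N" unfolding Y_def by blast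
  from bchoice[OF this] obtain b where "\<forall>z\<in>Y. b z \<in> B \<and> (z \<otimes> inv (b z)) [^] p \<in> N" by blast
  then have b: "\<And>z. z \<in> Y \<Longrightarrow> b z \<in> B" "\<And>z. z \<in> Y \<Longrightarrow> (z \<otimes> inv (b z)) [^] p \<in> N" by auto
  have YQ: "Y \<subseteq> Q" by (auto simp: Y_def)
  have S: "z \<otimes> inv (b z) \<in> ?S" if "z \<in> Y" for z
    using b[OF that] that YQ le subgroup.m_closed[OF Q] subgroup.m_inv_closed[OF Q]
    by (simp add: subset_iff)
  have "fin_mod B Y"
  proof (rule fin_modI[OF B, where h = "\<lambda>z. g (z \<otimes> inv (b z))"])
    have "(\<lambda>z. g (z \<otimes> inv (b z))) ` Y \<subseteq> g ` ?S" using S by blast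
    then show "finite ((\<lambda>z. g (z \<otimes> inv (b z))) ` Y)" using g(1) finite_subset by blast
    fix x y assume xy: "x \<in> Y" "y \<in> Y" "g (x \<otimes> inv (b x)) = g (y \<otimes> inv (b y))"
    have *: "cg B (z \<otimes> inv (b z)) z" if "z \<in> Y" for z
      by (rule cg_mult_right[OF B])
        (use that b(1)[OF that] Qc YQ subgroup.m_inv_closed[OF B] in auto)
    have "cg N (x \<otimes> inv (b x)) (y \<otimes> inv (b y))" using g(2) S xy by blast
    then have "cg B (x \<otimes> inv (b x)) (y \<otimes> inv (b y))" using le(1) by (rule cg_mono)
    then show "cg B x y"
      using cg_trans[OF B cg_trans[OF B cg_sym[OF B *[OF xy(1)]]] *[OF xy(2)]] by blast
  qed (use YQ Qc in auto)
  then show "fin_mod B ?X"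
  proof (rule fin_mod_fiber[OF B, where h = "\<lambda>x. h (x [^] p)", rotated 2])
    have "(\<lambda>x. h (x [^] p)) ` ?X \<subseteq> h ` B" by blast
    then show "finite ((\<lambda>x. h (x [^] p)) ` ?X)" using h(1) finite_subset by blast
    fix x y assume xy: "x \<in> ?X" "y \<in> ?X" "h (x [^] p) = h (y [^] p)"
    have c: "x \<in> carrier G" "y \<in> carrier G" using xy Qc by auto
    have "cg ?P (x [^] p) (y [^] p)" using h(2) xy by blast
    then have "(x \<otimes> inv y) [^] p \<in> ?P"
      using cg_diff[of ?P "x [^] p" "y [^] p"] c by (simp add: nat_pow_distrib nat_pow_inv)
    then obtain d n where d: "d \<in> B" "n \<in> N" "(x \<otimes> inv y) [^] p = d [^] p \<otimes> n" by blast
    have dc: "d \<in> carrier G" using d Bc by blast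
    have "cg N (d [^] p \<otimes> n) (d [^] p)"
      by (rule cg_mult_right[OF N]) (use d dc in auto)
    then have "((x \<otimes> inv y) \<otimes> inv d) [^] p \<in> N"
      using cg_diff[of N "(x \<otimes> inv y) [^] p" "d [^] p"] c dc d(3)
      by (simp add: nat_pow_distrib[of "x \<otimes> inv y" "inv d"] nat_pow_inv)
    then show "x \<otimes> inv y \<in> Y"
      using xy d(1) subgroup.m_closed[OF Q] subgroup.m_inv_closed[OF Q] unfolding Y_def by blast
  qed (use YQ Qc in auto)
qed

text \<open>Let \<open>C\<close> be the intersection of the chain. The socle of \<open>Q / C\<close>
  is finite, so the socles of the \<open>B n / C\<close> become constant; the constant value is
  trivial because the \<open>B n\<close> intersect in \<open>C\<close>. A \<open>p\<close>-primary
  group with trivial socle is trivial, so \<open>B k = C\<close> for some \<open>k\<close>.\<close>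

lemma fin_socle_descending_chain:
  assumes N: "subgroup N G" and Q: "subgroup Q G"
    and tors: "\<And>x. x \<in> Q \<Longrightarrow> \<exists>e. x [^] (p ^ e :: nat) \<in> N"
    and fin: "fin_socle p Q N"
    and B: "\<And>n. subgroup (B n) G" "\<And>n. N \<subseteq> B n" "\<And>n. B (Suc n) \<subseteq> B n" "B 0 \<subseteq> Q"
  shows "\<exists>k. \<forall>j. B k \<subseteq> B j"
proof -
  define C where "C = (\<Inter>n. B n)"
  have C: "subgroup C G" unfolding C_def by (rule subgroups_Inter) (use B in auto)
  have mono: "B j \<subseteq> B i" if "i \<le> j" for i j
    using lift_Suc_antimono_le[of B] B(3) that by blast
  have "fin_socle p Q C"
    by (rule fin_socle_quotient[OF N C Q _ _ tors fin]) (use B in \<open>auto simp: C_def\<close>)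
  then have fin': "fin_mod C ({x \<in> Q. x [^] p \<in> C} \<inter> B 0)"
    unfolding fin_socle_def by (rule fin_mod_subset) blast
  obtain k where k: "\<forall>j\<ge>k. {x \<in> Q. x [^] p \<in> C} \<inter> B k \<subseteq> B j"
    using fin_mod_stable[of C "{x \<in> Q. x [^] p \<in> C}" B, OF C fin' _ B(1) _ B(3)] subgroup.subset[OF Q]
    by (auto simp: C_def)
  have soc: "x \<in> C" if "x \<in> B k" "x [^] p \<in> C" for x
  proof -
    have "x \<in> B j" for j
    proof (cases "k \<le> j")
      case True
      then show ?thesis using k that mono[of 0 k] B(4) by blast
    next
      case False
      then show ?thesis using that mono[of j k] by auto
    qed
    then show ?thesis by (simp add: C_def)
  qed
  have "x \<in> C" if "x \<in> B k" "x [^] (p ^ e) \<in> C" for x e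
    using that
  proof (induction e arbitrary: x)
    case 0
    then show ?case using subgroup.mem_carrier[OF B(1)] by fastforce
  next
    case (Suc e)
    have "x [^] p \<in> B k" using Suc.prems subgroup_nat_pow_closed[OF B(1)] by blast
    moreover have "(x [^] p) [^] (p ^ e) \<in> C"
      using Suc.prems subgroup.mem_carrier[OF B(1)] by (simp add: nat_pow_pow)
    ultimately show ?case using Suc.IH soc Suc.prems by blast
  qed
  moreover have "N \<subseteq> C" using B by (auto simp: C_def)
  ultimately have "B k \<subseteq> C" using tors mono[of 0 k] B(4) by blast
  then show ?thesis by (auto simp: C_def)
qed

end

section \<open>Limits of decreasing sequences of subgroups\<close>

text \<open>The application takes for \<open>N j\<close> the elements of the closed subgroup whose
  first \<open>j + 1\<close> coordinates are trivial, so a congruence modulo \<open>N j\<close> is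
  agreement on these coordinates.\<close>

locale filtered_group = comm_group G for G (structure) +
  fixes N :: "nat \<Rightarrow> 'a set"
  assumes N_subgroup: "subgroup (N j) G"
    and N_Suc: "N (Suc j) \<subseteq> N j"
begin

lemma N_antimono: "i \<le> j \<Longrightarrow> N j \<subseteq> N i"
  using lift_Suc_antimono_le[of N] N_Suc by blast

lemmas cgN_refl = cg_refl[OF N_subgroup] and cgN_mult = cg_mult[OF N_subgroup]
  and cgN_inv = cg_inv[OF N_subgroup] and cgN_sym = cg_sym[OF N_subgroup]
  and cgN_trans = cg_trans[OF N_subgroup] and cgN_pow = cg_pow[OF N_subgroup]

lemma cgN_antimono: "cg (N j) x y \<Longrightarrow> i \<le> j \<Longrightarrow> cg (N i) x y"
  using cg_mono N_antimono by blast

text \<open>Describes a group tree: since \<open>A m\<close> contains \<open>N m\<close>, membership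
  in \<open>A m\<close> depends only on the first \<open>m + 1\<close> coordinates.\<close>

definition group_seq :: "(nat \<Rightarrow> 'a set) \<Rightarrow> bool" where
  "group_seq A \<longleftrightarrow> (\<forall>m. subgroup (A m) G \<and> A (Suc m) \<subseteq> A m \<and> N m \<subseteq> A m)"

text \<open>Each \<open>C m\<close> is empty or a coset of \<open>A m\<close>.\<close>

definition coset_seq :: "(nat \<Rightarrow> 'a set) \<Rightarrow> (nat \<Rightarrow> 'a set) \<Rightarrow> bool" where
  "coset_seq A C \<longleftrightarrow> (\<forall>m. C m \<subseteq> carrier G \<and> C (Suc m) \<subseteq> C m \<and>
     (\<forall>x\<in>C m. \<forall>y\<in>carrier G. y \<in> C m \<longleftrightarrow> cg (A m) x y))"

text \<open>On the sequence of sets describing a tree, \<open>lim_seq\<close> acts as the \<open>\<omega>\<close>-th derivative.\<close>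

definition lim_seq :: "(nat \<Rightarrow> 'a set) \<Rightarrow> nat \<Rightarrow> 'a set" where
  "lim_seq A m = {x \<in> carrier G. \<forall>n. \<exists>y\<in>A (m + n). cg (N m) x y}"

text \<open>For the sequence of a tree this says that every node has a proper extension, so that the
  derivative changes nothing.\<close>

definition pruned :: "(nat \<Rightarrow> 'a set) \<Rightarrow> bool" where
  "pruned A \<longleftrightarrow> (\<forall>m. \<forall>x\<in>A m. \<exists>y\<in>A (Suc m). cg (N m) x y)"

lemma seq_antimono: "(\<And>m. A (Suc m) \<subseteq> A m) \<Longrightarrow> i \<le> j \<Longrightarrow> A j \<subseteq> (A i :: 'a set)"
  using lift_Suc_antimono_le[of A] by blast

lemma pruned_lift:
  assumes "pruned A" "\<And>m. A m \<subseteq> carrier G" "x \<in> A m"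
  shows "\<exists>y\<in>A (m + n). cg (N m) x y"
proof (induction n)
  case 0
  then show ?case using assms cgN_refl by (metis add_0_right subsetD)
next
  case (Suc n)
  then obtain y where y: "y \<in> A (m + n)" "cg (N m) x y" by blast
  then obtain z where "z \<in> A (Suc (m + n))" "cg (N (m + n)) y z"
    using assms(1) unfolding pruned_def by blast
  then show ?case using cgN_trans[OF y(2)] cgN_antimono[of "m + n" y z m] by auto
qed

lemma lim_seq_mono_dec:
  assumes "\<And>m. A (Suc m) \<subseteq> A m"
  shows "lim_seq A (Suc m) \<subseteq> lim_seq A m"
proof
  fix x assume x: "x \<in> lim_seq A (Suc m)"
  have "\<exists>y\<in>A (m + n). cg (N m) x y" for n
  proof -
    obtain y where "y \<in> A (Suc m + n)" "cg (N (Suc m)) x y"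
      using x unfolding lim_seq_def by blast
    then show ?thesis using assms cgN_antimono[of "Suc m" x y m] by auto
  qed
  then show "x \<in> lim_seq A m" using x by (simp add: lim_seq_def)
qed

lemma group_seq_lim_seq:
  assumes A: "group_seq A"
  shows "group_seq (lim_seq A)"
  unfolding group_seq_def
proof (intro allI conjI)
  have Asub: "subgroup (A m) G" for m using A by (simp add: group_seq_def)
  fix m
  show "lim_seq A (Suc m) \<subseteq> lim_seq A m"
    by (rule lim_seq_mono_dec) (use A in \<open>simp add: group_seq_def\<close>)
  have NL: "N m \<subseteq> lim_seq A m"
  proof
    fix x assume x: "x \<in> N m"
    then have "cg (N m) x \<one>" by (simp add: cg_one[OF N_subgroup])
    then show "x \<in> lim_seq A m"
      using subgroup.one_closed[OF Asub] cg_closed unfolding lim_seq_def by blast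
  qed
  then show "N m \<subseteq> lim_seq A m" .
  show "subgroup (lim_seq A m) G"
  proof (rule subgroupI)
    show "lim_seq A m \<subseteq> carrier G" by (auto simp: lim_seq_def)
    show "lim_seq A m \<noteq> {}" using NL subgroup.one_closed[OF N_subgroup] by blast
    fix x assume x: "x \<in> lim_seq A m"
    have "\<exists>y\<in>A (m + n). cg (N m) (inv x) y" for n
    proof -
      obtain y where "y \<in> A (m + n)" "cg (N m) x y" using x unfolding lim_seq_def by blast
      then show ?thesis using cgN_inv subgroup.m_inv_closed[OF Asub] by blast
    qed
    then show "inv x \<in> lim_seq A m" using x by (simp add: lim_seq_def)
    fix y assume y: "y \<in> lim_seq A m"
    have "\<exists>z\<in>A (m + n). cg (N m) (x \<otimes> y) z" for n
    proof -
      obtain x' y' where "x' \<in> A (m + n)" "cg (N m) x x'" "y' \<in> A (m + n)" "cg (N m) y y'"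
        using x y unfolding lim_seq_def by blast
      then show ?thesis using cgN_mult subgroup.m_closed[OF Asub] by blast
    qed
    then show "x \<otimes> y \<in> lim_seq A m" using x y by (simp add: lim_seq_def)
  qed
qed

lemma coset_seq_lim_seq:
  assumes A: "group_seq A" and C: "coset_seq A C"
  shows "coset_seq (lim_seq A) (lim_seq C)"
  unfolding coset_seq_def
proof (intro allI conjI ballI)
  have Cc: "C m \<subseteq> carrier G" for m using C by (simp add: coset_seq_def)
  have C_iff: "y \<in> C m \<longleftrightarrow> cg (A m) x y" if "x \<in> C m" "y \<in> carrier G" for x y m
    using C that unfolding coset_seq_def by blast
  have Asub: "subgroup (A m) G" for m using A by (simp add: group_seq_def)
  fix m
  show "lim_seq C m \<subseteq> carrier G" by (auto simp: lim_seq_def)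
  show "lim_seq C (Suc m) \<subseteq> lim_seq C m"
    by (rule lim_seq_mono_dec) (use C in \<open>simp add: coset_seq_def\<close>)
  fix x y assume x: "x \<in> lim_seq C m" and y: "y \<in> carrier G"
  have xc: "x \<in> carrier G" using x by (simp add: lim_seq_def)
  show "y \<in> lim_seq C m \<longleftrightarrow> cg (lim_seq A m) x y"
  proof
    assume y': "y \<in> lim_seq C m"
    have "\<exists>z\<in>A (m + n). cg (N m) (x \<otimes> inv y) z" for n
    proof -
      obtain u v where uv: "u \<in> C (m + n)" "cg (N m) x u" "v \<in> C (m + n)" "cg (N m) y v"
        using x y' unfolding lim_seq_def by blast
      then have "u \<otimes> inv v \<in> A (m + n)" using C_iff Cc cg_diff by blast
      then show ?thesis using uv cgN_mult cgN_inv by blast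
    qed
    then show "cg (lim_seq A m) x y" using xc y by (simp add: cg_iff lim_seq_def)
  next
    assume "cg (lim_seq A m) x y"
    then have d: "x \<otimes> inv y \<in> lim_seq A m" by (rule cg_diff)
    have "\<exists>z\<in>C (m + n). cg (N m) y z" for n
    proof -
      obtain u v where uv: "u \<in> C (m + n)" "cg (N m) x u" "v \<in> A (m + n)" "cg (N m) (x \<otimes> inv y) v"
        using x d unfolding lim_seq_def by blast
      have c: "u \<in> carrier G" "v \<in> carrier G" using uv cg_closed by blast+
      have "y = x \<otimes> inv (x \<otimes> inv y)" using xc y by (simp add: inv_mult inv_cancel)
      then have "cg (N m) y (u \<otimes> inv v)"
        using cgN_mult[OF uv(2) cgN_inv[OF uv(4)]] by simp
      moreover have "cg (A (m + n)) (u \<otimes> inv v) u"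
        using cg_mult_right[OF Asub c(1)] uv(3) subgroup.m_inv_closed[OF Asub] by blast
      then have "u \<otimes> inv v \<in> C (m + n)"
        using C_iff[OF uv(1)] cg_sym[OF Asub] c by blast
      ultimately show ?thesis by blast
    qed
    then show "y \<in> lim_seq C m" using y by (simp add: lim_seq_def)
  qed
qed

lemma lim_seq_subset:
  assumes A: "group_seq A"
  shows "lim_seq A m \<subseteq> A m"
proof
  fix x assume "x \<in> lim_seq A m"
  then obtain y where y: "y \<in> A (m + 0)" "cg (N m) x y" unfolding lim_seq_def by blast
  then show "x \<in> A m"
    using A cg_mem[of "A m" x y] cg_mono[of "N m" x y "A m"] by (simp add: group_seq_def)
qed

text \<open>The subtree of nodes with trivial first entry may be taken before or after the limit:
  \<open>N m\<close> lies in \<open>N 0\<close>, so elements congruent modulo \<open>N m\<close> are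
  both in \<open>N 0\<close> or both outside.\<close>

lemma lim_seq_Int_N0:
  "lim_seq (\<lambda>m. A m \<inter> N 0) = (\<lambda>m. lim_seq A m \<inter> N 0)"
proof (intro ext equalityI subsetI)
  fix m x assume x: "x \<in> lim_seq (\<lambda>m. A m \<inter> N 0) m"
  then obtain y where "y \<in> N 0" "cg (N m) x y" unfolding lim_seq_def by blast
  then have "x \<in> N 0" using cg_mem[OF N_subgroup cgN_antimono[of m x y 0]] by simp
  then show "x \<in> lim_seq A m \<inter> N 0" using x unfolding lim_seq_def by blast
next
  fix m x assume x: "x \<in> lim_seq A m \<inter> N 0"
  have "\<exists>y\<in>A (m + n) \<inter> N 0. cg (N m) x y" for n
  proof -
    obtain y where "y \<in> A (m + n)" "cg (N m) x y" using x unfolding lim_seq_def by blast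
    then show ?thesis using cg_mem[OF N_subgroup cgN_antimono[of m x y 0]] x by auto
  qed
  then show "x \<in> lim_seq (\<lambda>m. A m \<inter> N 0) m" using x by (simp add: lim_seq_def)
qed

end

section \<open>Lifting primary parts\<close>

locale torsion_filtered_group = filtered_group +
  assumes N_torsion: "x \<in> N 0 \<Longrightarrow> \<exists>k::nat. k > 0 \<and> x [^] k \<in> N j"
begin

text \<open>Let \<open>q\<close> be the part prime to \<open>p\<close> of an exponent that kills
  \<open>v\<close> modulo \<open>N j\<close>. An exponent \<open>c\<close> divisible by
  \<open>q\<close> and congruent to 1 modulo \<open>p ^ e\<close> leaves only the
  \<open>p\<close>-part of \<open>v\<close> and does not change the class modulo \<open>N m\<close>,
  where \<open>p ^ e\<close> already kills \<open>x\<close>.\<close>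

lemma primary_part:
  assumes p: "prime (p::nat)" and v: "v \<in> N 0" and xv: "cg (N m) x v" and x: "x [^] (p ^ e) \<in> N m"
  shows "\<exists>c::nat. \<exists>e'. (v [^] c) [^] (p ^ e') \<in> N j \<and> cg (N m) x (v [^] c)"
proof -
  obtain t :: nat where t: "t > 0" "v [^] t \<in> N j" using N_torsion[OF v] by blast
  have vc: "v \<in> carrier G" and xc: "x \<in> carrier G" using cg_closed[OF xv] by auto
  obtain a q where q: "t = p ^ a * q" "\<not> p dvd q"
    using t p by (metis multiplicity_decompose' not_prime_unit not_gr_zero)
  have "coprime q (p ^ e)"
    using p q(2) by (simp add: prime_imp_coprime coprime_commute)
  then obtain r where r: "[q * r = 1] (mod p ^ e)"
    using cong_solve_coprime_nat[of q "p ^ e"] by auto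
  \<comment> \<open>The summand \<open>q * p ^ e\<close> makes \<open>c\<close> positive even if
    \<open>r = 0\<close>, so that \<open>c\<close> can be written as \<open>1 + p ^ e * s\<close>
    with a natural number \<open>s\<close>.\<close>
  define c where "c = q * r + q * p ^ e"
  have "q > 0" using q t by (metis gr0I mult_0_right)
  then have c1: "c \<ge> 1" unfolding c_def using p prime_gt_0_nat by (simp add: Suc_leI)
  have "[c = 1] (mod p ^ e)" unfolding c_def using r
    by (metis cong_add_lcancel_0_nat cong_mult_self_right cong_trans add.commute cong_add_rcancel_0_nat cong_def mod_mult_self1 mult.commute)
  then obtain s where s: "c = 1 + p ^ e * s"
    using c1 by (metis cong_altdef_nat dvd_def le_add_diff_inverse)
  have "(v [^] c) [^] (p ^ a) = (v [^] t) [^] (r + p ^ e)"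
    using vc by (simp add: nat_pow_pow c_def q algebra_simps)
  then have 1: "(v [^] c) [^] (p ^ a) \<in> N j"
    using subgroup_nat_pow_closed[OF N_subgroup t(2)] by simp
  have "x [^] c = x \<otimes> (x [^] (p ^ e)) [^] s"
    using xc by (simp add: s nat_pow_mult[symmetric] nat_pow_pow m_comm)
  moreover have "cg (N m) (x \<otimes> (x [^] (p ^ e)) [^] s) x"
    using cg_mult_right[OF N_subgroup xc subgroup_nat_pow_closed[OF N_subgroup x]] .
  ultimately have "cg (N m) x (v [^] c)"
    using cgN_trans[OF cgN_sym cgN_pow[OF xv]] by metis
  with 1 show ?thesis by blast
qed

definition eventually_fin_socle :: "nat \<Rightarrow> bool" where
  "eventually_fin_socle p \<longleftrightarrow> (\<exists>M. \<forall>j\<ge>M. fin_socle p (N j) (N (Suc j)))"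

text \<open>The lifts of \<open>x\<close> to the \<open>n\<close>-th derivative are cosets of a decreasing sequence of subgroups of
  \<open>N m\<close>, whose \<open>p\<close>-part satisfies the descending chain condition modulo \<open>N (m + 1)\<close>.\<close>

lemma primary_lift:
  assumes p: "prime p" and K: "group_seq K" "\<And>m. K m \<subseteq> N 0"
    and fin: "fin_socle p (N m) (N (Suc m))"
    and x: "x \<in> lim_seq K m" "x [^] (p ^ e) \<in> N m"
  shows "\<exists>y\<in>lim_seq K (Suc m). \<exists>e. y [^] (p ^ e) \<in> N (Suc m) \<and> cg (N m) x y"
proof -
  have Ksub: "subgroup (K i) G" "N i \<subseteq> K i" for i using K by (auto simp: group_seq_def)
  have Kdec: "K j \<subseteq> K i" if "i \<le> j" for i j
    using seq_antimono[of K] K that by (simp add: group_seq_def)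
  define Q where "Q = {u \<in> N m. \<exists>e. u [^] (p ^ e) \<in> N (Suc m)}"
  \<comment> \<open>Differences of two \<open>p\<close>-primary lifts of \<open>x\<close> lie in
    \<open>Q\<close>; those in \<open>B n\<close> can be approximated modulo
    \<open>N (Suc m)\<close> at depth \<open>Suc m + n\<close>.\<close>
  define B where "B n = {u \<in> Q. \<exists>v\<in>K (Suc m + n). cg (N (Suc m)) u v}" for n
  note Nc = subgroup.mem_carrier[OF N_subgroup]
  have tors_mult: "\<exists>e. (u \<otimes> v) [^] (p ^ e) \<in> N j"
    if "u [^] (p ^ a) \<in> N j" "v [^] (p ^ b) \<in> N j" "u \<in> carrier G" "v \<in> carrier G" for u v a b j
  proof -
    have "(u \<otimes> v) [^] (p ^ (a + b)) = (u [^] (p ^ a)) [^] (p ^ b) \<otimes> (v [^] (p ^ b)) [^] (p ^ a)"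
      using that by (simp add: nat_pow_distrib nat_pow_pow power_add mult.commute)
    then have "(u \<otimes> v) [^] (p ^ (a + b)) \<in> N j"
      using that by (simp add: subgroup_nat_pow_closed[OF N_subgroup] subgroup.m_closed[OF N_subgroup])
    then show ?thesis by blast
  qed
  have tors_inv: "(inv u) [^] (p ^ a) \<in> N j" if "u [^] (p ^ a) \<in> N j" "u \<in> carrier G" for u a j
    using that by (simp add: nat_pow_inv subgroup.m_inv_closed[OF N_subgroup])
  have NQ: "N (Suc m) \<subseteq> Q"
    unfolding Q_def using N_Suc subgroup_nat_pow_closed[OF N_subgroup] by blast
  have Q: "subgroup Q G"
  proof (rule subgroupI)
    show "Q \<subseteq> carrier G" unfolding Q_def using Nc by blast
    show "Q \<noteq> {}" using NQ subgroup.one_closed[OF N_subgroup] by blast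
    fix u assume u: "u \<in> Q"
    then show "inv u \<in> Q"
      unfolding Q_def using tors_inv subgroup.m_inv_closed[OF N_subgroup] Nc by blast
    fix v assume "v \<in> Q"
    then show "u \<otimes> v \<in> Q"
      using u tors_mult[of u _ "Suc m" v] subgroup.m_closed[OF N_subgroup] Nc unfolding Q_def by blast
  qed
  note Qc = subgroup.mem_carrier[OF Q]
  have NB: "N (Suc m) \<subseteq> B n" for n
  proof
    fix u assume u: "u \<in> N (Suc m)"
    then have "cg (N (Suc m)) u \<one>" by (simp add: cg_one[OF N_subgroup])
    then show "u \<in> B n" unfolding B_def using u NQ subgroup.one_closed[OF Ksub(1)] by blast
  qed
  have B: "subgroup (B n) G" for n
  proof (rule subgroupI)
    show "B n \<subseteq> carrier G" unfolding B_def using Qc by blast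
    show "B n \<noteq> {}" using NB subgroup.one_closed[OF N_subgroup] by blast
    fix u assume u: "u \<in> B n"
    then obtain u' where u': "u' \<in> K (Suc m + n)" "cg (N (Suc m)) u u'" unfolding B_def by blast
    then show "inv u \<in> B n"
      using u cgN_inv[OF u'(2)] subgroup.m_inv_closed[OF Ksub(1)] subgroup.m_inv_closed[OF Q]
      unfolding B_def by blast
    fix v assume v: "v \<in> B n"
    then obtain v' where v': "v' \<in> K (Suc m + n)" "cg (N (Suc m)) v v'" unfolding B_def by blast
    then show "u \<otimes> v \<in> B n"
      using u v u' cgN_mult[OF u'(2) v'(2)] subgroup.m_closed[OF Ksub(1)] subgroup.m_closed[OF Q]
      unfolding B_def by blast
  qed
  have "fin_socle p Q (N (Suc m))"
    using fin unfolding fin_socle_def by (rule fin_mod_subset) (auto simp: Q_def)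
  moreover have "\<exists>e. u [^] (p ^ e) \<in> N (Suc m)" if "u \<in> Q" for u using that by (simp add: Q_def)
  moreover have "B (Suc n) \<subseteq> B n" for n
    using Kdec[of "Suc m + n" "Suc m + Suc n"] unfolding B_def by auto
  ultimately obtain k where k: "\<And>j. B k \<subseteq> B j"
    using fin_socle_descending_chain[of "N (Suc m)" Q p B, OF N_subgroup Q _ _ B NB]
    unfolding B_def by blast
  \<comment> \<open>Lifts of \<open>x\<close> to every depth exist by assumption;
    \<open>primary_part\<close> makes them \<open>p\<close>-primary modulo
    \<open>N (Suc m)\<close>.\<close>
  have "\<exists>y\<in>K (Suc m + n). \<exists>e. y [^] (p ^ e) \<in> N (Suc m) \<and> cg (N m) x y" for n
  proof -
    obtain v where v: "v \<in> K (m + Suc n)" "cg (N m) x v"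
      using x(1) unfolding lim_seq_def by blast
    then obtain c :: nat and e' where "(v [^] c) [^] (p ^ e') \<in> N (Suc m)" "cg (N m) x (v [^] c)"
      using primary_part[OF p _ v(2) x(2)] K(2) by blast
    moreover have "v [^] c \<in> K (Suc m + n)"
      using subgroup_nat_pow_closed[OF Ksub(1) v(1)] by simp
    ultimately show ?thesis by blast
  qed
  then obtain y where y: "\<And>n. y n \<in> K (Suc m + n)" "\<And>n. \<exists>e. y n [^] (p ^ e) \<in> N (Suc m)"
    "\<And>n. cg (N m) x (y n)"
    by metis
  have yc: "y n \<in> carrier G" for n using y(3) cg_closed by blast
  \<comment> \<open>The lift at index \<open>k\<close>, where \<open>B\<close> has become constant,
    serves for all \<open>n\<close>: its difference to the lift at index \<open>n\<close> lies in
    \<open>B k\<close>, hence in \<open>B n\<close>, and an approximation of this difference is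
    added to \<open>y n\<close>.\<close>
  have "\<exists>v\<in>K (Suc m + n). cg (N (Suc m)) (y k) v" for n
  proof (cases "n \<le> k")
    case True
    then show ?thesis using Kdec[of "Suc m + n" "Suc m + k"] y(1)[of k] cgN_refl[OF yc] by auto
  next
    case False
    define u where "u = y k \<otimes> inv (y n)"
    have "cg (N m) (y k) (y n)" using cgN_trans[OF cgN_sym[OF y(3)] y(3)] .
    then have "u \<in> N m" unfolding u_def by (rule cg_diff)
    moreover obtain a b where "y k [^] (p ^ a) \<in> N (Suc m)" "y n [^] (p ^ b) \<in> N (Suc m)"
      using y(2) by blast
    then have "\<exists>e. u [^] (p ^ e) \<in> N (Suc m)"
      unfolding u_def using tors_mult tors_inv yc by blast
    ultimately have uQ: "u \<in> Q" by (simp add: Q_def)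
    have "y n \<in> K (Suc m + k)" using Kdec[of "Suc m + k" "Suc m + n"] y(1)[of n] False by auto
    then have "u \<in> K (Suc m + k)"
      unfolding u_def using y(1)[of k] subgroup.m_closed[OF Ksub(1)] subgroup.m_inv_closed[OF Ksub(1)] by blast
    then have "u \<in> B k" unfolding B_def using uQ cgN_refl[OF Qc[OF uQ]] by blast
    then have "u \<in> B n" using k by blast
    then obtain u' where u': "u' \<in> K (Suc m + n)" "cg (N (Suc m)) u u'" unfolding B_def by blast
    have "u \<otimes> y n = y k" unfolding u_def using yc by (simp add: m_assoc)
    then have "cg (N (Suc m)) (y k) (u' \<otimes> y n)"
      using cgN_mult[OF u'(2) cgN_refl[OF yc[of n]]] by simp
    then show ?thesis using u'(1) y(1)[of n] subgroup.m_closed[OF Ksub(1)] by blast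
  qed
  then have "y k \<in> lim_seq K (Suc m)" using yc by (simp add: lim_seq_def)
  then show ?thesis using y by blast
qed

text \<open>The element provided by \<open>primary_lift\<close> is again \<open>p\<close>-primary at
  the next level, so the lifting can be repeated as long as the socles are finite.\<close>

lemma primary_lim_seq:
  assumes p: "prime p" and K: "group_seq K" "\<And>m. K m \<subseteq> N 0"
    and fin: "\<And>j. j \<ge> m \<Longrightarrow> fin_socle p (N j) (N (Suc j))"
    and x: "x \<in> lim_seq K m" "x [^] (p ^ e) \<in> N m"
  shows "x \<in> lim_seq (lim_seq K) m"
proof -
  have xc: "x \<in> carrier G" using x by (simp add: lim_seq_def)
  have "\<exists>y\<in>lim_seq K (m + n). \<exists>e. y [^] (p ^ e) \<in> N (m + n) \<and> cg (N m) x y" for n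
  proof (induction n)
    case 0
    then show ?case using x cgN_refl[OF xc] by auto
  next
    case (Suc n)
    then obtain y e where y: "y \<in> lim_seq K (m + n)" "y [^] (p ^ e) \<in> N (m + n)" "cg (N m) x y"
      by blast
    obtain z e' where z: "z \<in> lim_seq K (Suc (m + n))" "z [^] (p ^ e') \<in> N (Suc (m + n))" "cg (N (m + n)) y z"
      using primary_lift[OF p K _ y(1,2)] fin by (meson le_add1)
    have "cg (N m) x z" using cgN_trans[OF y(3) cgN_antimono[OF z(3)]] by simp
    then show ?case using z by auto
  qed
  then show ?thesis using xc unfolding lim_seq_def[of "lim_seq K"] by blast
qed

text \<open>An element of \<open>p\<close>-power order need not extend at levels where the
  \<open>p\<close>-socle is infinite. But an element of the second limit is approximated by elements
  of the first limit at levels beyond the last bad one for \<open>p\<close>; their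
  \<open>p\<close>-parts stay in the second limit by \<open>primary_lim_seq\<close>. Other orders
  are split into prime powers.\<close>

lemma pruned_lim_lim:
  assumes fin: "\<And>p. prime p \<Longrightarrow> eventually_fin_socle p"
    and K: "group_seq K" "\<And>m. K m \<subseteq> N 0"
  shows "pruned (lim_seq (lim_seq K))"
  unfolding pruned_def
proof (intro allI ballI)
  let ?L = "lim_seq K" and ?W = "lim_seq (lim_seq K)"
  have L: "group_seq ?L" by (rule group_seq_lim_seq[OF K(1)])
  have W: "group_seq ?W" by (rule group_seq_lim_seq[OF L])
  have Wsub: "subgroup (?W i) G" for i using W by (simp add: group_seq_def)
  have Wdec: "?W j \<subseteq> ?W i" if "i \<le> j" for i j
    by (rule seq_antimono[OF _ that]) (use W in \<open>simp add: group_seq_def\<close>)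
  have LN: "?L i \<subseteq> N 0" for i using lim_seq_subset[OF K(1)] K(2) by blast
  fix m
  have prim: "\<exists>y\<in>?W (Suc m). cg (N m) x y"
    if p: "prime p" and x: "x \<in> ?W m" "x [^] (p ^ e) \<in> N m" for x and p e :: nat
  proof -
    obtain M where M: "\<And>j. j \<ge> M \<Longrightarrow> fin_socle p (N j) (N (Suc j))"
      using fin[OF p] unfolding eventually_fin_socle_def by blast
    \<comment> \<open>The depth \<open>m + (M + 1)\<close> is past \<open>M\<close>, where lifting
      succeeds, and at least \<open>Suc m\<close>, where the extension is wanted.\<close>
    obtain v where v: "v \<in> ?L (m + (M + 1))" "cg (N m) x v"
      using x(1) unfolding lim_seq_def[of "lim_seq K"] by blast
    obtain c :: nat and e' where c: "(v [^] c) [^] (p ^ e') \<in> N (m + (M + 1))" "cg (N m) x (v [^] c)"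
      using primary_part[OF p _ v(2) x(2)] LN v(1) by blast
    have vL: "v [^] c \<in> ?L (m + (M + 1))"
      using subgroup_nat_pow_closed v(1) L by (simp add: group_seq_def)
    have "v [^] c \<in> ?W (m + (M + 1))"
      by (rule primary_lim_seq[OF p K _ vL c(1)]) (use M in auto)
    then show ?thesis using c(2) Wdec[of "Suc m" "m + (M + 1)"] by auto
  qed
  \<comment> \<open>Strong induction on an exponent \<open>t\<close> killing \<open>x\<close>: with
    \<open>t = p ^ a * q\<close>, Bezout writes \<open>x\<close> as a product of a part killed by
    \<open>q < t\<close> and one killed by \<open>p ^ a\<close>.\<close>
  have gen: "\<exists>y\<in>?W (Suc m). cg (N m) x y" if "t > 0" "x \<in> ?W m" "x [^] t \<in> N m" for t :: nat and x
    using that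
  proof (induction t arbitrary: x rule: less_induct)
    case (less t)
    have xc: "x \<in> carrier G" using less.prems by (simp add: lim_seq_def)
    show ?case
    proof (cases "t = 1")
      case True
      then have "cg (N m) x \<one>" using less.prems xc by (simp add: cg_one[OF N_subgroup])
      then show ?thesis using subgroup.one_closed[OF Wsub] by blast
    next
      case False
      then obtain p where p: "prime p" "p dvd t" using prime_factor_nat by blast
      obtain a q where q: "t = p ^ a * q" "\<not> p dvd q"
        using less.prems(1) p(1) by (metis multiplicity_decompose' not_prime_unit not_gr_zero)
      have "a > 0" using p q by (metis gr0I mult_1 power_0)
      then have "p ^ a > 1" using prime_gt_1_nat[OF p(1)] by (intro one_less_power)
      have q0: "q > 0" using q less.prems(1) by (metis gr0I mult_0_right)
      then have "q < t" using q \<open>p ^ a > 1\<close> by simp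
      have "coprime (int (p ^ a)) (int q)"
        using p(1) q(2) by (metis coprime_int_iff coprime_power_left_iff prime_imp_coprime)
      then obtain u v :: int where uv: "u * int (p ^ a) + v * int q = 1"
        by (metis bezout_int coprime_imp_gcd_eq_1)
      define x1 where "x1 = x [^] (u * int (p ^ a))"
      define x2 where "x2 = x [^] (v * int q)"
      have x12: "x = x1 \<otimes> x2"
        unfolding x1_def x2_def using xc uv by (metis int_pow_1 int_pow_mult)
      have W12: "x1 \<in> ?W m" "x2 \<in> ?W m"
        unfolding x1_def x2_def using subgroup_int_pow_closed[OF Wsub less.prems(2)] by auto
      have "x1 [^] q = (x [^] t) [^] u"
        unfolding x1_def using xc q by (simp add: int_pow_int[symmetric] int_pow_pow algebra_simps)
      then have "x1 [^] q \<in> N m"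
        using subgroup_int_pow_closed[OF N_subgroup less.prems(3)] by simp
      then obtain y1 where y1: "y1 \<in> ?W (Suc m)" "cg (N m) x1 y1"
        using less.IH[OF \<open>q < t\<close> q0 W12(1)] by blast
      have "x2 [^] (p ^ a) = (x [^] t) [^] v"
        unfolding x2_def using xc q by (simp add: int_pow_int[symmetric] int_pow_pow algebra_simps)
      then have "x2 [^] (p ^ a) \<in> N m"
        using subgroup_int_pow_closed[OF N_subgroup less.prems(3)] by simp
      then obtain y2 where y2: "y2 \<in> ?W (Suc m)" "cg (N m) x2 y2"
        using prim[OF p(1) W12(2)] by blast
      have "cg (N m) x (y1 \<otimes> y2)" unfolding x12 using cgN_mult y1 y2 by blast
      then show ?thesis using y1 y2 subgroup.m_closed[OF Wsub] by blast
    qed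
  qed
  fix x assume x: "x \<in> ?W m"
  then have "x \<in> N 0" using lim_seq_subset[OF L] LN by blast
  then show "\<exists>y\<in>?W (Suc m). cg (N m) x y" using N_torsion[of x m] gen x by blast
qed

text \<open>All lifts of \<open>x\<close> have the same first coordinate, so they differ by elements
  of \<open>N 0\<close>, where the second limit is pruned. Hence the lift \<open>z 1\<close> to the
  next level can be moved to any depth: write it as the deep lift \<open>z (Suc n)\<close> times a
  difference, and lift only the difference.\<close>

theorem pruned_lim3:
  assumes fin: "\<And>p. prime p \<Longrightarrow> eventually_fin_socle p" and A: "group_seq A"
  shows "pruned (lim_seq (lim_seq (lim_seq A)))"
  unfolding pruned_def
proof (intro allI ballI)
  let ?W = "lim_seq (lim_seq A)"
  let ?V = "\<lambda>m. ?W m \<inter> N 0"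
  have W: "group_seq ?W" by (intro group_seq_lim_seq A)
  have Wsub: "subgroup (?W i) G" for i using W by (simp add: group_seq_def)
  have "group_seq (\<lambda>m. A m \<inter> N 0)"
    using A N_antimono[of 0] subgroups_Inter_pair[OF _ N_subgroup] by (auto simp: group_seq_def)
  from pruned_lim_lim[OF fin this] have V: "pruned ?V" by (simp add: lim_seq_Int_N0)
  fix m x assume x: "x \<in> lim_seq ?W m"
  then have xc: "x \<in> carrier G" by (simp add: lim_seq_def)
  have "\<exists>z\<in>?W (m + n). cg (N m) x z" for n using x unfolding lim_seq_def[of ?W] by blast
  then obtain z where z: "\<And>n. z n \<in> ?W (m + n)" "\<And>n. cg (N m) x (z n)" by metis
  have zc: "z n \<in> carrier G" for n using z(2) cg_closed by blast
  have "\<exists>w\<in>?W (Suc m + n). cg (N (Suc m)) (z 1) w" for n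
  proof -
    define d where "d = z 1 \<otimes> inv (z (Suc n))"
    have "cg (N m) (z 1) (z (Suc n))" using cgN_trans[OF cgN_sym[OF z(2)] z(2)] .
    then have "d \<in> N 0" using cg_diff N_antimono[of 0 m] unfolding d_def by blast
    moreover have "z (Suc n) \<in> ?W (Suc m)"
      using z(1)[of "Suc n"] seq_antimono[of ?W "Suc m" "m + Suc n"] W by (auto simp: group_seq_def)
    then have "d \<in> ?W (Suc m)"
      unfolding d_def using z(1)[of 1] subgroup.m_closed[OF Wsub] subgroup.m_inv_closed[OF Wsub] by simp
    ultimately have "d \<in> ?V (Suc m)" by blast
    moreover have "?V i \<subseteq> carrier G" for i using subgroup.subset[OF Wsub] by blast
    ultimately obtain u where u: "u \<in> ?W (Suc m + n)" "cg (N (Suc m)) d u"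
      using pruned_lift[OF V] by blast
    have "d \<otimes> z (Suc n) = z 1" unfolding d_def using zc by (simp add: m_assoc)
    then have "cg (N (Suc m)) (z 1) (u \<otimes> z (Suc n))"
      using cgN_mult[OF u(2) cgN_refl[OF zc[of "Suc n"]]] by simp
    moreover have "u \<otimes> z (Suc n) \<in> ?W (Suc m + n)"
      using u(1) z(1)[of "Suc n"] subgroup.m_closed[OF Wsub] by simp
    ultimately show ?thesis by blast
  qed
  then have "z 1 \<in> lim_seq ?W (Suc m)" using zc by (simp add: lim_seq_def[of ?W])
  then show "\<exists>y\<in>lim_seq ?W (Suc m). cg (N m) x y" using z(2) by blast
qed

text \<open>If no level is empty, choose any \<open>y\<close> in the level \<open>Suc m\<close>. The
  difference of \<open>x\<close> and \<open>y\<close> lies in the pruned group sequence, so it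
  extends, and adding the extension to \<open>y\<close> extends \<open>x\<close>.\<close>

theorem pruned_lim3_coset:
  assumes fin: "\<And>p. prime p \<Longrightarrow> eventually_fin_socle p" and A: "group_seq A" and C: "coset_seq A C"
  shows "(\<exists>m. lim_seq (lim_seq (lim_seq C)) m = {}) \<or> pruned (lim_seq (lim_seq (lim_seq C)))"
proof -
  let ?A = "lim_seq (lim_seq (lim_seq A))" and ?C = "lim_seq (lim_seq (lim_seq C))"
  have C': "coset_seq ?A ?C"
    by (intro coset_seq_lim_seq group_seq_lim_seq A C)
  have A': "group_seq ?A" by (intro group_seq_lim_seq A)
  have Asub: "subgroup (?A i) G" for i using A' by (simp add: group_seq_def)
  have C_iff: "y \<in> ?C m \<longleftrightarrow> cg (?A m) x y" if "x \<in> ?C m" "y \<in> carrier G" for x y m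
    using C' that unfolding coset_seq_def by blast
  have Cc: "?C m \<subseteq> carrier G" "?C (Suc m) \<subseteq> ?C m" for m using C' by (auto simp: coset_seq_def)
  have "pruned ?C" if ne: "\<And>m. ?C m \<noteq> {}"
    unfolding pruned_def
  proof (intro allI ballI)
    fix m x assume x: "x \<in> ?C m"
    obtain y where y: "y \<in> ?C (Suc m)" using ne by blast
    then have c: "x \<in> carrier G" "y \<in> carrier G" "y \<in> ?C m" using x Cc by blast+
    then have "x \<otimes> inv y \<in> ?A m" using C_iff[OF x] cg_diff by blast
    then obtain u where u: "u \<in> ?A (Suc m)" "cg (N m) (x \<otimes> inv y) u"
      using pruned_lim3[OF fin A] unfolding pruned_def by blast
    have uc: "u \<in> carrier G" using u cg_closed by blast
    have "(x \<otimes> inv y) \<otimes> y = x" using c by (simp add: m_assoc)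
    then have "cg (N m) x (y \<otimes> u)"
      using cgN_mult[OF u(2) cgN_refl[OF c(2)]] c uc by (simp add: m_comm)
    moreover have "y \<otimes> u \<in> ?C (Suc m)"
      using C_iff[OF y] cg_sym[OF Asub cg_mult_right[OF Asub c(2) u(1)]] c uc by simp
    ultimately show "\<exists>y\<in>?C (Suc m). cg (N m) x y" by blast
  qed
  then show ?thesis by blast
qed

end

section \<open>Independent sequences\<close>

context comm_group
begin

lemma int_pow_coprime_mem:
  assumes B: "subgroup B G" and x: "x \<in> carrier G"
    and "x [^] (i::int) \<in> B" "x [^] (j::int) \<in> B" "coprime i j"
  shows "x \<in> B"
proof -
  obtain u v where uv: "u * i + v * j = 1" by (metis assms(5) bezout_int coprime_imp_gcd_eq_1)
  have "x = x [^] (i * u + j * v)" using uv x by (simp add: mult.commute)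
  also have "\<dots> = (x [^] i) [^] u \<otimes> (x [^] j) [^] v"
    using x by (simp add: int_pow_mult int_pow_pow)
  also have "\<dots> \<in> B"
    using assms subgroup_int_pow_closed[OF B] subgroup.m_closed[OF B] by blast
  finally show ?thesis .
qed

lemma cg_int_pow:
  assumes "subgroup B G" "cg B x y"
  shows "cg B (x [^] (n::int)) (y [^] n)"
proof -
  have c: "x \<in> carrier G" "y \<in> carrier G" using assms cg_closed by auto
  have "x [^] n \<otimes> inv (y [^] n) = (x \<otimes> inv y) [^] n"
    using c by (simp add: int_pow_distrib int_pow_inv)
  then show ?thesis
    using assms subgroup_int_pow_closed[OF assms(1) cg_diff[OF assms(2)]] c by (simp add: cg_def)
qed

text \<open>That is, \<open>F / P\<close> embeds into \<open>Q / B\<close> as an essential subgroup.\<close>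

lemma ex_maximal_complement:
  assumes P: "subgroup P G" and Q: "subgroup Q G" and F: "P \<subseteq> F" "F \<subseteq> Q"
  shows "\<exists>B. subgroup B G \<and> P \<subseteq> B \<and> B \<subseteq> Q \<and> B \<inter> F \<subseteq> P \<and>
    (\<forall>x\<in>Q - B. \<exists>i::int. \<exists>b\<in>B. x [^] i \<otimes> b \<in> F - P)"
proof -
  define \<A> where "\<A> = {B. subgroup B G \<and> P \<subseteq> B \<and> B \<subseteq> Q \<and> B \<inter> F \<subseteq> P}"
  have "\<exists>M\<in>\<A>. \<forall>X\<in>\<A>. M \<subseteq> X \<longrightarrow> X = M"
  proof (rule subset_Zorn_nonempty)
    show "\<A> \<noteq> {}" using P F by (auto simp: \<A>_def)
    fix \<C> assume \<C>: "\<C> \<noteq> {}" "subset.chain \<A> \<C>"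
    then have sub: "\<C> \<subseteq> \<A>" and lin: "\<And>X Y. X \<in> \<C> \<Longrightarrow> Y \<in> \<C> \<Longrightarrow> X \<subseteq> Y \<or> Y \<subseteq> X"
      by (auto simp: subset_chain_def)
    have \<C>D: "subgroup X G \<and> P \<subseteq> X \<and> X \<subseteq> Q \<and> X \<inter> F \<subseteq> P" if "X \<in> \<C>" for X
      using that sub by (auto simp: \<A>_def)
    have "subgroup (\<Union>\<C>) G"
    proof (rule subgroupI)
      show "\<Union>\<C> \<subseteq> carrier G" using sub by (auto simp: \<A>_def dest: subgroup.mem_carrier)
      show "\<Union>\<C> \<noteq> {}" using \<C>(1) sub subgroup.one_closed by (fastforce simp: \<A>_def)
      fix x assume "x \<in> \<Union>\<C>"
      then obtain X where X: "X \<in> \<C>" "x \<in> X" by blast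
      then have "inv x \<in> X" using \<C>D[OF X(1)] by (simp add: subgroup.m_inv_closed)
      then show "inv x \<in> \<Union>\<C>" using X(1) by blast
      fix y assume "y \<in> \<Union>\<C>"
      then obtain Y where Y: "Y \<in> \<C>" "y \<in> Y" by blast
      obtain Z where Z: "Z \<in> \<C>" "x \<in> Z" "y \<in> Z" using lin[OF X(1) Y(1)] X Y by blast
      then have "x \<otimes> y \<in> Z" using \<C>D[OF Z(1)] by (simp add: subgroup.m_closed)
      then show "x \<otimes> y \<in> \<Union>\<C>" using Z(1) by blast
    qed
    moreover obtain X where "X \<in> \<C>" using \<C>(1) by blast
    then have "P \<subseteq> \<Union>\<C>" using \<C>D[of X] by blast
    moreover have "\<Union>\<C> \<subseteq> Q" using \<C>D by (intro Union_least) simp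
    moreover have "\<Union>\<C> \<inter> F \<subseteq> P" unfolding Int_Union2 using \<C>D by (intro UN_least) simp
    ultimately show "\<Union>\<C> \<in> \<A>" by (simp add: \<A>_def)
  qed
  then obtain B where "B \<in> \<A>" and max: "\<forall>X\<in>\<A>. B \<subseteq> X \<longrightarrow> X = B" by blast
  then have B: "subgroup B G" "P \<subseteq> B" "B \<subseteq> Q" "B \<inter> F \<subseteq> P" by (simp_all add: \<A>_def)
  have "\<exists>i::int. \<exists>b\<in>B. x [^] i \<otimes> b \<in> F - P" if x: "x \<in> Q - B" for x
  proof (rule ccontr)
    assume no: "\<not> ?thesis"
    have xc: "x \<in> carrier G" using x subgroup.mem_carrier[OF Q] by blast
    note Bc = subgroup.mem_carrier[OF B(1)]
    \<comment> \<open>The subgroup generated by \<open>x\<close> and \<open>B\<close>. If none of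
      its elements lies in \<open>F - P\<close>, it violates the maximality of
      \<open>B\<close>.\<close>
    define X where "X = {x [^] (i::int) \<otimes> b |i b. b \<in> B}"
    have BX: "B \<subseteq> X"
    proof
      fix b assume "b \<in> B"
      moreover have "b = x [^] (0::int) \<otimes> b" using Bc[OF \<open>b \<in> B\<close>] by simp
      ultimately show "b \<in> X" unfolding X_def by blast
    qed
    have "x = x [^] (1::int) \<otimes> \<one>" using xc by (simp add: int_pow_1)
    then have "x \<in> X" using subgroup.one_closed[OF B(1)] unfolding X_def by blast
    moreover have "subgroup X G"
    proof (rule subgroupI)
      show "X \<subseteq> carrier G" using xc Bc by (auto simp: X_def)
      show "X \<noteq> {}" using \<open>x \<in> X\<close> by blast
      fix y assume "y \<in> X"
      then obtain i :: int and b where y: "y = x [^] i \<otimes> b" "b \<in> B" unfolding X_def by blast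
      have "inv y = x [^] (- i) \<otimes> inv b" using y xc Bc by (simp add: inv_mult int_pow_neg)
      then show "inv y \<in> X" using y subgroup.m_inv_closed[OF B(1)] unfolding X_def by blast
      fix z assume "z \<in> X"
      then obtain j :: int and c where z: "z = x [^] j \<otimes> c" "c \<in> B" unfolding X_def by blast
      have "y \<otimes> z = x [^] (i + j) \<otimes> (b \<otimes> c)"
        using y z xc Bc by (simp add: int_pow_mult m_ac)
      then show "y \<otimes> z \<in> X" using y z subgroup.m_closed[OF B(1)] unfolding X_def by blast
    qed
    moreover have "X \<subseteq> Q"
      unfolding X_def using x B(3) subgroup_int_pow_closed[OF Q] subgroup.m_closed[OF Q] by blast
    moreover have "X \<inter> F \<subseteq> P" using no unfolding X_def by blast
    ultimately have "X \<in> \<A>" using B(2) BX by (auto simp: \<A>_def)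
    then show False using max BX x \<open>x \<in> X\<close> by blast
  qed
  then show ?thesis using B by blast
qed

section \<open>Integer combinations of a sequence\<close>

primrec lin :: "(nat \<Rightarrow> 'a) \<Rightarrow> (nat \<Rightarrow> int) \<Rightarrow> nat \<Rightarrow> 'a" where
  "lin z a 0 = \<one>"
| "lin z a (Suc K) = lin z a K \<otimes> z K [^] a K"

lemma lin_closed: "(\<And>k. k < K \<Longrightarrow> z k \<in> carrier G) \<Longrightarrow> lin z a K \<in> carrier G"
  by (induction K) auto

lemma lin_mem:
  assumes B: "subgroup B G"
  shows "(\<And>k. k < K \<Longrightarrow> z k [^] a k \<in> B) \<Longrightarrow> lin z a K \<in> B"
  by (induction K) (auto simp: subgroup.one_closed[OF B] subgroup.m_closed[OF B])

lemma lin_cong: "(\<And>k. k < K \<Longrightarrow> z k = z' k \<and> a k = a' k) \<Longrightarrow> lin z a K = lin z' a' K"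
  by (induction K) auto

lemma lin_add:
  "(\<And>k. k < K \<Longrightarrow> z k \<in> carrier G) \<Longrightarrow> lin z (\<lambda>k. a k + b k) K = lin z a K \<otimes> lin z b K"
  by (induction K) (auto simp: int_pow_mult m_ac lin_closed)

lemma lin_scale:
  "(\<And>k. k < K \<Longrightarrow> z k \<in> carrier G) \<Longrightarrow> lin z (\<lambda>k. c * a k) K = lin z a K [^] (c::int)"
  by (induction K) (auto simp: int_pow_distrib int_pow_pow mult.commute lin_closed)

lemma lin_minus:
  assumes "\<And>k. k < K \<Longrightarrow> z k \<in> carrier G"
  shows "lin z (\<lambda>k. - a k) K = inv (lin z a K)"
  using lin_scale[of K z "-1" a] assms lin_closed[of K z a] by (simp add: int_pow_neg int_pow_1)

lemma lin_diff:
  assumes "\<And>k. k < K \<Longrightarrow> z k \<in> carrier G"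
  shows "lin z (\<lambda>k. a k - b k) K = lin z a K \<otimes> inv (lin z b K)"
  using lin_add[of K z a "\<lambda>k. - b k"] lin_minus[of K z b] assms by simp

lemma lin_zero: "(\<And>k. k < K \<Longrightarrow> a k = 0) \<Longrightarrow> lin z a K = \<one>"
  by (induction K) auto

lemma lin_extend: "K \<le> K' \<Longrightarrow> (\<And>k. K \<le> k \<Longrightarrow> k < K' \<Longrightarrow> a k = 0) \<Longrightarrow>
    (\<And>k. k < K' \<Longrightarrow> z k \<in> carrier G) \<Longrightarrow> lin z a K' = lin z a K"
  by (induction K' rule: dec_induct) (auto simp: lin_closed)

lemma lin_single:
  "(\<And>k. k < K \<Longrightarrow> z k \<in> carrier G) \<Longrightarrow> i < K \<Longrightarrow> lin z (\<lambda>k. if k = i then c else 0) K = z i [^] c"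
  by (induction K) (auto simp: less_Suc_eq lin_zero)

end

context torsion_filtered_group
begin

definition supp_le :: "(nat \<Rightarrow> nat) \<Rightarrow> nat \<Rightarrow> nat \<Rightarrow> (nat \<Rightarrow> int) \<Rightarrow> bool" where
  "supp_le lev K m a \<longleftrightarrow> (\<forall>k<K. m < lev k \<longrightarrow> a k = 0)"

text \<open>Additively, the sum of \<open>N (Suc m)\<close> and the subgroup generated by the
  multiples \<open>c z k\<close> with \<open>lev k \<le> m\<close>.\<close>

definition lin_span :: "(nat \<Rightarrow> 'a) \<Rightarrow> (nat \<Rightarrow> nat) \<Rightarrow> nat \<Rightarrow> int \<Rightarrow> nat \<Rightarrow> 'a set" where
  "lin_span z lev K c m = {x. \<exists>a. supp_le lev K m a \<and> (\<forall>k<K. c dvd a k) \<and> cg (N (Suc m)) x (lin z a K)}"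

text \<open>For every \<open>m\<close>, the \<open>z k\<close> with \<open>lev k \<le> m\<close>
  form a basis over the field with \<open>p\<close> elements of the quotient of
  \<open>lin_span z lev K 1 m\<close> by \<open>lin_span z lev K (int p) m\<close>.\<close>

definition indep :: "nat \<Rightarrow> (nat \<Rightarrow> 'a) \<Rightarrow> (nat \<Rightarrow> nat) \<Rightarrow> nat \<Rightarrow> bool" where
  "indep p z lev K \<longleftrightarrow> (\<forall>m a. supp_le lev K m a \<longrightarrow> lin z a K \<in> N (Suc m) \<longrightarrow> (\<forall>k<K. int p dvd a k))"

lemma N_Suc_subset_lin_span:
  "N (Suc m) \<subseteq> lin_span z lev K c m"
proof
  fix x assume "x \<in> N (Suc m)"
  then have "cg (N (Suc m)) x (lin z (\<lambda>_. 0) K)"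
    by (simp add: lin_zero cg_one[OF N_subgroup])
  then show "x \<in> lin_span z lev K c m" unfolding lin_span_def supp_le_def by (auto intro!: exI[of _ "\<lambda>_. 0"])
qed

lemma subgroup_lin_span:
  assumes z: "\<And>k. k < K \<Longrightarrow> z k \<in> carrier G"
  shows "subgroup (lin_span z lev K c m) G"
proof (rule subgroupI)
  show "lin_span z lev K c m \<subseteq> carrier G" unfolding lin_span_def using cg_closed by blast
  show "lin_span z lev K c m \<noteq> {}"
    using N_Suc_subset_lin_span subgroup.one_closed[OF N_subgroup] by blast
  fix x assume "x \<in> lin_span z lev K c m"
  then obtain a where a: "supp_le lev K m a" "\<forall>k<K. c dvd a k" "cg (N (Suc m)) x (lin z a K)"
    unfolding lin_span_def by blast
  have "cg (N (Suc m)) (inv x) (lin z (\<lambda>k. - a k) K)"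
    using cgN_inv[OF a(3)] lin_minus[OF z] by simp
  then show "inv x \<in> lin_span z lev K c m"
    unfolding lin_span_def using a by (auto simp: supp_le_def intro!: exI[of _ "\<lambda>k. - a k"])
  fix y assume "y \<in> lin_span z lev K c m"
  then obtain b where b: "supp_le lev K m b" "\<forall>k<K. c dvd b k" "cg (N (Suc m)) y (lin z b K)"
    unfolding lin_span_def by blast
  have "cg (N (Suc m)) (x \<otimes> y) (lin z (\<lambda>k. a k + b k) K)"
    using cgN_mult[OF a(3) b(3)] lin_add[OF z] by simp
  then show "x \<otimes> y \<in> lin_span z lev K c m"
    unfolding lin_span_def using a b by (auto simp: supp_le_def intro!: exI[of _ "\<lambda>k. a k + b k"])
qed

lemma lin_mem_lin_span:
  assumes "\<And>k. k < K \<Longrightarrow> z k \<in> carrier G"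
    and "supp_le lev K m a" "\<And>k. k < K \<Longrightarrow> c dvd a k"
  shows "lin z a K \<in> lin_span z lev K c m"
proof -
  have "lin z a K \<in> carrier G" by (rule lin_closed) (rule assms(1))
  then have "cg (N (Suc m)) (lin z a K) (lin z a K)" by (rule cgN_refl)
  then show ?thesis unfolding lin_span_def using assms(2,3) by blast
qed

lemma lin_span_mono: "c' dvd c \<Longrightarrow> lin_span z lev K c m \<subseteq> lin_span z lev K c' m"
  unfolding lin_span_def using dvd_trans by blast

lemma lin_span_subset_N0:
  assumes z: "\<And>k. k < K \<Longrightarrow> z k \<in> N 0"
  shows "lin_span z lev K c m \<subseteq> N 0"
proof
  fix x assume "x \<in> lin_span z lev K c m"
  then obtain a where "cg (N (Suc m)) x (lin z a K)" unfolding lin_span_def by blast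
  then have "cg (N 0) x (lin z a K)" by (rule cgN_antimono) simp
  moreover have "lin z a K \<in> N 0"
    by (rule lin_mem[OF N_subgroup]) (use z subgroup_int_pow_closed[OF N_subgroup] in auto)
  ultimately show "x \<in> N 0" using cg_mem[OF N_subgroup] by blast
qed

lemma lin_span_pow:
  assumes z: "\<And>k. k < K \<Longrightarrow> z k \<in> carrier G" and x: "x \<in> lin_span z lev K 1 m"
  shows "x [^] (p::nat) \<in> lin_span z lev K (int p) m"
proof -
  obtain a where a: "supp_le lev K m a" "cg (N (Suc m)) x (lin z a K)"
    using x unfolding lin_span_def by blast
  have "cg (N (Suc m)) (x [^] p) (lin z (\<lambda>k. int p * a k) K)"
    using cgN_pow[OF a(2), of p] lin_scale[OF z, where c = "int p" and a = a] by (simp add: int_pow_int)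
  then show ?thesis
    unfolding lin_span_def using a(1) by (auto simp: supp_le_def intro!: exI[of _ "\<lambda>k. int p * a k"])
qed

text \<open>Modulo \<open>B\<close> an element is determined by its coefficients modulo
  \<open>T\<close>.\<close>

lemma fin_mod_lin_span:
  assumes z: "\<And>k. k < K \<Longrightarrow> z k \<in> carrier G" and B: "subgroup B G" "N (Suc m) \<subseteq> B" and T: "T > 0"
    and TB: "\<And>a. supp_le lev K m a \<Longrightarrow> lin z (\<lambda>k. int T * a k) K \<in> B"
  shows "fin_mod B (lin_span z lev K 1 m)"
proof -
  have "\<forall>x\<in>lin_span z lev K 1 m. \<exists>a. supp_le lev K m a \<and> cg (N (Suc m)) x (lin z a K)"
    unfolding lin_span_def by blast
  from bchoice[OF this] obtain a where "\<forall>x\<in>lin_span z lev K 1 m. supp_le lev K m (a x) \<and> cg (N (Suc m)) x (lin z (a x) K)" by blast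
  then have a: "\<And>x. x \<in> lin_span z lev K 1 m \<Longrightarrow> supp_le lev K m (a x)"
    "\<And>x. x \<in> lin_span z lev K 1 m \<Longrightarrow> cg B x (lin z (a x) K)"
    using cg_mono B(2) by blast+
  define h where "h x = restrict (\<lambda>k. a x k mod int T) {..<K}" for x
  show ?thesis
  proof (rule fin_modI[OF B(1), where h = h])
    show "lin_span z lev K 1 m \<subseteq> carrier G" using subgroup.subset[OF subgroup_lin_span[OF z]] .
    have "h ` lin_span z lev K 1 m \<subseteq> PiE {..<K} (\<lambda>_. {0..<int T})"
      unfolding h_def using T by (intro image_subsetI restrict_PiE_iff[THEN iffD2]) auto
    then show "finite (h ` lin_span z lev K 1 m)"
      by (rule finite_subset) (intro finite_PiE, auto)
    fix x y assume xy: "x \<in> lin_span z lev K 1 m" "y \<in> lin_span z lev K 1 m" "h x = h y"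
    define d where "d k = (a x k - a y k) div int T" for k
    have d: "a x k - a y k = int T * d k" if "k < K" for k
    proof -
      have "a x k mod int T = a y k mod int T"
        using fun_cong[OF xy(3), of k] that by (simp add: h_def)
      then show ?thesis unfolding d_def by (simp add: mod_eq_dvd_iff)
    qed
    have "supp_le lev K m d"
      unfolding supp_le_def d_def using a(1)[OF xy(1)] a(1)[OF xy(2)] by (simp add: supp_le_def)
    then have "lin z (\<lambda>k. int T * d k) K \<in> B" by (rule TB)
    also have "lin z (\<lambda>k. int T * d k) K = lin z (\<lambda>k. a x k - a y k) K"
      using d by (intro lin_cong) simp
    also have "\<dots> = lin z (a x) K \<otimes> inv (lin z (a y) K)" by (rule lin_diff[OF z])
    finally have "cg B (lin z (a x) K) (lin z (a y) K)"
      by (simp add: cg_def lin_closed[OF z])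
    then show "cg B x y"
      using cg_trans[OF B(1) cg_trans[OF B(1) a(2)[OF xy(1)]] cg_sym[OF B(1) a(2)[OF xy(2)]]] by blast
  qed
qed

text \<open>The group \<open>?F / ?P\<close> is finite and killed by \<open>p\<close>. By maximality
  of \<open>B\<close> it embeds into \<open>N 0 / B\<close> and meets every nontrivial subgroup
  there. Hence torsion prime to \<open>p\<close> disappears in \<open>N 0 / B\<close>, and its
  \<open>p\<close>-socle lies in the finite image of \<open>?F\<close>.\<close>

lemma lin_span_complement:
  assumes p: "prime p" and z: "\<And>k. k < K \<Longrightarrow> z k \<in> N 0"
  shows "\<exists>B. subgroup B G \<and> N (Suc m) \<subseteq> B \<and> B \<inter> lin_span z lev K 1 m \<subseteq> lin_span z lev K (int p) m \<and>
    (\<forall>x\<in>N 0. \<exists>e. x [^] (p ^ e) \<in> B) \<and> fin_socle p (N 0) B"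
proof -
  let ?F = "lin_span z lev K 1 m" and ?P = "lin_span z lev K (int p) m"
  have zc: "z k \<in> carrier G" if "k < K" for k
    using z[OF that] subgroup.mem_carrier[OF N_subgroup] by blast
  note N0c = subgroup.mem_carrier[OF N_subgroup]
  have F: "subgroup ?F G" and P: "subgroup ?P G" by (rule subgroup_lin_span[OF zc]; simp)+
  obtain B where B: "subgroup B G" "?P \<subseteq> B" "B \<subseteq> N 0" "B \<inter> ?F \<subseteq> ?P"
    and ess: "\<And>x. x \<in> N 0 \<Longrightarrow> x \<notin> B \<Longrightarrow> \<exists>i::int. \<exists>b\<in>B. x [^] i \<otimes> b \<in> ?F - ?P"
    using ex_maximal_complement[OF P N_subgroup lin_span_mono[of 1 "int p" z lev K m] lin_span_subset_N0[of K z lev 1 m, OF z]]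
    by auto
  have NB: "N (Suc m) \<subseteq> B" using N_Suc_subset_lin_span B(2) by blast
  note Bc = subgroup.mem_carrier[OF B(1)]
  \<comment> \<open>After raising to \<open>p ^ a\<close>, the order modulo \<open>B\<close> divides
    \<open>q\<close>, which is prime to \<open>p\<close>. An element of \<open>?F - ?P\<close>
    obtained from a nontrivial class would have both its \<open>q\<close>-th and its
    \<open>p\<close>-th power in \<open>?P\<close>, hence would lie in \<open>?P\<close>.\<close>
  have tors: "\<exists>e. x [^] (p ^ e) \<in> B" if x: "x \<in> N 0" for x
  proof -
    obtain t :: nat where t: "t > 0" "x [^] t \<in> N (Suc m)" using N_torsion[OF x] by blast
    obtain a q where q: "t = p ^ a * q" "\<not> p dvd q"
      using t p by (metis multiplicity_decompose' not_prime_unit not_gr_zero)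
    define y where "y = x [^] (p ^ a)"
    have yc: "y \<in> carrier G" and y0: "y \<in> N 0"
      unfolding y_def using x N0c subgroup_nat_pow_closed[OF N_subgroup] by auto
    have yq: "y [^] q \<in> B" using t q NB N0c[OF x] by (auto simp: y_def nat_pow_pow)
    have "y \<in> B"
    proof (rule ccontr)
      assume "y \<notin> B"
      then obtain i :: int and b where f: "b \<in> B" "y [^] i \<otimes> b \<in> ?F - ?P" using ess[OF y0] by blast
      define f where "f = y [^] i \<otimes> b"
      have fF: "f \<in> ?F" "f \<notin> ?P" and fc: "f \<in> carrier G"
        using f yc Bc by (auto simp: f_def)
      have "f [^] q = (y [^] q) [^] i \<otimes> b [^] q"
        unfolding f_def using yc Bc[OF f(1)]
        by (simp add: int_pow_distrib int_pow_int[symmetric] int_pow_pow mult.commute)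
      then have "f [^] q \<in> B"
        using subgroup_int_pow_closed[OF B(1) yq] subgroup_nat_pow_closed[OF B(1) f(1)]
          subgroup.m_closed[OF B(1)] by simp
      then have "f [^] q \<in> ?P" using B(4) subgroup_nat_pow_closed[OF F fF(1)] by blast
      then have "f [^] int q \<in> ?P" by (simp add: int_pow_int)
      moreover have "f [^] int p \<in> ?P" using lin_span_pow[OF zc fF(1)] by (simp add: int_pow_int)
      moreover have "coprime (int q) (int p)"
        using p q(2) by (simp add: prime_imp_coprime coprime_commute)
      ultimately show False using int_pow_coprime_mem[OF P fc] fF(2) by blast
    qed
    then show ?thesis unfolding y_def by blast
  qed
  let ?X = "{x \<in> N 0. x [^] p \<in> B}"
  \<comment> \<open>If \<open>x\<close> is not in \<open>B\<close>, essentiality gives an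
    \<open>f\<close> in \<open>?F - ?P\<close> congruent to \<open>x [^] i\<close>. Here
    \<open>p\<close> does not divide \<open>i\<close>, since otherwise \<open>f\<close> would lie in
    \<open>B\<close>; so \<open>i\<close> is invertible modulo \<open>p\<close> and \<open>x\<close>
    is congruent to a power of \<open>f\<close>.\<close>
  have "\<exists>g\<in>?F. cg B x g" if x: "x \<in> ?X" for x
  proof (cases "x \<in> B")
    case True
    then show ?thesis using subgroup.one_closed[OF F] cg_one[OF B(1)] by blast
  next
    case False
    have xc: "x \<in> carrier G" using x N0c by blast
    obtain i :: int and b where f: "b \<in> B" "x [^] i \<otimes> b \<in> ?F - ?P" using ess x False by blast
    define f where "f = x [^] i \<otimes> b"
    have fF: "f \<in> ?F" "f \<notin> ?P" and fc: "f \<in> carrier G"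
      using f xc Bc by (auto simp: f_def)
    have "\<not> int p dvd i"
    proof
      assume "int p dvd i"
      then obtain j where "i = int p * j" by blast
      then have "x [^] i = (x [^] p) [^] j" using xc by (simp add: int_pow_int[symmetric] int_pow_pow)
      then have "f \<in> B"
        unfolding f_def using x f(1) subgroup_int_pow_closed[OF B(1)] subgroup.m_closed[OF B(1)] by simp
      then show False using fF B(4) by blast
    qed
    then have "coprime (int p) i" using p by (simp add: prime_imp_coprime)
    then obtain u v where uv: "u * int p + v * i = 1" by (metis bezout_int coprime_imp_gcd_eq_1)
    have "x = x [^] (i * v + int p * u)" using uv xc by (simp add: algebra_simps int_pow_1)
    also have "\<dots> = (x [^] i) [^] v \<otimes> (x [^] p) [^] u"
      using xc by (simp add: int_pow_mult int_pow_pow int_pow_int[symmetric])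
    finally have xeq: "x = (x [^] i) [^] v \<otimes> (x [^] p) [^] u" .
    have "cg B x ((x [^] i) [^] v)"
      by (subst xeq, rule cg_mult_right[OF B(1)]) (use xc x subgroup_int_pow_closed[OF B(1)] in auto)
    moreover have "cg B (x [^] i) f"
      unfolding f_def using cg_sym[OF B(1) cg_mult_right[OF B(1) _ f(1)]] xc by simp
    ultimately have "cg B x (f [^] v)" using cg_trans[OF B(1)] cg_int_pow[OF B(1)] by blast
    then show ?thesis using subgroup_int_pow_closed[OF F fF(1)] by blast
  qed
  then have "\<forall>x\<in>?X. \<exists>g. g \<in> ?F \<and> cg B x g" by blast
  from bchoice[OF this] obtain g where "\<forall>x\<in>?X. g x \<in> ?F \<and> cg B x (g x)" by blast
  then have g: "\<And>x. x \<in> ?X \<Longrightarrow> g x \<in> ?F" "\<And>x. x \<in> ?X \<Longrightarrow> cg B x (g x)" by blast+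
  have finF: "fin_mod B ?F"
  proof (rule fin_mod_lin_span[OF zc B(1) NB])
    show "p > 0" using p prime_gt_0_nat by simp
    fix a assume "supp_le lev K m a"
    then have "lin z (\<lambda>k. int p * a k) K \<in> ?P"
      by (intro lin_mem_lin_span[OF zc]) (auto simp: supp_le_def)
    then show "lin z (\<lambda>k. int p * a k) K \<in> B" using B(2) by blast
  qed
  define h where "h = (#>) B"
  note h = fin_modD[OF finF B(1) subgroup.subset[OF F], folded h_def]
  have "fin_mod B ?X"
  proof (rule fin_modI[OF B(1), where h = "\<lambda>x. h (g x)"])
    show "?X \<subseteq> carrier G" using N0c by blast
    have "(\<lambda>x. h (g x)) ` ?X \<subseteq> h ` ?F" using g(1) by blast
    then show "finite ((\<lambda>x. h (g x)) ` ?X)" using h(1) finite_subset by blast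
    fix x y assume xy: "x \<in> ?X" "y \<in> ?X" "h (g x) = h (g y)"
    then have "cg B (g x) (g y)" using h(2) g(1) by blast
    then show "cg B x y"
      using cg_trans[OF B(1) cg_trans[OF B(1) g(2)[OF xy(1)]] cg_sym[OF B(1) g(2)[OF xy(2)]]] by blast
  qed
  then show ?thesis using B NB tors unfolding fin_socle_def by blast
qed

end

section \<open>Choosing an independent sequence\<close>

context torsion_filtered_group
begin

text \<open>Additively, two properties of \<open>w\<close> in \<open>N l\<close> suffice. First,
  \<open>p w\<close> is in \<open>N (Suc l)\<close> and \<open>w\<close> is not in the span of the
  old elements modulo \<open>N (Suc l)\<close>; this makes the coefficient of \<open>w\<close> in
  any relation divisible by \<open>p\<close>. Second, \<open>p w\<close> is in the complements
  \<open>B m\<close>; then the old part of the relation falls into \<open>B m\<close>, hence into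
  the \<open>p\<close>-multiples of the span, and independence of the old elements applies.\<close>

lemma indep_extend:
  assumes p: "prime p" and z: "\<And>k. k < K \<Longrightarrow> z k \<in> N (lev k)" and ind: "indep p z lev K"
    and bad: "\<not> fin_socle p (N (lev K)) (N (Suc (lev K)))"
  shows "\<exists>w\<in>N (lev K). indep p (z(K := w)) lev (Suc K)"
proof -
  define l where "l = lev K"
  have z0: "z k \<in> N 0" if "k < K" for k using z[OF that] N_antimono[OF le0[of "lev k"]] by blast
  have Nc: "x \<in> carrier G" if "x \<in> N j" for x j using that subgroup.mem_carrier[OF N_subgroup] by blast
  have zc: "z k \<in> carrier G" if "k < K" for k using z0[OF that] by (rule Nc)
  \<comment> \<open>Beyond the largest level \<open>M\<close> that occurs no further elements come
    into play, so complements are needed only for the finitely many \<open>m\<close> in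
    \<open>{l..M}\<close>.\<close>
  obtain M where M: "l \<le> M" "\<And>k. k < K \<Longrightarrow> lev k \<le> M"
  proof
    show "l \<le> Max (insert l (lev ` {..<K}))" by simp
    show "lev k \<le> Max (insert l (lev ` {..<K}))" if "k < K" for k using that by simp
  qed
  have "\<forall>m. \<exists>B. subgroup B G \<and> N (Suc m) \<subseteq> B \<and> B \<inter> lin_span z lev K 1 m \<subseteq> lin_span z lev K (int p) m \<and>
      (\<forall>x\<in>N 0. \<exists>e. x [^] (p ^ e) \<in> B) \<and> fin_socle p (N 0) B"
    by (intro allI lin_span_complement p z0)
  then obtain B where "\<forall>m. subgroup (B m) G \<and> N (Suc m) \<subseteq> B m \<and>
      B m \<inter> lin_span z lev K 1 m \<subseteq> lin_span z lev K (int p) m \<and>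
      (\<forall>x\<in>N 0. \<exists>e. x [^] (p ^ e) \<in> B m) \<and> fin_socle p (N 0) (B m)"
    by (rule choice[THEN exE])
  then have B: "\<And>m. subgroup (B m) G" "\<And>m. N (Suc m) \<subseteq> B m"
    "\<And>m. B m \<inter> lin_span z lev K 1 m \<subseteq> lin_span z lev K (int p) m"
    "\<And>m x. x \<in> N 0 \<Longrightarrow> \<exists>e. x [^] (p ^ e) \<in> B m" "\<And>m. fin_socle p (N 0) (B m)"
    by simp_all
  note Bpow = subgroup_nat_pow_closed[OF B(1)]
  have Nl0: "x \<in> N 0" if "x \<in> N l" for x using that N_antimono[OF le0[of l]] by blast
  define U where "U = {w \<in> N l. \<forall>m\<in>{l..M}. w [^] p \<in> B m}"
  have U: "subgroup U G"
  proof (rule subgroupI)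
    show "U \<subseteq> carrier G" unfolding U_def using Nc by blast
    have "\<one> \<in> U"
      unfolding U_def using subgroup.one_closed[OF N_subgroup] subgroup.one_closed[OF B(1)] by simp
    then show "U \<noteq> {}" by blast
    fix x assume x: "x \<in> U"
    then have xc: "x \<in> carrier G" using Nc by (auto simp: U_def)
    show "inv x \<in> U"
      using x xc subgroup.m_inv_closed[OF N_subgroup] subgroup.m_inv_closed[OF B(1)]
      by (simp add: U_def nat_pow_inv)
    fix y assume y: "y \<in> U"
    then have yc: "y \<in> carrier G" using Nc by (auto simp: U_def)
    show "x \<otimes> y \<in> U"
      using x y xc yc subgroup.m_closed[OF N_subgroup] subgroup.m_closed[OF B(1)]
      by (simp add: U_def nat_pow_distrib)
  qed
  have torsU: "\<exists>e. x [^] (p ^ e) \<in> U" if x: "x \<in> N l" for x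
  proof -
    obtain e where e: "\<And>m. x [^] (p ^ e m) \<in> B m" using B(4)[OF Nl0[OF x]] by metis
    define E where "E = (\<Sum>m\<in>{l..M}. e m)"
    have "(x [^] (p ^ E)) [^] p \<in> B m" if m: "m \<in> {l..M}" for m
    proof -
      have "e m \<le> E" unfolding E_def using m by (intro member_le_sum) auto
      then obtain d where "E = e m + d" using le_Suc_ex by blast
      then have "(x [^] (p ^ E)) [^] p = (x [^] (p ^ e m)) [^] (p ^ d * p)"
        using Nc[OF x] by (simp add: nat_pow_pow power_add mult.assoc)
      then show ?thesis using Bpow[OF e] by simp
    qed
    then have "x [^] (p ^ E) \<in> U"
      unfolding U_def using subgroup_nat_pow_closed[OF N_subgroup x] by blast
    then show ?thesis by blast
  qed
  \<comment> \<open>If \<open>x [^] p\<close> is in \<open>U\<close>, its class modulo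
    \<open>B m\<close> lies in the finite socle of \<open>N 0 / B m\<close>. These finitely many
    classes determine \<open>x\<close> modulo \<open>U\<close>.\<close>
  have finU: "fin_socle p (N l) U"
    unfolding fin_socle_def
  proof (rule fin_modI[OF U, where h = "\<lambda>x. restrict (\<lambda>m. B m #> (x [^] p)) {l..M}"])
    let ?X = "{x \<in> N l. x [^] p \<in> U}"
    show "?X \<subseteq> carrier G" using Nc by blast
    have "(\<lambda>x. restrict (\<lambda>m. B m #> (x [^] p)) {l..M}) ` ?X \<subseteq>
        PiE {l..M} (\<lambda>m. (\<lambda>y. B m #> y) ` {y \<in> N 0. y [^] p \<in> B m})"
    proof (intro image_subsetI restrict_PiE_iff[THEN iffD2] ballI)
      fix x m assume "x \<in> ?X" "m \<in> {l..M}"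
      then have "x [^] p \<in> N 0" "(x [^] p) [^] p \<in> B m"
        using Nl0 subgroup_nat_pow_closed[OF N_subgroup] by (auto simp: U_def)
      then show "B m #> x [^] p \<in> (\<lambda>y. B m #> y) ` {y \<in> N 0. y [^] p \<in> B m}" by blast
    qed
    moreover have "finite (PiE {l..M} (\<lambda>m. (\<lambda>y. B m #> y) ` {y \<in> N 0. y [^] p \<in> B m}))"
      using B(5) by (intro finite_PiE) (auto simp: fin_socle_def fin_mod_def)
    ultimately show "finite ((\<lambda>x. restrict (\<lambda>m. B m #> (x [^] p)) {l..M}) ` ?X)"
      by (rule finite_subset)
    fix x y assume xy: "x \<in> ?X" "y \<in> ?X"
      "restrict (\<lambda>m. B m #> (x [^] p)) {l..M} = restrict (\<lambda>m. B m #> (y [^] p)) {l..M}"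
    have c: "x \<in> carrier G" "y \<in> carrier G" using xy Nc by auto
    have "(x \<otimes> inv y) [^] p \<in> B m" if "m \<in> {l..M}" for m
    proof -
      have "B m #> (x [^] p) = B m #> (y [^] p)" using fun_cong[OF xy(3), of m] that by simp
      then have "cg (B m) (x [^] p) (y [^] p)" using rcos_eq_iff_cg[OF B(1)] c by simp
      then show ?thesis using cg_diff c by (fastforce simp: nat_pow_distrib nat_pow_inv)
    qed
    then have "x \<otimes> inv y \<in> U"
      unfolding U_def using xy subgroup.m_closed[OF N_subgroup] subgroup.m_inv_closed[OF N_subgroup] by simp
    then show "cg U x y" using c by (simp add: cg_def)
  qed
  \<comment> \<open>The exponent \<open>1\<close> presents the product of \<open>U\<close> and
    \<open>N (Suc l)\<close> as an instance of \<open>subgroup_pow_mult\<close>.\<close>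
  define V where "V = {u [^] (1::nat) \<otimes> n |u n. u \<in> U \<and> n \<in> N (Suc l)}"
  have V: "subgroup V G" unfolding V_def by (rule subgroup_pow_mult[OF U N_subgroup])
  have V_iff: "x \<in> V \<longleftrightarrow> (\<exists>u\<in>U. \<exists>n\<in>N (Suc l). x = u \<otimes> n)" for x
  proof -
    have "u [^] (1::nat) = u" if "u \<in> U" for u using subgroup.mem_carrier[OF U that] by simp
    then show ?thesis unfolding V_def mem_Collect_eq by metis
  qed
  have UV: "U \<subseteq> V"
    using subgroup.one_closed[OF N_subgroup] subgroup.mem_carrier[OF U] by (force simp: V_iff subset_iff)
  have NV: "N (Suc l) \<subseteq> V"
    using subgroup.one_closed[OF U] Nc by (force simp: V_iff subset_iff)
  have VN: "V \<subseteq> N l"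
  proof
    fix x assume "x \<in> V"
    then obtain u n where x: "u \<in> U" "n \<in> N (Suc l)" "x = u \<otimes> n" using V_iff by blast
    then have "u \<in> N l" "n \<in> N l" using N_Suc by (auto simp: U_def)
    then show "x \<in> N l" unfolding x(3) by (rule subgroup.m_closed[OF N_subgroup])
  qed
  have finV: "fin_socle p (N l) V"
    by (rule fin_socle_quotient[OF U V N_subgroup UV VN torsU finU])
  let ?W = "{w \<in> N l. w [^] p \<in> N (Suc l)}"
  have finW: "fin_mod V ?W"
    using finV unfolding fin_socle_def by (rule fin_mod_subset) (use NV in blast)
  let ?F = "lin_span z lev K 1 l"
  have F: "subgroup ?F G" by (rule subgroup_lin_span[OF zc])
  have NF: "N (Suc l) \<subseteq> ?F" by (rule N_Suc_subset_lin_span)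
  \<comment> \<open>A common exponent of the old elements modulo \<open>N (Suc l)\<close>; it makes
    their span finite modulo \<open>N (Suc l)\<close>.\<close>
  obtain T where T: "T > 0" "\<And>k. k < K \<Longrightarrow> z k [^] (T::nat) \<in> N (Suc l)"
  proof -
    have "\<forall>k. \<exists>t::nat. k < K \<longrightarrow> t > 0 \<and> z k [^] t \<in> N (Suc l)" using N_torsion[OF z0] by blast
    then obtain t where t: "\<And>k. k < K \<Longrightarrow> t k > (0::nat) \<and> z k [^] t k \<in> N (Suc l)" by metis
    have "z k [^] (\<Prod>k<K. t k) \<in> N (Suc l)" if "k < K" for k
    proof -
      have "t k dvd (\<Prod>k<K. t k)" using that by (intro dvd_prodI) auto
      then obtain s where "(\<Prod>k<K. t k) = t k * s" by blast
      then have "z k [^] (\<Prod>k<K. t k) = (z k [^] t k) [^] s" using zc[OF that] by (simp add: nat_pow_pow)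
      then show ?thesis using t[OF that] subgroup_nat_pow_closed[OF N_subgroup] by simp
    qed
    moreover have "(\<Prod>k<K. t k) > 0" using t by (simp add: prod_pos)
    ultimately show ?thesis using that by blast
  qed
  have finF: "fin_mod (N (Suc l)) ?F"
  proof (rule fin_mod_lin_span[OF zc N_subgroup subset_refl T(1)])
    fix a
    have "z k [^] (int T * a k) \<in> N (Suc l)" if "k < K" for k
    proof -
      have "z k [^] (int T * a k) = (z k [^] T) [^] a k"
        using zc[OF that] by (simp add: int_pow_pow int_pow_int[symmetric])
      then show ?thesis using subgroup_int_pow_closed[OF N_subgroup T(2)[OF that]] by simp
    qed
    then show "lin z (\<lambda>k. int T * a k) K \<in> N (Suc l)" by (intro lin_mem[OF N_subgroup])
  qed
  \<comment> \<open>Otherwise \<open>?W \<inter> V\<close> would lie in the span \<open>?F\<close>,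
    which is finite modulo \<open>N (Suc l)\<close>. As \<open>?W\<close> has finitely many classes
    modulo \<open>V\<close>, it would be finite modulo \<open>N (Suc l)\<close>, against
    \<open>bad\<close>.\<close>
  have "\<exists>w\<in>?W \<inter> U. w \<notin> ?F"
  proof (rule ccontr)
    assume "\<not> ?thesis"
    then have WU: "w \<in> ?F" if "w \<in> ?W" "w \<in> U" for w using that by blast
    have "?W \<inter> V \<subseteq> ?F"
    proof
      fix w assume w: "w \<in> ?W \<inter> V"
      then obtain u n where u: "u \<in> U" "n \<in> N (Suc l)" "w = u \<otimes> n" using V_iff by blast
      have c: "u \<in> carrier G" "n \<in> carrier G" using u(1,2) subgroup.mem_carrier[OF U] Nc by auto
      have "cg (N (Suc l)) w u" unfolding u(3) by (rule cg_mult_right[OF N_subgroup c(1) u(2)])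
      then have "u [^] p \<in> N (Suc l)"
        using cg_mem[OF N_subgroup cgN_pow, of "Suc l" w u p] w by blast
      then have "u \<in> ?F" using WU u(1) by (simp add: U_def)
      then show "w \<in> ?F" unfolding u(3) using u(2) NF subgroup.m_closed[OF F] by blast
    qed
    then have finWV: "fin_mod (N (Suc l)) (?W \<inter> V)" by (rule fin_mod_subset[OF finF])
    have Wc: "?W \<subseteq> carrier G" using Nc by blast
    define h where "h = (#>) V"
    note h = fin_modD[OF finW V Wc, folded h_def]
    have "fin_mod (N (Suc l)) ?W"
    proof (rule fin_mod_fiber[OF N_subgroup Wc h(1) finWV])
      show "?W \<inter> V \<subseteq> carrier G" using Wc by blast
      fix x y assume xy: "x \<in> ?W" "y \<in> ?W" "h x = h y"
      have c: "x \<in> carrier G" "y \<in> carrier G" using xy Nc by auto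
      have "x \<otimes> inv y \<in> V" using h(2)[OF xy] by (rule cg_diff)
      moreover have "x \<otimes> inv y \<in> ?W"
        using xy c subgroup.m_closed[OF N_subgroup] subgroup.m_inv_closed[OF N_subgroup]
        by (simp add: nat_pow_distrib nat_pow_inv)
      ultimately show "x \<otimes> inv y \<in> ?W \<inter> V" by blast
    qed
    then show False using bad unfolding fin_socle_def l_def by blast
  qed
  then obtain w where w: "w \<in> N l" "w [^] p \<in> N (Suc l)" "w \<in> U" "w \<notin> ?F" by blast
  have wc: "w \<in> carrier G" using w(1) by (rule Nc)
  have "indep p (z(K := w)) lev (Suc K)"
    unfolding indep_def
  proof (intro allI impI)
    fix m a k
    assume a: "supp_le lev (Suc K) m a" and mem: "lin (z(K := w)) a (Suc K) \<in> N (Suc m)" and k: "k < Suc K"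
    have a': "supp_le lev K m a" using a by (simp add: supp_le_def)
    have "lin (z(K := w)) a K = lin z a K" by (rule lin_cong) simp
    then have mem': "lin z a K \<otimes> w [^] a K \<in> N (Suc m)" using mem by simp
    have lc: "lin z a K \<in> carrier G" by (rule lin_closed[OF zc])
    show "int p dvd a k"
    proof (cases "m < l")
      case True
      then have aK: "a K = 0" using a by (simp add: supp_le_def l_def)
      then have "lin z a K \<in> N (Suc m)" using mem' lc by simp
      then have "\<forall>k<K. int p dvd a k" using ind a' unfolding indep_def by blast
      then show ?thesis using aK k by (cases "k = K") auto
    next
      case False
      have cgw: "cg (N (Suc m)) (lin z a K) (w [^] (- a K))"
        using mem' lc wc by (simp add: cg_def int_pow_neg)
      have pK: "int p dvd a K"
      proof (rule ccontr)
        assume n: "\<not> int p dvd a K"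
        define b where "b k = (if l < lev k then 0 else a k)" for k
        have bF: "lin z b K \<in> ?F"
          by (rule lin_mem_lin_span[OF zc]) (auto simp: supp_le_def b_def)
        have "lin z (\<lambda>k. a k - b k) K \<in> N (Suc l)"
        proof (rule lin_mem[OF N_subgroup])
          fix k assume k: "k < K"
          show "z k [^] (a k - b k) \<in> N (Suc l)"
          proof (cases "l < lev k")
            case True
            then have "z k \<in> N (Suc l)" using z[OF k] N_antimono[of "Suc l" "lev k"] by auto
            then show ?thesis by (rule subgroup_int_pow_closed[OF N_subgroup])
          next
            case False
            then show ?thesis using subgroup.one_closed[OF N_subgroup] by (simp add: b_def)
          qed
        qed
        then have "cg ?F (lin z a K) (lin z b K)"
          using NF by (auto simp: lin_diff[OF zc] cg_def lin_closed[OF zc])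
        then have "lin z a K \<in> ?F" using cg_mem[OF F] bF by blast
        moreover have "N (Suc m) \<subseteq> ?F" using N_antimono[of "Suc l" "Suc m"] False NF by auto
        ultimately have "w [^] (- a K) \<in> ?F" using cg_mem[OF F cg_mono[OF cgw]] by blast
        moreover have "w [^] int p \<in> ?F" using w(2) NF by (auto simp: int_pow_int)
        moreover have "coprime (- a K) (int p)"
          using p n by (simp add: prime_imp_coprime coprime_commute)
        ultimately show False using int_pow_coprime_mem[OF F wc] w(4) by blast
      qed
      then obtain c where c: "a K = int p * c" by blast
      \<comment> \<open>For \<open>m\<close> above \<open>M\<close> the relation is weakened to one
        modulo \<open>N (Suc M)\<close>, where a complement is available; no coefficient is lost
        because no old level exceeds \<open>M\<close>.\<close>
      define m' where "m' = min m M"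
      have m': "m' \<in> {l..M}" "m' \<le> m" using False M(1) by (auto simp: m'_def)
      have supp: "supp_le lev K m' a"
        unfolding supp_le_def
      proof (intro allI impI)
        fix k assume k: "k < K" "m' < lev k"
        then have "m < lev k" using M(2)[OF k(1)] by (auto simp: m'_def)
        then show "a k = 0" using a' k(1) by (simp add: supp_le_def)
      qed
      have "w [^] (- a K) = (w [^] p) [^] (- c)"
        using wc by (simp add: c int_pow_pow int_pow_int[symmetric])
      then have "w [^] (- a K) \<in> B m'"
        using w(3) m'(1) subgroup_int_pow_closed[OF B(1)] by (simp add: U_def)
      moreover have "cg (B m') (lin z a K) (w [^] (- a K))"
        using cg_mono[OF cgN_antimono[OF cgw] B(2)] m'(2) by simp
      ultimately have "lin z a K \<in> B m'" using cg_mem[OF B(1)] by blast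
      moreover have "lin z a K \<in> lin_span z lev K 1 m'"
        by (rule lin_mem_lin_span[OF zc supp]) auto
      ultimately have "lin z a K \<in> lin_span z lev K (int p) m'" using B(3) by blast
      then obtain b where b: "supp_le lev K m' b" "\<forall>k<K. int p dvd b k"
        "cg (N (Suc m')) (lin z a K) (lin z b K)"
        unfolding lin_span_def by blast
      have "lin z (\<lambda>k. a k - b k) K \<in> N (Suc m')"
        using cg_diff[OF b(3)] lin_diff[OF zc] by simp
      moreover have "supp_le lev K m' (\<lambda>k. a k - b k)" using supp b(1) by (simp add: supp_le_def)
      ultimately have "\<forall>k<K. int p dvd a k - b k" using ind unfolding indep_def by blast
      then have "\<forall>k<K. int p dvd a k" using b(2) dvd_diff_commute dvd_add_right_iff by (metis diff_add_cancel)
      then show ?thesis using pK k by (cases "k = K") auto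
    qed
  qed
  then show ?thesis using w(1) unfolding l_def by blast
qed

theorem ex_independent_sequence:
  assumes p: "prime p" and bad: "\<And>k. \<not> fin_socle p (N (lev k)) (N (Suc (lev k)))"
  shows "\<exists>z. (\<forall>k. z k \<in> N (lev k)) \<and> (\<forall>K. indep p z lev K)"
proof -
  define P where "P n z \<longleftrightarrow> (\<forall>k<n. z k \<in> N (lev k)) \<and> indep p z lev n" for n z
  have indep_cong: "indep p z lev K \<longleftrightarrow> indep p z' lev K" if "\<And>k. k < K \<Longrightarrow> z k = z' k" for z z' K
    using lin_cong[of K z z'] that unfolding indep_def by (metis (no_types, lifting))
  have "\<exists>f. \<forall>n. P n (f n) \<and> (\<forall>k<n. f (Suc n) k = f n k)"
  proof (rule dependent_nat_choice)
    show "\<exists>z. P 0 z" by (simp add: P_def indep_def)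
    fix z n assume "P n z"
    then obtain w where w: "w \<in> N (lev n)" "indep p (z(n := w)) lev (Suc n)"
      using indep_extend[OF p, of n z lev] bad unfolding P_def by blast
    then have "P (Suc n) (z(n := w))" using \<open>P n z\<close> by (auto simp: P_def less_Suc_eq)
    then show "\<exists>y. P (Suc n) y \<and> (\<forall>k<n. y k = z k)" by (intro exI[of _ "z(n := w)"]) auto
  qed
  then obtain f where f: "\<And>n. P n (f n)" "\<And>n k. k < n \<Longrightarrow> f (Suc n) k = f n k" by blast
  define z where "z k = f (Suc k) k" for k
  have fz: "f n k = z k" if "k < n" for n k
    using that
  proof (induction n)
    case (Suc n)
    then show ?case using f(2)[of k n] by (cases "k = n") (auto simp: z_def)
  qed simp
  have "z k \<in> N (lev k)" for k using f(1)[of "Suc k"] by (simp add: P_def z_def)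
  moreover have "indep p z lev K" for K
    using f(1)[of K] indep_cong[of K "f K" z] fz by (simp add: P_def)
  ultimately show ?thesis by blast
qed

end

section \<open>Reducing ill-foundedness to an orbit equivalence relation\<close>

definition children :: "nat \<Rightarrow> nat list \<Rightarrow> nat list set" where
  "children K s = {t. list_encode t < K \<and> t \<noteq> [] \<and> butlast t = s}"

lemma finite_list_encode_less: "finite {t. list_encode t < K}"
  by (rule finite_vimageI[of "{..<K}" list_encode, unfolded vimage_def lessThan_def mem_Collect_eq])
    (use inj_list_encode in auto)

lemma list_decode_eq_iff: "list_decode k = s \<longleftrightarrow> k = list_encode s"
  by (metis list_decode_inverse list_encode_inverse)

lemma finite_children: "finite (children K s)"
  by (rule finite_subset[OF _ finite_list_encode_less[of K]]) (auto simp: children_def)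

definition admissible :: "nat \<Rightarrow> nat list set \<Rightarrow> int \<Rightarrow> nat \<Rightarrow> (nat list \<Rightarrow> int) \<Rightarrow> nat \<Rightarrow> bool" where
  "admissible p T \<epsilon> n a K \<longleftrightarrow>
     (\<forall>s. a s \<noteq> 0 \<longrightarrow> s \<in> T \<and> length s \<le> n \<and> list_encode s < K) \<and>
     (\<forall>s. length s < n \<longrightarrow> int p dvd a s - sum a (children K s)) \<and> int p dvd a [] - \<epsilon>"

lemma admissible_extend:
  assumes "admissible p T \<epsilon> n a K" "K \<le> K'"
  shows "admissible p T \<epsilon> n a K'"
proof -
  have "sum a (children K' s) = sum a (children K s)" for s
    by (rule sum.mono_neutral_right[OF finite_children])
      (use assms in \<open>auto simp: children_def admissible_def\<close>)
  then show ?thesis using assms unfolding admissible_def by (metis order_less_le_trans)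
qed

lemma admissible_add:
  assumes "admissible p T \<epsilon> n a K" "admissible p T \<delta> n b K"
  shows "admissible p T (\<epsilon> + \<delta>) n (\<lambda>s. a s + b s) K"
  unfolding admissible_def
proof (intro conjI allI impI)
  show "s \<in> T" "length s \<le> n" "list_encode s < K" if "a s + b s \<noteq> 0" for s
  proof -
    have "a s \<noteq> 0 \<or> b s \<noteq> 0" using that by auto
    then show "s \<in> T" "length s \<le> n" "list_encode s < K" using assms unfolding admissible_def by blast+
  qed
  show "int p dvd a s + b s - (\<Sum>t\<in>children K s. a t + b t)" if "length s < n" for s
  proof -
    have "int p dvd (a s - sum a (children K s)) + (b s - sum b (children K s))"
      by (rule dvd_add) (use assms that in \<open>auto simp: admissible_def\<close>)
    then show ?thesis by (simp add: sum.distrib algebra_simps)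
  qed
  have "int p dvd (a [] - \<epsilon>) + (b [] - \<delta>)"
    by (rule dvd_add) (use assms in \<open>auto simp: admissible_def\<close>)
  then show "int p dvd a [] + b [] - (\<epsilon> + \<delta>)" by (simp add: algebra_simps)
qed

lemma admissible_minus:
  assumes "admissible p T \<epsilon> n a K"
  shows "admissible p T (- \<epsilon>) n (\<lambda>s. - a s) K"
  unfolding admissible_def
proof (intro conjI allI impI)
  show "s \<in> T" "length s \<le> n" "list_encode s < K" if "- a s \<noteq> 0" for s
    using assms that by (auto simp: admissible_def)
  show "int p dvd - a s - (\<Sum>t\<in>children K s. - a t)" if "length s < n" for s
  proof -
    have "int p dvd - (a s - sum a (children K s))"
      using assms that by (subst dvd_minus_iff) (auto simp: admissible_def)
    then show ?thesis by (simp add: sum_negf)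
  qed
  have "int p dvd - (a [] - \<epsilon>)"
    using assms by (subst dvd_minus_iff) (auto simp: admissible_def)
  then show "int p dvd - a [] - - \<epsilon>" by simp
qed

text \<open>\<open>z k\<close> belongs to the finite sequence with code \<open>k\<close>, and all
  sequences of length \<open>n\<close> have the same level \<open>lv n\<close>.\<close>

locale independent_family = torsion_filtered_group +
  fixes p :: nat and lv :: "nat \<Rightarrow> nat" and z :: "nat \<Rightarrow> 'a"
  assumes p: "prime p" and lv: "strict_mono lv"
    and z: "z k \<in> N (lv (length (list_decode k)))"
    and ind: "indep p z (\<lambda>k. lv (length (list_decode k))) K"
begin

text \<open>Elements attached to sequences longer than \<open>n\<close> lie in \<open>M n\<close>,
  so modulo \<open>M n\<close> only sequences of length at most \<open>n\<close> are
  visible.\<close>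

abbreviation M :: "nat \<Rightarrow> 'a set" where "M n \<equiv> N (Suc (lv n))"

abbreviation comb :: "(nat list \<Rightarrow> int) \<Rightarrow> nat \<Rightarrow> 'a" where
  "comb a K \<equiv> lin z (\<lambda>k. a (list_decode k)) K"

lemma z_closed: "z k \<in> carrier G"
  using z subgroup.mem_carrier[OF N_subgroup] by blast

text \<open>For strength 0 this is a subgroup; for strength 1 it is empty or a coset of that
  subgroup.\<close>

definition combs :: "nat list set \<Rightarrow> int \<Rightarrow> nat \<Rightarrow> 'a set" where
  "combs T \<epsilon> n = {x. \<exists>a K. admissible p T \<epsilon> n a K \<and> cg (M n) x (comb a K)}"

lemma combs_closed: "x \<in> combs T \<epsilon> n \<Longrightarrow> x \<in> carrier G"
  unfolding combs_def using cg_closed by blast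

lemma comb_extend:
  assumes "admissible p T \<epsilon> n a K" "K \<le> K'"
  shows "comb a K' = comb a K"
proof (rule lin_extend[OF assms(2)])
  fix k assume "K \<le> k"
  then have "\<not> list_encode (list_decode k) < K" by simp
  then show "a (list_decode k) = 0" using assms(1) unfolding admissible_def by blast
qed (rule z_closed)

lemma combs_mult:
  assumes "x \<in> combs T \<epsilon> n" "y \<in> combs T \<delta> n"
  shows "x \<otimes> y \<in> combs T (\<epsilon> + \<delta>) n"
proof -
  obtain a K where a: "admissible p T \<epsilon> n a K" "cg (M n) x (comb a K)"
    using assms(1) unfolding combs_def by blast
  obtain b L where b: "admissible p T \<delta> n b L" "cg (M n) y (comb b L)"
    using assms(2) unfolding combs_def by blast
  let ?K = "max K L"
  have "admissible p T (\<epsilon> + \<delta>) n (\<lambda>s. a s + b s) ?K"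
    by (intro admissible_add admissible_extend[OF a(1)] admissible_extend[OF b(1)]) auto
  moreover have "comb (\<lambda>s. a s + b s) ?K = comb a ?K \<otimes> comb b ?K"
    by (rule lin_add) (rule z_closed)
  then have "comb (\<lambda>s. a s + b s) ?K = comb a K \<otimes> comb b L"
    by (simp only: comb_extend[OF a(1) max.cobounded1] comb_extend[OF b(1) max.cobounded2])
  then have "cg (M n) (x \<otimes> y) (comb (\<lambda>s. a s + b s) ?K)"
    using cgN_mult[OF a(2) b(2)] by simp
  ultimately show ?thesis unfolding combs_def by blast
qed

lemma combs_inv:
  assumes "x \<in> combs T \<epsilon> n"
  shows "inv x \<in> combs T (- \<epsilon>) n"
proof -
  obtain a K where a: "admissible p T \<epsilon> n a K" "cg (M n) x (comb a K)"
    using assms unfolding combs_def by blast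
  have "comb (\<lambda>s. - a s) K = inv (comb a K)"
    by (rule lin_minus) (rule z_closed)
  then have "cg (M n) (inv x) (comb (\<lambda>s. - a s) K)" using cgN_inv[OF a(2)] by simp
  then show ?thesis using admissible_minus[OF a(1)] unfolding combs_def by blast
qed

lemma combs_saturated:
  assumes "cg (M n) x y"
  shows "x \<in> combs T \<epsilon> n \<longleftrightarrow> y \<in> combs T \<epsilon> n"
  unfolding combs_def mem_Collect_eq using cgN_trans[OF assms] cgN_trans[OF cgN_sym[OF assms]] by blast

lemma one_combs: "\<one> \<in> combs T 0 n"
proof -
  have "admissible p T 0 n (\<lambda>_. 0) 0" by (simp add: admissible_def)
  moreover have "cg (M n) \<one> (comb (\<lambda>_. 0) 0)" by (simp add: cgN_refl)
  ultimately show ?thesis unfolding combs_def by blast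
qed

text \<open>By independence, the coefficients modulo \<open>p\<close> at sequences of length at most
  \<open>n\<close> are determined by \<open>g\<close>: in the difference of the two combinations the
  longer sequences contribute an element of \<open>M n\<close>, and what remains is a relation
  modulo \<open>M n\<close>.\<close>

lemma comb_unique:
  assumes a: "admissible p T \<epsilon> n a K" "cg (M n) g (comb a K)"
    and b: "admissible p T' \<delta> n' b L" "cg (M n') g (comb b L)"
    and n: "n \<le> n'" and s: "length s \<le> n"
  shows "int p dvd a s - b s"
proof -
  let ?K = "max K L"
  let ?d = "\<lambda>s. if length s \<le> n then a s - b s else 0"
  let ?e = "\<lambda>s. if length s \<le> n then 0 else a s - b s"
  have c: "cg (M n) (comb a ?K) (comb b ?K)"
  proof -
    have "cg (M n) g (comb b L)"
      by (rule cgN_antimono[OF b(2)]) (use n lv strict_mono_less_eq in auto)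
    then have "cg (M n) (comb a K) (comb b L)" using cgN_trans[OF cgN_sym[OF a(2)]] by blast
    then show ?thesis by (simp only: comb_extend[OF a(1) max.cobounded1] comb_extend[OF b(1) max.cobounded2])
  qed
  have "comb (\<lambda>s. a s - b s) ?K = comb a ?K \<otimes> inv (comb b ?K)"
    by (rule lin_diff) (rule z_closed)
  then have 1: "comb (\<lambda>s. a s - b s) ?K \<in> M n" using cg_diff[OF c] by simp
  have 2: "comb ?e ?K \<in> M n"
  proof (rule lin_mem[OF N_subgroup])
    fix k
    show "z k [^] ?e (list_decode k) \<in> M n"
    proof (cases "length (list_decode k) \<le> n")
      case True
      then show ?thesis using subgroup.one_closed[OF N_subgroup] by simp
    next
      case False
      then have "lv n < lv (length (list_decode k))" using lv by (simp add: strict_mono_less)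
      then have "z k \<in> M n" using z[of k] N_antimono[of "Suc (lv n)" "lv (length (list_decode k))"] by auto
      then show ?thesis by (rule subgroup_int_pow_closed[OF N_subgroup])
    qed
  qed
  have "comb ?d ?K = comb (\<lambda>s. (a s - b s) - ?e s) ?K" by (rule lin_cong) auto
  also have "\<dots> = comb (\<lambda>s. a s - b s) ?K \<otimes> inv (comb ?e ?K)"
    by (rule lin_diff) (rule z_closed)
  also have "\<dots> \<in> M n" using 1 2 by (simp add: subgroup.m_closed[OF N_subgroup] subgroup.m_inv_closed[OF N_subgroup])
  finally have mem: "comb ?d ?K \<in> M n" .
  have "supp_le (\<lambda>k. lv (length (list_decode k))) ?K (lv n) (\<lambda>k. ?d (list_decode k))"
    using lv by (auto simp: supp_le_def strict_mono_less)
  then have d: "\<forall>k<?K. int p dvd ?d (list_decode k)"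
    using ind[of ?K] mem unfolding indep_def by blast
  show ?thesis
  proof (cases "list_encode s < ?K")
    case True
    then show ?thesis using d[rule_format, of "list_encode s"] s by simp
  next
    case False
    then have "a s = 0" "b s = 0" using a(1) b(1) unfolding admissible_def by (metis less_max_iff_disj)+
    then show ?thesis by simp
  qed
qed

text \<open>The coefficients modulo \<open>p\<close> do not depend on the truncation by
  \<open>comb_unique\<close>. Conservation then gives every node with nonzero coefficient a child
  with nonzero coefficient, and such nodes lie in \<open>T\<close>. The root has coefficient 1, so a
  branch arises.\<close>

lemma ill_founded_of_combs:
  assumes g: "\<And>n. g \<in> combs T 1 n"
  shows "ill_founded T"
proof -
  have "\<forall>n. \<exists>a K. admissible p T 1 n a K \<and> cg (M n) g (comb a K)"
    using g unfolding combs_def by blast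
  then obtain a K where a: "\<And>n. admissible p T 1 n (a n) (K n)" "\<And>n. cg (M n) g (comb (a n) (K n))"
    by metis
  \<comment> \<open>The truncation at \<open>length s\<close> is the first one to see
    \<open>s\<close>.\<close>
  define good where "good s \<longleftrightarrow> \<not> int p dvd a (length s) s" for s
  have uniq: "int p dvd a n s - a n' s" if "length s \<le> n" "n \<le> n'" for n n' s
    by (rule comb_unique[OF a a that(2,1)])
  have "\<not> int p dvd 1" using p by (simp add: prime_nat_iff zdvd1_eq)
  moreover have "int p dvd a 0 [] - 1" using a(1)[of 0] by (simp add: admissible_def)
  ultimately have good0: "good []" unfolding good_def by (metis dvd_diffD length_0_conv diff_diff_eq2 dvd_diff add_diff_cancel_left' diff_add_cancel)
  have good_Suc: "\<exists>i. good (s @ [i])" if "good s" for s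
  proof -
    let ?n = "length s"
    let ?b = "a (Suc ?n)"
    have "int p dvd a ?n s - ?b s" by (rule uniq) auto
    moreover have "int p dvd ?b s - sum ?b (children (K (Suc ?n)) s)"
      using a(1)[of "Suc ?n"] by (simp add: admissible_def)
    ultimately have "int p dvd (a ?n s - ?b s) + (?b s - sum ?b (children (K (Suc ?n)) s))"
      by (rule dvd_add)
    then have "\<not> int p dvd sum ?b (children (K (Suc ?n)) s)"
      using \<open>good s\<close> unfolding good_def by (metis add_diff_eq diff_add_cancel dvd_add dvd_diffD)
    then have "\<exists>t\<in>children (K (Suc ?n)) s. \<not> int p dvd ?b t"
      by (rule contrapos_np) (intro dvd_sum, blast)
    then obtain t where t: "t \<in> children (K (Suc ?n)) s" "\<not> int p dvd ?b t"
      by blast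
    then have ts: "t = s @ [last t]" by (auto simp: children_def)
    then have "length t = Suc ?n" by (metis length_append_singleton)
    then have "good t" using t(2) by (simp add: good_def)
    then show ?thesis using ts by metis
  qed
  have goodT: "s \<in> T" if "good s" for s
  proof -
    have "a (length s) s \<noteq> 0" using that unfolding good_def by auto
    then show ?thesis using a(1)[of "length s"] unfolding admissible_def by blast
  qed
  obtain next_i where next_i: "\<And>s. good s \<Longrightarrow> good (s @ [next_i s])" using good_Suc by metis
  define br where "br n = rec_nat [] (\<lambda>_ s. s @ [next_i s]) n" for n
  define f where "f n = next_i (br n)" for n
  have br: "br n = map f [0..<n]" for n
    by (induction n) (auto simp: br_def f_def)
  have "good (br n)" for n
    by (induction n) (use good0 next_i in \<open>auto simp: br_def\<close>)
  then show ?thesis unfolding ill_founded_def using goodT br by metis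
qed

text \<open>The elements attached to the initial segments of a branch are multiplied together; the
  product converges by completeness, and its truncations have coefficient 1 on the branch and 0
  elsewhere.\<close>

lemma combs_of_ill_founded:
  assumes complete: "\<And>y. (\<And>n. cg (N n) (y n) (y (Suc n))) \<Longrightarrow> \<exists>g. \<forall>n. cg (N n) g (y n)"
    and T: "ill_founded T"
  shows "\<exists>g. \<forall>n. g \<in> combs T 1 n"
proof -
  obtain f where f: "\<And>n. map f [0..<n] \<in> T" using T unfolding ill_founded_def by blast
  define br where "br n = map f [0..<n]" for n
  have len: "length (br n) = n" for n by (simp add: br_def)
  have br_inj: "br i = br j \<longleftrightarrow> i = j" for i j using len by metis
  have bl: "butlast (br (Suc i)) = br i" for i by (simp add: br_def)
  define y where "y n = rec_nat (z (list_encode (br 0))) (\<lambda>i x. x \<otimes> z (list_encode (br (Suc i)))) n" for n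
  have y0: "y 0 = z (list_encode (br 0))" and ySuc: "y (Suc n) = y n \<otimes> z (list_encode (br (Suc n)))" for n
    by (simp_all add: y_def)
  have yc: "y n \<in> carrier G" for n by (induction n) (simp_all add: y0 ySuc z_closed)
  have step: "cg (N (lv (Suc n))) (y n) (y (Suc n))" for n
    unfolding ySuc
    by (rule cgN_sym[OF cg_mult_right[OF N_subgroup yc]]) (use z[of "list_encode (br (Suc n))"] len in simp)
  have steps: "cg (M n) (y n) (y (n + d))" for n d
  proof (induction d)
    case (Suc d)
    have "Suc (lv n) \<le> lv (Suc (n + d))" using lv by (simp add: strict_mono_less Suc_leI)
    then have "cg (M n) (y (n + d)) (y (Suc (n + d)))" by (rule cgN_antimono[OF step])
    then show ?case using cgN_trans[OF Suc] by simp
  qed (simp add: cgN_refl yc)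
  have lv_ge: "n \<le> lv n" for n using lv by (rule strict_mono_imp_increasing)
  have "cg (N n) (y n) (y (Suc n))" for n
    by (rule cgN_antimono[OF step]) (use lv_ge[of "Suc n"] in simp)
  then obtain g where g: "\<And>n. cg (N n) g (y n)" using complete[of y] by blast
  \<comment> \<open>Completeness controls \<open>g\<close> modulo \<open>N n\<close> by
    \<open>y n\<close> only. Congruence modulo the smaller \<open>M n\<close> is obtained from the
    later term with index \<open>Suc (lv n)\<close>, which differs from \<open>y n\<close> by an
    element of \<open>M n\<close>.\<close>
  have gy: "cg (M n) g (y n)" for n
  proof -
    have "cg (M n) g (y (Suc (lv n)))" by (rule g)
    moreover have "cg (M n) (y n) (y (Suc (lv n)))"
      using steps[of n "Suc (lv n) - n"] lv_ge[of n] by simp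
    ultimately show ?thesis using cgN_trans cgN_sym by blast
  qed
  define a where "a n s = (if \<exists>i\<le>n. s = br i then 1 else 0 :: int)" for n s
  have comb_y: "comb (a n) K = y n" if "\<forall>i\<le>n. list_encode (br i) < K" for n K
    using that
  proof (induction n)
    case 0
    have "comb (a 0) K = lin z (\<lambda>k. if k = list_encode (br 0) then 1 else 0) K"
      by (rule lin_cong) (simp add: a_def list_decode_eq_iff)
    also have "\<dots> = z (list_encode (br 0)) [^] (1::int)"
      by (rule lin_single) (use 0 z_closed in auto)
    finally show ?case by (simp add: y0 z_closed)
  next
    case (Suc n)
    have "comb (a (Suc n)) K =
        lin z (\<lambda>k. a n (list_decode k) + (if k = list_encode (br (Suc n)) then 1 else 0)) K"
      by (rule lin_cong) (auto simp: a_def le_Suc_eq br_inj list_decode_eq_iff list_encode_eq)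
    also have "\<dots> = comb (a n) K \<otimes> lin z (\<lambda>k. if k = list_encode (br (Suc n)) then 1 else 0) K"
      by (rule lin_add) (rule z_closed)
    also have "lin z (\<lambda>k. if k = list_encode (br (Suc n)) then 1 else 0) K =
        z (list_encode (br (Suc n))) [^] (1::int)"
      by (rule lin_single) (use Suc.prems z_closed in auto)
    finally show ?case using Suc by (simp add: ySuc z_closed)
  qed
  have "y n \<in> combs T 1 n" for n
  proof -
    define K where "K = Suc (\<Sum>i\<le>n. list_encode (br i))"
    have K: "\<forall>i\<le>n. list_encode (br i) < K"
      unfolding K_def by (auto intro!: le_imp_less_Suc member_le_sum)
    have "int p dvd a n s - sum (a n) (children K s)" if s: "length s < n" for s
    proof -
      \<comment> \<open>If \<open>s\<close> is on the branch, the next initial segment is its only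
        child with nonzero coefficient; if \<open>s\<close> is off the branch, so are all its
        children.\<close>
      have "sum (a n) (children K s) = (\<Sum>t\<in>children K s. if t = br (Suc (length s)) then a n s else 0)"
      proof (rule sum.cong)
        fix t assume "t \<in> children K s"
        then have t: "t \<noteq> []" "butlast t = s" by (auto simp: children_def)
        show "a n t = (if t = br (Suc (length s)) then a n s else 0)"
        proof (cases "\<exists>i\<le>n. t = br i")
          case True
          then obtain i where i: "i \<le> n" "t = br i" by blast
          then obtain j where j: "i = Suc j" using t by (cases i) (auto simp: br_def)
          then have "s = br j" using t i bl by simp
          then show ?thesis using i j len[of j] by (auto simp: a_def br_inj)
        next
          case False
          then have "t \<noteq> br (Suc (length s))" using s by auto
          then show ?thesis using False by (simp add: a_def)
        qed
      qed simp
      also have "\<dots> = (if br (Suc (length s)) \<in> children K s then a n s else 0)"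
        by (simp add: finite_children)
      also have "\<dots> = a n s"
      proof (cases "\<exists>i\<le>n. s = br i")
        case True
        then have "s = br (length s)" using len by metis
        then have "butlast (br (Suc (length s))) = s" by (simp add: bl)
        moreover have "list_encode (br (Suc (length s))) < K" using K s by simp
        moreover have "br (Suc (length s)) \<noteq> []" by (simp add: br_def)
        ultimately have "br (Suc (length s)) \<in> children K s" by (simp add: children_def)
        then show ?thesis by simp
      next
        case False
        then have "a n s = 0" by (simp add: a_def)
        then show ?thesis by simp
      qed
      finally show ?thesis by simp
    qed
    moreover have "a n [] = 1" by (auto simp: a_def br_def)
    ultimately have "admissible p T 1 n (a n) K"
      using K f by (auto simp: admissible_def a_def br_def split: if_splits)
    moreover have "cg (M n) (y n) (comb (a n) K)" using comb_y[OF K] yc cgN_refl by simp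
    ultimately show ?thesis unfolding combs_def by blast
  qed
  then show ?thesis using combs_saturated[OF gy] by blast
qed

section \<open>The action on the disjoint union of the quotients by the subgroups
  \<open>M n\<close>\<close>

definition coset_index :: "(nat \<times> 'a set) set" where
  "coset_index = {(n, M n #> x) |n x. x \<in> carrier G}"

text \<open>Translation from the right is a left action because the group is abelian.\<close>

definition coset_action :: "'a \<Rightarrow> nat \<times> 'a set \<Rightarrow> nat \<times> 'a set" where
  "coset_action g = restrict (\<lambda>(n, C). (n, C #> g)) coset_index"

lemma M_rcos_eq: "x \<in> carrier G \<Longrightarrow> y \<in> carrier G \<Longrightarrow> M n #> x = M n #> y \<longleftrightarrow> cg (M n) x y"
  by (rule rcos_eq_iff_cg[OF N_subgroup])

lemma coset_action_apply:
  "x \<in> carrier G \<Longrightarrow> g \<in> carrier G \<Longrightarrow> coset_action g (n, M n #> x) = (n, M n #> (x \<otimes> g))"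
  using coset_mult_assoc[OF subgroup.subset[OF N_subgroup]]
  by (auto simp: coset_action_def coset_index_def)

lemma coset_action_group_action: "group_action G coset_index coset_action"
proof -
  have maps: "coset_action g C \<in> coset_index" if "C \<in> coset_index" "g \<in> carrier G" for g C
    using that by (auto simp: coset_index_def coset_action_apply) (metis m_closed)
  have cancel: "coset_action h (coset_action g C) = C"
    if "C \<in> coset_index" "g \<in> carrier G" "h \<in> carrier G" "g \<otimes> h = \<one>" for g h C
    using that by (auto simp: coset_index_def coset_action_apply m_assoc)
  have bij: "coset_action g \<in> Bij coset_index" if g: "g \<in> carrier G" for g
  proof -
    have "bij_betw (coset_action g) coset_index coset_index"
      by (rule bij_betwI[where g = "coset_action (inv g)"]) (use g maps cancel in auto)
    then show ?thesis by (simp add: Bij_def coset_action_def)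
  qed
  have "coset_action (g \<otimes> h) = compose coset_index (coset_action g) (coset_action h)"
    if "g \<in> carrier G" "h \<in> carrier G" for g h
  proof (rule extensionalityI)
    show "coset_action (g \<otimes> h) \<in> extensional coset_index" by (simp add: coset_action_def)
    fix C assume "C \<in> coset_index"
    then show "coset_action (g \<otimes> h) C = compose coset_index (coset_action g) (coset_action h) C"
      using that by (auto simp: coset_index_def compose_def coset_action_apply m_ac)
  qed simp
  then have "coset_action \<in> hom G (BijGroup coset_index)"
    using bij by (auto simp: hom_def BijGroup_def)
  then show ?thesis
    unfolding group_action_def group_hom_def group_hom_axioms_def
    by (simp add: group_BijGroup is_group)
qed

definition comb_cosets :: "int \<Rightarrow> nat list set \<Rightarrow> (nat \<times> 'a set) set" where
  "comb_cosets \<epsilon> T = {(n, M n #> x) |n x. x \<in> combs T \<epsilon> n}"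

lemma comb_cosets_subset: "comb_cosets \<epsilon> T \<subseteq> coset_index"
  unfolding comb_cosets_def coset_index_def using combs_closed by blast

lemma mem_comb_cosets:
  assumes "x \<in> carrier G"
  shows "(n, M n #> x) \<in> comb_cosets \<epsilon> T \<longleftrightarrow> x \<in> combs T \<epsilon> n"
proof
  assume "(n, M n #> x) \<in> comb_cosets \<epsilon> T"
  then obtain y where y: "y \<in> combs T \<epsilon> n" "M n #> x = M n #> y" unfolding comb_cosets_def by blast
  then show "x \<in> combs T \<epsilon> n"
    using M_rcos_eq[OF assms combs_closed[OF y(1)]] combs_saturated by blast
qed (auto simp: comb_cosets_def)

text \<open>A translation that carries the trivial coset into the second family must lie in
  \<open>combs T 1 n\<close> for all \<open>n\<close>. Conversely, translating the strength 0
  combinations by such an element gives exactly those of strength 1, because strengths add.\<close>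

lemma coset_action_comb_cosets:
  assumes g: "g \<in> carrier G"
  shows "coset_action g ` comb_cosets 0 T = comb_cosets 1 T \<longleftrightarrow> (\<forall>n. g \<in> combs T 1 n)"
proof
  assume eq: "coset_action g ` comb_cosets 0 T = comb_cosets 1 T"
  show "\<forall>n. g \<in> combs T 1 n"
  proof
    fix n
    have "(n, M n #> \<one>) \<in> comb_cosets 0 T" by (simp add: mem_comb_cosets one_combs)
    then have "coset_action g (n, M n #> \<one>) \<in> comb_cosets 1 T" using eq by blast
    then show "g \<in> combs T 1 n" using g by (simp add: coset_action_apply mem_comb_cosets)
  qed
next
  assume gc: "\<forall>n. g \<in> combs T 1 n"
  show "coset_action g ` comb_cosets 0 T = comb_cosets 1 T"
  proof (intro equalityI subsetI)
    fix C assume "C \<in> coset_action g ` comb_cosets 0 T"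
    then obtain n x where x: "x \<in> combs T 0 n" "C = coset_action g (n, M n #> x)"
      unfolding comb_cosets_def by blast
    then have "C = (n, M n #> (x \<otimes> g))" using g by (simp add: coset_action_apply combs_closed)
    moreover have "x \<otimes> g \<in> combs T 1 n" using combs_mult[OF x(1)] gc by fastforce
    ultimately show "C \<in> comb_cosets 1 T" unfolding comb_cosets_def by blast
  next
    fix C assume "C \<in> comb_cosets 1 T"
    then obtain n x where x: "x \<in> combs T 1 n" "C = (n, M n #> x)" unfolding comb_cosets_def by blast
    have xc: "x \<in> carrier G" using x(1) by (rule combs_closed)
    have "inv g \<in> combs T (- 1) n" using gc by (intro combs_inv) simp
    from combs_mult[OF x(1) this] have m: "x \<otimes> inv g \<in> combs T 0 n" by simp
    have "coset_action g (n, M n #> (x \<otimes> inv g)) = C"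
      using x(2) xc g by (simp add: coset_action_apply m_assoc)
    moreover have "(n, M n #> (x \<otimes> inv g)) \<in> comb_cosets 0 T" using m unfolding comb_cosets_def by blast
    ultimately show "C \<in> coset_action g ` comb_cosets 0 T" by (metis imageI)
  qed
qed

text \<open>A fixed coset belongs to the family if and only if \<open>T\<close> contains the support
  of one of the coefficient functions representing it. Supports are finite sets of nodes, so there
  are countably many.\<close>

lemma comb_cosets_measurable:
  assumes "C \<in> coset_index"
  shows "{T \<in> space (member_algebra UNIV). C \<in> comb_cosets \<epsilon> T} \<in> sets (member_algebra UNIV)"
proof -
  let ?A = "member_algebra (UNIV :: nat list set)"
  have sp: "space ?A = UNIV" by (simp add: member_algebra_def space_measure_of_conv)
  obtain n x where x: "x \<in> carrier G" "C = (n, M n #> x)" using assms unfolding coset_index_def by blast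
  define \<S> where "\<S> = {{s. a s \<noteq> 0} |a K. admissible p UNIV \<epsilon> n a K \<and> cg (M n) x (comb a K)}"
  have fin: "finite S" if S: "S \<in> \<S>" for S
  proof -
    obtain a K where a: "S = {s. a s \<noteq> 0}" "admissible p UNIV \<epsilon> n a K" using S unfolding \<S>_def by blast
    then have "S \<subseteq> {s. list_encode s < K}" by (auto simp: admissible_def)
    then show ?thesis by (rule finite_subset) (rule finite_list_encode_less)
  qed
  have "\<S> \<subseteq> {S. finite S}" using fin by blast
  then have cS: "countable \<S>" by (rule countable_subset) (rule countable_Collect_finite)
  have meas: "{T. S \<subseteq> T} \<in> sets ?A" if "S \<in> \<S>" for S
  proof -
    have "{T. S \<subseteq> T} = space ?A \<inter> (\<Inter>s\<in>S. {T. s \<in> T})" by (auto simp: sp)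
    also have "\<dots> \<in> sets ?A"
    proof (cases "S = {}")
      case False
      have "{T. s \<in> T} \<in> sets ?A" for s
        using basic_set_measurable[of "2 * to_nat s + 2"] by (simp add: basic_set_def)
      then have "(\<Inter>s\<in>S. {T. s \<in> T}) \<in> sets ?A" by (intro sets.finite_INT[OF fin[OF that] False])
      then show ?thesis by (rule sets.Int[OF sets.top])
    next
      case True
      then show ?thesis using sets.top[of ?A] by simp
    qed
    finally show ?thesis .
  qed
  have "C \<in> comb_cosets \<epsilon> T \<longleftrightarrow> (\<exists>S\<in>\<S>. S \<subseteq> T)" for T
  proof -
    have "admissible p T \<epsilon> n a K \<longleftrightarrow> admissible p UNIV \<epsilon> n a K \<and> {s. a s \<noteq> 0} \<subseteq> T" for a K
      unfolding admissible_def by blast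
    then have "x \<in> combs T \<epsilon> n \<longleftrightarrow> (\<exists>S\<in>\<S>. S \<subseteq> T)"
      unfolding combs_def \<S>_def by blast
    then show ?thesis using mem_comb_cosets[OF x(1)] x(2) by simp
  qed
  then have "{T \<in> space ?A. C \<in> comb_cosets \<epsilon> T} = (\<Union>S\<in>\<S>. {T. S \<subseteq> T})" by (auto simp: sp)
  also have "\<dots> \<in> sets ?A" by (rule sets.countable_UN'[OF cS]) (use meas in auto)
  finally show ?thesis .
qed

text \<open>The elements moving one given coset to another form a coset of some \<open>M n\<close>
  or the empty set, in either case an open set. So tameness would make the set of \<open>T\<close>
  whose two families lie in one orbit measurable, and this is the set of ill-founded
  \<open>T\<close>.\<close>

theorem not_tame:
  assumes Top: "topspace Top = carrier G"
    and op: "\<And>j x. x \<in> carrier G \<Longrightarrow> openin Top (N j #> x)"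
    and ctb: "\<And>j. countable {N j #> x |x. x \<in> carrier G}"
    and complete: "\<And>y. (\<And>n. cg (N n) (y n) (y (Suc n))) \<Longrightarrow> \<exists>g. \<forall>n. cg (N n) g (y n)"
  shows "\<not> tame G Top"
proof
  assume tame: "tame G Top"
  have ci: "countable coset_index"
  proof -
    have "coset_index = (\<Union>n. Pair n ` {M n #> x |x. x \<in> carrier G})" by (auto simp: coset_index_def)
    then show ?thesis using ctb by auto
  qed
  have opn: "openin Top {g \<in> carrier G. coset_action g i = j}" if ij: "i \<in> coset_index" "j \<in> coset_index" for i j
  proof -
    obtain n x m y where xy: "x \<in> carrier G" "i = (n, M n #> x)" "y \<in> carrier G" "j = (m, M m #> y)"
      using ij unfolding coset_index_def by blast
    show ?thesis
    proof (cases "n = m")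
      case False
      then have empty: "{g \<in> carrier G. coset_action g i = j} = {}" using xy by (auto simp: coset_action_apply)
      show ?thesis unfolding empty by simp
    next
      case True
      have "{g \<in> carrier G. coset_action g i = j} = M n #> (inv x \<otimes> y)"
      proof (intro equalityI subsetI)
        fix g assume "g \<in> {g \<in> carrier G. coset_action g i = j}"
        then have g: "g \<in> carrier G" "cg (M n) (x \<otimes> g) y"
          using xy True by (auto simp: coset_action_apply M_rcos_eq)
        have "cg (M n) (inv x \<otimes> (x \<otimes> g)) (inv x \<otimes> y)"
          using cgN_mult[OF cgN_refl g(2)] xy by simp
        then have "M n #> g = M n #> (inv x \<otimes> y)" using g xy by (simp add: M_rcos_eq inv_cancel)
        then show "g \<in> M n #> (inv x \<otimes> y)" using rcos_self[OF g(1) N_subgroup[of "Suc (lv n)"]] by simp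
      next
        fix g assume g': "g \<in> M n #> (inv x \<otimes> y)"
        have xyc: "inv x \<otimes> y \<in> carrier G" using xy by simp
        have g: "g \<in> carrier G" using r_coset_subset_G[OF subgroup.subset[OF N_subgroup] xyc] g' by blast
        have "M n #> g = M n #> (inv x \<otimes> y)" using repr_independence[OF g' xyc N_subgroup] by simp
        then have "cg (M n) g (inv x \<otimes> y)" using M_rcos_eq[OF g xyc] by simp
        then have "cg (M n) (x \<otimes> g) (x \<otimes> (inv x \<otimes> y))" using cgN_mult[OF cgN_refl] xy by blast
        then show "g \<in> {g \<in> carrier G. coset_action g i = j}"
          using g xy True by (simp add: coset_action_apply M_rcos_eq inv_cancel)
      qed
      then show ?thesis using op[of "inv x \<otimes> y"] xy by simp
    qed
  qed
  have "{T \<in> space (member_algebra UNIV). \<exists>g\<in>carrier G. coset_action g ` comb_cosets 0 T = comb_cosets 1 T}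
      \<in> sets (member_algebra UNIV)"
    by (rule tame_transporter_measurable[OF tame coset_action_group_action ci Top opn])
      (auto intro: comb_cosets_measurable subsetD[OF comb_cosets_subset])
  moreover have "(\<exists>g\<in>carrier G. coset_action g ` comb_cosets 0 T = comb_cosets 1 T) \<longleftrightarrow> ill_founded T" for T
  proof -
    have "(\<exists>g\<in>carrier G. coset_action g ` comb_cosets 0 T = comb_cosets 1 T) \<longleftrightarrow> (\<exists>g. \<forall>n. g \<in> combs T 1 n)"
      using coset_action_comb_cosets combs_closed by meson
    also have "\<dots> \<longleftrightarrow> ill_founded T"
      using ill_founded_of_combs combs_of_ill_founded[OF complete] by blast
    finally show ?thesis .
  qed
  ultimately have "{T. ill_founded T} \<in> sets (member_algebra (UNIV :: nat list set))"
    by (simp add: member_algebra_def space_measure_of_conv)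
  then show False using ill_founded_not_measurable by blast
qed

end

text \<open>If the socle is infinite at infinitely many levels, these are enumerated by
  \<open>lv\<close>, and a sequence of length \<open>n\<close> gets an element at the
  \<open>n\<close>-th of them.\<close>

theorem (in torsion_filtered_group) tame_eventually_fin_socle:
  assumes tame: "tame G Top" and Top: "topspace Top = carrier G"
    and op: "\<And>j x. x \<in> carrier G \<Longrightarrow> openin Top (N j #> x)"
    and ctb: "\<And>j. countable {N j #> x |x. x \<in> carrier G}"
    and complete: "\<And>y. (\<And>n. cg (N n) (y n) (y (Suc n))) \<Longrightarrow> \<exists>g. \<forall>n. cg (N n) g (y n)"
    and p: "prime p"
  shows "eventually_fin_socle p"
proof (rule ccontr)
  assume "\<not> eventually_fin_socle p"
  then have "\<exists>j\<ge>m. \<not> fin_socle p (N j) (N (Suc j))" for m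
    unfolding eventually_fin_socle_def by blast
  then have inf: "infinite {j. \<not> fin_socle p (N j) (N (Suc j))}"
    by (auto simp: infinite_nat_iff_unbounded_le)
  define lv where "lv = enumerate {j. \<not> fin_socle p (N j) (N (Suc j))}"
  have bad: "\<not> fin_socle p (N (lv n)) (N (Suc (lv n)))" for n
    using enumerate_in_set[OF inf, of n] by (simp add: lv_def)
  have lv: "strict_mono lv" unfolding lv_def by (rule strict_mono_enumerate[OF inf])
  obtain z where z: "\<And>k. z k \<in> N (lv (length (list_decode k)))"
    "\<And>K. indep p z (\<lambda>k. lv (length (list_decode k))) K"
    using ex_independent_sequence[OF p, of "\<lambda>k. lv (length (list_decode k))"] bad by blast
  interpret independent_family G N p lv z
    by unfold_locales (use p lv z in auto)
  show False using not_tame[OF Top op ctb complete] tame by blast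
qed

section \<open>Group trees in closed subgroups of a product\<close>

context filtered_group
begin

text \<open>A nonempty set closed under \<open>x \<otimes> inv y \<otimes> w\<close> is a coset of
  the subgroup of its differences. A coset tree may use unrelated subgroups at different levels; the
  subgroups of differences decrease because the sets do.\<close>

lemma ex_group_seq_of_heap:
  assumes C: "\<And>m. C m \<subseteq> carrier G" "\<And>m. C m \<noteq> {}" "\<And>m. C (Suc m) \<subseteq> C m"
    and heap: "\<And>m x y w. x \<in> C m \<Longrightarrow> y \<in> C m \<Longrightarrow> w \<in> C m \<Longrightarrow> x \<otimes> inv y \<otimes> w \<in> C m"
    and sat: "\<And>m x y. x \<in> C m \<Longrightarrow> cg (N m) x y \<Longrightarrow> y \<in> C m"
  shows "\<exists>A. group_seq A \<and> coset_seq A C"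
proof -
  define A where "A m = {x \<otimes> inv y |x y. x \<in> C m \<and> y \<in> C m}" for m
  note Cc = subsetD[OF C(1)]
  have iff: "y \<in> C m \<longleftrightarrow> cg (A m) x y" if x: "x \<in> C m" and y: "y \<in> carrier G" for x y m
  proof
    assume "y \<in> C m"
    then show "cg (A m) x y" using x Cc by (auto simp: cg_def A_def)
  next
    assume "cg (A m) x y"
    then obtain u v where uv: "u \<in> C m" "v \<in> C m" "x \<otimes> inv y = u \<otimes> inv v"
      unfolding cg_def A_def by blast
    have c: "x \<in> carrier G" "u \<in> carrier G" "v \<in> carrier G" using x uv Cc by auto
    have "inv (x \<otimes> inv y) = y \<otimes> inv x" using c y by (simp add: inv_mult m_comm)
    then have "y = inv (x \<otimes> inv y) \<otimes> x" using c y by (simp add: m_assoc)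
    also have "\<dots> = v \<otimes> inv u \<otimes> x" unfolding uv(3) using c by (simp add: inv_mult m_comm)
    finally show "y \<in> C m" using heap[OF uv(2,1) x] by simp
  qed
  have "group_seq A"
    unfolding group_seq_def
  proof (intro allI conjI)
    fix m
    obtain c where c: "c \<in> C m" using C(2) by blast
    show "A (Suc m) \<subseteq> A m" using C(3)[of m] by (auto simp: A_def)
    show "N m \<subseteq> A m"
    proof
      fix x assume x: "x \<in> N m"
      have cc: "c \<in> carrier G" "x \<in> carrier G" using c Cc x subgroup.mem_carrier[OF N_subgroup] by auto
      have "c \<otimes> x \<in> C m"
        using sat[OF c cgN_sym[OF cg_mult_right[OF N_subgroup cc(1) x]]] .
      moreover have "x = c \<otimes> x \<otimes> inv c" using cc by (simp add: m_comm[of c x] m_assoc)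
      ultimately show "x \<in> A m" using c unfolding A_def by blast
    qed
    show "subgroup (A m) G"
    proof (rule subgroupI)
      show "A m \<subseteq> carrier G" using Cc by (auto simp: A_def)
      show "A m \<noteq> {}" using c by (auto simp: A_def)
      fix a assume "a \<in> A m"
      then obtain x y where xy: "x \<in> C m" "y \<in> C m" "a = x \<otimes> inv y" unfolding A_def by blast
      have xyc: "x \<in> carrier G" "y \<in> carrier G" using xy Cc by auto
      have "inv a = y \<otimes> inv x" using xyc xy(3) by (simp add: inv_mult m_comm)
      then show "inv a \<in> A m" using xy unfolding A_def by blast
      fix b assume "b \<in> A m"
      then obtain u v where uv: "u \<in> C m" "v \<in> C m" "b = u \<otimes> inv v" unfolding A_def by blast
      have uvc: "u \<in> carrier G" "v \<in> carrier G" using uv Cc by auto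
      have "a \<otimes> b = (x \<otimes> inv y \<otimes> u) \<otimes> inv v" using xyc uvc xy(3) uv(3) by (simp add: m_assoc)
      then show "a \<otimes> b \<in> A m" using heap[OF xy(1,2) uv(1)] uv(2) unfolding A_def by blast
    qed
  qed
  moreover have "coset_seq A C" using C iff by (simp add: coset_seq_def)
  ultimately show ?thesis by blast
qed

end

lemma map_mult_DirProd_list:
  assumes "\<And>i. i \<in> set is \<Longrightarrow> x i \<in> carrier (H i) \<and> y i \<in> carrier (H i)"
  shows "map x is \<otimes>\<^bsub>DirProd_list (map H is)\<^esub> map y is = map (\<lambda>i. x i \<otimes>\<^bsub>H i\<^esub> y i) is"
  using assms
proof (induction "is")
  case Nil
  then show ?case by (simp add: DirProd_list_def)
next
  case (Cons i "is")
  let ?D = "DirProd_list (map H is)"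
  have mem: "map x is \<in> carrier ?D" "map y is \<in> carrier ?D"
    using Cons.prems by (auto intro!: DirProd_list_carrier_memI)
  have "(\<lambda>(g, gs). g # gs) \<in> hom (H i \<times>\<times> ?D) (DirProd_list (H i # map H is))"
    using DirProd_list_iso[of "H i" "map H is"] by (simp add: iso_def)
  from hom_mult[OF this, of "(x i, map x is)" "(y i, map y is)"]
  show ?case using Cons mem by (simp add: DirProd_def)
qed

lemma map_mult_fin_prod:
  assumes "x \<in> (\<Pi>\<^sub>E i\<in>UNIV. carrier (H i))" "y \<in> (\<Pi>\<^sub>E i\<in>UNIV. carrier (H i))"
  shows "map x [0..<m] \<otimes>\<^bsub>fin_prod H m\<^esub> map y [0..<m] = map (\<lambda>i. x i \<otimes>\<^bsub>H i\<^esub> y i) [0..<m]"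
  unfolding fin_prod_def using assms by (intro map_mult_DirProd_list) auto

section \<open>The filtration of a closed subgroup of the product by its level subgroups\<close>

locale closed_filtered_subgroup =
  fixes H :: "nat \<Rightarrow> 'a monoid" and G :: "(nat \<Rightarrow> 'a) set"
  assumes H_comm: "comm_group (H n)"
    and H_countable: "countable (carrier (H n))"
    and G_subgroup: "subgroup G (product_group UNIV H)"
    and G_closed: "closedin (prod_discrete H) G"
    and G_torsion: "n \<ge> 1 \<Longrightarrow> torsion_group (subgroup_of_prod H (level H G n) Mod level H G (n + 1))"
begin

lemma H_group: "group (H n)"
  using H_comm comm_group.axioms(2) by blast

lemma P_group: "group (product_group UNIV H)"
  using H_group by simp

lemma G_PiE: "x \<in> G \<Longrightarrow> x \<in> (\<Pi>\<^sub>E i\<in>UNIV. carrier (H i))"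
  using subgroup.mem_carrier[OF G_subgroup] by simp

lemma G_carrier: "x \<in> G \<Longrightarrow> x i \<in> carrier (H i)"
  using PiE_mem[OF G_PiE] by simp

definition GG :: "(nat \<Rightarrow> 'a) monoid" where
  "GG = subgroup_of_prod H G"

lemma carrier_GG [simp]: "carrier GG = G"
  by (simp add: GG_def)

lemma mult_GG: "x \<otimes>\<^bsub>GG\<^esub> y = (\<lambda>i. x i \<otimes>\<^bsub>H i\<^esub> y i)"
  by (simp add: GG_def restrict_def)

lemma one_GG: "\<one>\<^bsub>GG\<^esub> = (\<lambda>i. \<one>\<^bsub>H i\<^esub>)"
  by (simp add: GG_def restrict_def)

lemma GG_comm: "comm_group GG"
proof (rule group.group_comm_groupI)
  show "group GG"
    unfolding GG_def by (rule subgroup.subgroup_is_group[OF G_subgroup P_group])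
  show "x \<otimes>\<^bsub>GG\<^esub> y = y \<otimes>\<^bsub>GG\<^esub> x" if "x \<in> carrier GG" "y \<in> carrier GG" for x y
    using that G_carrier comm_groupE(4)[OF H_comm] by (auto simp: fun_eq_iff mult_GG)
qed

lemma inv_GG: "x \<in> G \<Longrightarrow> inv\<^bsub>GG\<^esub> x = (\<lambda>i. inv\<^bsub>H i\<^esub> x i)"
  unfolding GG_def
  using group.m_inv_consistent[OF P_group G_subgroup, of x]
    inv_product_group[of x UNIV H, OF G_PiE[unfolded carrier_product_group]] H_group
  by (simp add: restrict_def)

lemma level_subgroup: "subgroup (level H G m) GG"
proof -
  interpret comm_group GG by (rule GG_comm)
  have H_one: "\<one>\<^bsub>H k\<^esub> \<otimes>\<^bsub>H k\<^esub> \<one>\<^bsub>H k\<^esub> = \<one>\<^bsub>H k\<^esub>" "inv\<^bsub>H k\<^esub> \<one>\<^bsub>H k\<^esub> = \<one>\<^bsub>H k\<^esub>" for k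
    using group.is_monoid[OF H_group[of k]] by (simp_all add: monoid.inv_one monoid.l_one monoid.one_closed)
  show ?thesis
  proof (rule subgroupI)
    show "level H G m \<subseteq> carrier GG" by (auto simp: level_def)
    have "\<one>\<^bsub>GG\<^esub> \<in> level H G m"
      using one_closed by (simp add: level_def one_GG)
    then show "level H G m \<noteq> {}" by blast
    show "inv\<^bsub>GG\<^esub> x \<in> level H G m" if x: "x \<in> level H G m" for x
      using x inv_closed[of x] by (auto simp: level_def inv_GG H_one)
    show "x \<otimes>\<^bsub>GG\<^esub> y \<in> level H G m" if "x \<in> level H G m" "y \<in> level H G m" for x y
      using that m_closed[of x y] by (auto simp: level_def mult_GG H_one)
  qed
qed

lemma level_torsion:
  assumes n: "n \<ge> 1" and x: "x \<in> level H G n"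
  shows "\<exists>k::nat. k > 0 \<and> x [^]\<^bsub>GG\<^esub> k \<in> level H G (n + 1)"
proof -
  define L L' where "L = level H G n" and "L' = level H G (n + 1)"
  define K where "K = GG\<lparr>carrier := L\<rparr>"
  interpret GG: comm_group GG by (rule GG_comm)
  have L: "subgroup L GG" "subgroup L' GG" unfolding L_def L'_def by (rule level_subgroup)+
  have KG: "group K" unfolding K_def by (rule GG.subgroup_imp_group[OF L(1)])
  have "comm_group K"
    by (rule group.group_comm_groupI[OF KG])
      (use GG.m_comm subgroup.mem_carrier[OF L(1)] in \<open>auto simp: K_def\<close>)
  then interpret K: comm_group K .
  have "L' \<subseteq> L" by (auto simp: L_def L'_def level_def)
  then have L': "subgroup L' K"
    unfolding K_def by (rule GG.subgroup_incl[OF L(2,1)])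
  have norm: "normal L' K" by (rule K.subgroup_imp_normal[OF L'])
  have xK: "x \<in> carrier K" using x by (simp add: K_def L_def)
  have tors: "torsion_group (K Mod L')"
    using G_torsion[OF n] by (simp add: K_def L_def L'_def GG_def)
  have "L' #>\<^bsub>K\<^esub> x \<in> carrier (K Mod L')"
    using xK by (auto simp: FactGroup_def RCOSETS_def)
  then obtain k :: nat where k: "k > 0" "(L' #>\<^bsub>K\<^esub> x) [^]\<^bsub>K Mod L'\<^esub> k = \<one>\<^bsub>K Mod L'\<^esub>"
    using tors unfolding torsion_group_def by blast
  interpret h: group_hom K "K Mod L'" "\<lambda>a. L' #>\<^bsub>K\<^esub> a"
    unfolding group_hom_def group_hom_axioms_def
    using KG normal.factorgroup_is_group[OF norm] normal.r_coset_hom_Mod[OF norm] by blast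
  have "L' #>\<^bsub>K\<^esub> (x [^]\<^bsub>K\<^esub> k) = L'"
    using h.hom_nat_pow[OF xK, of k] k(2) by (simp add: FactGroup_def)
  then have "x [^]\<^bsub>K\<^esub> k \<in> L'"
    using K.rcos_self[OF K.nat_pow_closed[OF xK] L', of k] by simp
  moreover have "x [^]\<^bsub>K\<^esub> k = x [^]\<^bsub>GG\<^esub> k"
    unfolding K_def by (rule GG.nat_pow_consistent[symmetric])
  ultimately show ?thesis using k(1) by (auto simp: L'_def)
qed

text \<open>The shift makes \<open>N 0\<close> the level subgroup of index 1, from which on the
  quotients are torsion. Multiplying the exponents for successive quotients makes \<open>N 0\<close>
  torsion modulo every \<open>N j\<close>.\<close>

sublocale torsion_filtered_group "GG" "\<lambda>j. level H G (Suc j)"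
proof (intro torsion_filtered_group.intro filtered_group.intro filtered_group_axioms.intro
    torsion_filtered_group_axioms.intro)
  show "comm_group GG" by (rule GG_comm)
  show "subgroup (level H G (Suc j)) GG" for j by (rule level_subgroup)
  show "level H G (Suc (Suc j)) \<subseteq> level H G (Suc j)" for j by (auto simp: level_def)
  fix x j assume x: "x \<in> level H G (Suc 0)"
  interpret GG: comm_group "GG" by (rule GG_comm)
  show "\<exists>k::nat. k > 0 \<and> x [^]\<^bsub>GG\<^esub> k \<in> level H G (Suc j)"
  proof (induction j)
    case 0
    have "x \<in> G" using x by (simp add: level_def)
    moreover have "x [^]\<^bsub>GG\<^esub> Suc 0 = x" using calculation GG.l_one[of x] by simp
    ultimately show ?case using x by (intro exI[of _ "Suc 0"]) simp
  next
    case (Suc j)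
    then obtain k :: nat where k: "k > 0" "x [^]\<^bsub>GG\<^esub> k \<in> level H G (Suc j)" by blast
    obtain l :: nat where l: "l > 0"
      "(x [^]\<^bsub>GG\<^esub> k) [^]\<^bsub>GG\<^esub> l \<in> level H G (Suc j + 1)"
      using level_torsion[OF _ k(2)] by auto
    have "x \<in> G" using x by (simp add: level_def)
    then have "x [^]\<^bsub>GG\<^esub> (k * l) \<in> level H G (Suc (Suc j))"
      using l(2) GG.nat_pow_pow[of x k l] by simp
    then show ?case using k(1) l(1) by (intro exI[of _ "k * l"]) simp
  qed
qed

lemma cg_level:
  "cg (level H G m) x y \<longleftrightarrow> x \<in> G \<and> y \<in> G \<and> (\<forall>k<m. x k = y k)"
proof (cases "x \<in> G \<and> y \<in> G")
  case True
  have "x k \<otimes>\<^bsub>H k\<^esub> inv\<^bsub>H k\<^esub> y k = \<one>\<^bsub>H k\<^esub> \<longleftrightarrow> x k = y k" for k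
  proof -
    interpret group "H k" by (rule H_group)
    have "x k \<in> carrier (H k)" "y k \<in> carrier (H k)" using True G_carrier by auto
    then show ?thesis using right_cancel[of "inv\<^bsub>H k\<^esub> y k" "x k" "y k"] by simp
  qed
  moreover have "x \<otimes>\<^bsub>GG\<^esub> inv\<^bsub>GG\<^esub> y \<in> G"
    using True m_closed[of x "inv\<^bsub>GG\<^esub> y"] inv_closed[of y] by simp
  ultimately show ?thesis
    using True unfolding cg_def by (simp add: level_def inv_GG mult_GG)
qed (auto simp: cg_def)

lemma topspace_G: "topspace (subtopology (prod_discrete H) G) = G"
  using G_PiE by auto

lemma rcos_level: "x \<in> G \<Longrightarrow> level H G (Suc j) #>\<^bsub>GG\<^esub> x = {y \<in> G. \<forall>k\<le>j. y k = x k}"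
proof -
  assume x: "x \<in> G"
  have "y \<in> level H G (Suc j) #>\<^bsub>GG\<^esub> x \<longleftrightarrow> cg (level H G (Suc j)) y x" for y
  proof
    assume y: "y \<in> level H G (Suc j) #>\<^bsub>GG\<^esub> x"
    then have yG: "y \<in> G"
      using r_coset_subset_G[OF subgroup.subset[OF level_subgroup], of x "Suc j"] x by auto
    show "cg (level H G (Suc j)) y x"
      using rcos_eq_iff_cg[OF level_subgroup, of x y "Suc j"] repr_independence[OF y _ level_subgroup] x yG
        cg_sym[OF level_subgroup] by simp
  next
    assume c: "cg (level H G (Suc j)) y x"
    then have yG: "y \<in> G" using cg_closed by fastforce
    show "y \<in> level H G (Suc j) #>\<^bsub>GG\<^esub> x"
      using rcos_eq_iff_cg[OF level_subgroup, of y x "Suc j"] rcos_self[OF _ level_subgroup, of y "Suc j"] x yG c by simp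
  qed
  then show ?thesis using x by (auto simp: cg_level less_Suc_eq_le)
qed

lemma openin_rcos_level:
  assumes x: "x \<in> G"
  shows "openin (subtopology (prod_discrete H) G) (level H G (Suc j) #>\<^bsub>GG\<^esub> x)"
proof -
  let ?U = "\<lambda>k. if k \<le> j then {x k} else carrier (H k)"
  have "openin (prod_discrete H) (Pi\<^sub>E UNIV ?U)"
    unfolding openin_product_topology_alt
  proof
    fix y assume y: "y \<in> Pi\<^sub>E UNIV ?U"
    have "finite {k \<in> UNIV. ?U k \<noteq> topspace (discrete_topology (carrier (H k)))}"
      by (rule finite_subset[of _ "{..j}"]) auto
    moreover have "\<forall>k\<in>UNIV. openin (discrete_topology (carrier (H k))) (?U k)"
      using G_carrier[OF x] by auto
    ultimately show "\<exists>U. finite {i \<in> UNIV. U i \<noteq> topspace (discrete_topology (carrier (H i)))} \<and>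
        (\<forall>i\<in>UNIV. openin (discrete_topology (carrier (H i))) (U i)) \<and>
        y \<in> Pi\<^sub>E UNIV U \<and> Pi\<^sub>E UNIV U \<subseteq> Pi\<^sub>E UNIV ?U"
      using y by (intro exI[of _ ?U] conjI subset_refl)
  qed
  then have "openin (subtopology (prod_discrete H) G) (G \<inter> Pi\<^sub>E UNIV ?U)"
    by (rule openin_subtopology_Int2)
  also have "G \<inter> Pi\<^sub>E UNIV ?U = {y \<in> G. \<forall>k\<le>j. y k = x k}"
    using G_carrier by (fastforce simp: PiE_iff split: if_splits)
  finally show ?thesis by (simp add: rcos_level[OF x])
qed

lemma countable_rcos_level:
  "countable {level H G (Suc j) #>\<^bsub>GG\<^esub> x |x. x \<in> G}"
proof -
  let ?L = "lists (\<Union>k. carrier (H k))"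
  have "countable ?L" using H_countable by (intro countable_lists countable_UN) auto
  moreover have "{level H G (Suc j) #>\<^bsub>GG\<^esub> x |x. x \<in> G} \<subseteq>
      (\<lambda>l. {y \<in> G. map y [0..<Suc j] = l}) ` ?L"
  proof
    fix C assume "C \<in> {level H G (Suc j) #>\<^bsub>GG\<^esub> x |x. x \<in> G}"
    then obtain x where x: "x \<in> G" "C = {y \<in> G. \<forall>k\<le>j. y k = x k}" using rcos_level by auto
    have "C = {y \<in> G. map y [0..<Suc j] = map x [0..<Suc j]}"
      unfolding x(2) by (auto simp: map_eq_conv less_Suc_eq_le simp del: upt_Suc)
    moreover have "x k \<in> (\<Union>k. carrier (H k))" for k using G_carrier[OF x(1)] by blast
    then have "map x [0..<Suc j] \<in> ?L" by (auto simp del: upt_Suc UN_iff)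
    ultimately show "C \<in> (\<lambda>l. {y \<in> G. map y [0..<Suc j] = l}) ` ?L" by blast
  qed
  ultimately show ?thesis by (meson countable_image countable_subset)
qed

lemma complete_G:
  assumes "\<And>n. cg (level H G (Suc n)) (y n) (y (Suc n))"
  shows "\<exists>g. \<forall>n. cg (level H G (Suc n)) g (y n)"
proof -
  have yG: "y n \<in> G" for n using assms by (simp add: cg_level)
  have eq: "y n k = y k k" if "k \<le> n" for n k
    using that
  proof (induction n)
    case (Suc n)
    show ?case
    proof (cases "k = Suc n")
      case False
      then have "k \<le> n" using Suc.prems by simp
      then show ?thesis using Suc.IH assms[of n] by (simp add: cg_level)
    qed simp
  qed simp
  \<comment> \<open>The coordinate with index \<open>k\<close> is final from \<open>y k\<close> on.
    Every basic neighbourhood of the limit restricts only finitely many coordinates and hence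
    contains some \<open>y m\<close>, so \<open>g\<close> lies in the closed set
    \<open>G\<close>.\<close>
  define g where "g k = y k k" for k
  have gP: "g \<in> (\<Pi>\<^sub>E i\<in>UNIV. carrier (H i))" using yG G_carrier by (auto simp: g_def)
  have "g \<in> G"
  proof (rule ccontr)
    assume "g \<notin> G"
    then have "g \<in> topspace (prod_discrete H) - G" using gP by simp
    moreover have "openin (prod_discrete H) (topspace (prod_discrete H) - G)"
      using G_closed by (simp add: closedin_def)
    ultimately obtain U where U: "finite {i \<in> UNIV. U i \<noteq> topspace (discrete_topology (carrier (H i)))}"
      "g \<in> Pi\<^sub>E UNIV U" "Pi\<^sub>E UNIV U \<subseteq> topspace (prod_discrete H) - G"
      unfolding openin_product_topology_alt by blast
    have "\<exists>m. \<forall>i\<in>{i. U i \<noteq> carrier (H i)}. i \<le> m"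
      using U(1) by (simp add: finite_nat_set_iff_bounded_le)
    then obtain m where m: "{i. U i \<noteq> carrier (H i)} \<subseteq> {..m}" by auto
    have "y m i \<in> U i" for i
    proof (cases "i \<le> m")
      case True
      then show ?thesis using eq[OF True] PiE_mem[OF U(2), of i] by (simp add: g_def)
    next
      case False
      then have "U i = carrier (H i)" using m by auto
      then show ?thesis using G_carrier[OF yG] by simp
    qed
    then have "y m \<in> Pi\<^sub>E UNIV U" by auto
    then show False using U(3) yG by blast
  qed
  moreover have "g k = y n k" if "k \<le> n" for k n
    using eq[OF that] by (simp only: g_def)
  ultimately have "cg (level H G (Suc n)) g (y n)" for n
    using yG by (simp add: cg_level less_Suc_eq_le)
  then show ?thesis by blast
qed

lemma eventually_fin_socle_of_tame:
  assumes "tame GG (subtopology (prod_discrete H) G)" "prime p"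
  shows "eventually_fin_socle p"
proof (rule tame_eventually_fin_socle[OF assms(1) _ _ _ _ assms(2)])
  show "topspace (subtopology (prod_discrete H) G) = carrier GG"
    using topspace_G by simp
  show "openin (subtopology (prod_discrete H) G) (level H G (Suc j) #>\<^bsub>GG\<^esub> x)"
    if "x \<in> carrier GG" for j x
    using that openin_rcos_level by simp
  show "countable {level H G (Suc j) #>\<^bsub>GG\<^esub> x |x. x \<in> carrier GG}" for j
    using countable_rcos_level by simp
  show "\<exists>g. \<forall>n. cg (level H G (Suc n)) g (y n)"
    if "\<And>n. cg (level H G (Suc n)) (y n) (y (Suc n))" for y
    by (rule complete_G[OF that])
qed

text \<open>Replaces the nodes of length \<open>j + 1\<close> by the elements of \<open>G\<close>
  extending them; the shift reflects that nodes are nonempty sequences.\<close>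

definition hat :: "'a list set \<Rightarrow> nat \<Rightarrow> (nat \<Rightarrow> 'a) set" where
  "hat S j = {x \<in> G. map x [0..<Suc j] \<in> S}"

lemma map_upt_in_nodes: "x \<in> G \<Longrightarrow> map x [0..<Suc j] \<in> nodes H"
  using G_carrier by (auto simp: nodes_def carrier_fin_prod simp del: upt_Suc intro!: bexI[of _ "Suc j"])

lemma map_upt_eq_iff: "map x [0..<m] = map y [0..<m] \<longleftrightarrow> (\<forall>k<m. x k = y k)"
  by auto

lemma nodes_ofE:
  assumes "S \<subseteq> nodes_of H G" "\<sigma> \<in> S"
  obtains x j where "x \<in> G" "\<sigma> = map x [0..<Suc j]"
proof -
  have "\<sigma> \<in> nodes_of H G" using assms by blast
  then obtain x where x: "x \<in> G" "\<sigma> = map x [0..<length \<sigma>]" and n: "\<sigma> \<in> nodes H"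
    by (auto simp: nodes_of_def)
  have "length \<sigma> \<ge> 1" using n by (auto simp: nodes_def carrier_fin_prod)
  then have "Suc (length \<sigma> - 1) = length \<sigma>" by simp
  with x(2) have "\<sigma> = map x [0..<Suc (length \<sigma> - 1)]" by (simp only:)
  then show ?thesis using x(1) that by blast
qed

lemma hat_inject:
  assumes "S \<subseteq> nodes_of H G" "S' \<subseteq> nodes_of H G" "hat S = hat S'"
  shows "S = S'"
proof -
  have "S1 \<subseteq> S2" if sub: "S1 \<subseteq> nodes_of H G" and eq: "hat S1 = hat S2" for S1 S2
  proof
    fix \<sigma> assume s: "\<sigma> \<in> S1"
    obtain x j where x: "x \<in> G" "\<sigma> = map x [0..<Suc j]" by (rule nodes_ofE[OF sub s])
    then have "x \<in> hat S1 j" using s by (simp add: hat_def)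
    then show "\<sigma> \<in> S2" using x eq by (simp add: hat_def)
  qed
  then show ?thesis using assms by (metis equalityI)
qed

lemma hat_closed: "hat S j \<subseteq> G"
  by (auto simp: hat_def)

lemma hat_Suc:
  assumes "tree H S"
  shows "hat S (Suc j) \<subseteq> hat S j"
proof
  fix x assume x: "x \<in> hat S (Suc j)"
  then have "prefix (map x [0..<Suc j]) (map x [0..<Suc (Suc j)])"
    by (simp add: upt_Suc_append[of 0 "Suc j"] del: upt_Suc)
  then have "map x [0..<Suc j] \<in> S"
    using assms x map_upt_in_nodes unfolding tree_def hat_def by blast
  then show "x \<in> hat S j" using x by (simp add: hat_def)
qed

lemma prefix_map_upt:
  assumes "prefix (map x [0..<m]) (map y [0..<n])"
  shows "m \<le> n \<and> (\<forall>k<m. x k = y k)"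
proof -
  have le: "m \<le> n" using prefix_length_le[OF assms] by simp
  have "map x [0..<m] ! k = map y [0..<n] ! k" if "k < m" for k
    using assms that by (auto simp: prefix_def nth_append simp del: nth_map)
  then show ?thesis using le by auto
qed

text \<open>An extension of any greater length can be cut down to one additional coordinate because
  \<open>S\<close> is a tree.\<close>

lemma hat_tree_deriv:
  assumes S: "S \<subseteq> nodes_of H G" "tree H S"
  shows "hat (tree_deriv S) j = {x \<in> G. \<exists>y\<in>hat S (Suc j). cg (level H G (Suc j)) x y}"
proof (intro equalityI subsetI)
  fix x assume x: "x \<in> hat (tree_deriv S) j"
  then have xG: "x \<in> G" by (simp add: hat_def)
  from x obtain \<tau> where t: "\<tau> \<in> S" "prefix (map x [0..<Suc j]) \<tau>" "Suc j < length \<tau>"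
    by (auto simp: hat_def tree_deriv_def simp del: upt_Suc)
  obtain y i where y: "y \<in> G" "\<tau> = map y [0..<Suc i]" by (rule nodes_ofE[OF S(1) t(1)])
  have "Suc j \<le> i" using t(3) y(2) by simp
  moreover have "y \<in> hat S i" using y t(1) by (simp add: hat_def)
  ultimately have "y \<in> hat S (Suc j)"
    using lift_Suc_antimono_le[of "hat S" "Suc j" i] hat_Suc[OF S(2)] by blast
  moreover have "\<forall>k<Suc j. x k = y k" using prefix_map_upt t(2) y(2) by blast
  ultimately show "x \<in> {x \<in> G. \<exists>y\<in>hat S (Suc j). cg (level H G (Suc j)) x y}"
    using xG y(1) by (auto simp: cg_level)
next
  fix x assume "x \<in> {x \<in> G. \<exists>y\<in>hat S (Suc j). cg (level H G (Suc j)) x y}"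
  then obtain y where y: "y \<in> hat S (Suc j)" "cg (level H G (Suc j)) x y" and xG: "x \<in> G" by blast
  have eq: "map x [0..<Suc j] = map y [0..<Suc j]" using y(2) by (simp add: cg_level map_upt_eq_iff del: upt_Suc)
  have "map y [0..<Suc j] \<in> S" using y(1) hat_Suc[OF S(2)] by (auto simp: hat_def)
  moreover have "map y [0..<Suc (Suc j)] \<in> S" using y(1) by (simp add: hat_def)
  moreover have "prefix (map y [0..<Suc j]) (map y [0..<Suc (Suc j)])"
    by (simp add: upt_Suc_append[of 0 "Suc j"] del: upt_Suc)
  ultimately have "map x [0..<Suc j] \<in> tree_deriv S"
    unfolding eq tree_deriv_def by (auto simp del: upt_Suc intro!: bexI[of _ "map y [0..<Suc (Suc j)]"])
  then show "x \<in> hat (tree_deriv S) j" using xG by (simp add: hat_def)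
qed

lemma tree_deriv_subset: "tree_deriv S \<subseteq> S"
  by (auto simp: tree_deriv_def)

lemma tree_tree_deriv:
  assumes S: "tree H S"
  shows "tree H (tree_deriv S)"
  unfolding tree_def
proof (intro conjI ballI impI)
  show "tree_deriv S \<subseteq> nodes H" using S tree_deriv_subset unfolding tree_def by blast
  fix \<tau> \<sigma> assume t: "\<tau> \<in> tree_deriv S" and s: "\<sigma> \<in> nodes H" "prefix \<sigma> \<tau>"
  obtain \<rho> where r: "\<tau> \<in> S" "\<rho> \<in> S" "prefix \<tau> \<rho>" "length \<tau> < length \<rho>"
    using t unfolding tree_deriv_def by blast
  have "\<sigma> \<in> S" using S r(1) s unfolding tree_def by blast
  moreover have "prefix \<sigma> \<rho>" using s(2) r(3) by (rule prefix_order.trans)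
  moreover have "length \<sigma> < length \<rho>" using prefix_length_le[OF s(2)] r(4) by simp
  ultimately show "\<sigma> \<in> tree_deriv S" unfolding tree_deriv_def using r(2) by blast
qed

text \<open>A node survives \<open>n\<close> derivatives if and only if it has an extension that is
  longer by \<open>n\<close>; intersecting over \<open>n\<close> yields
  \<open>lim_seq\<close>.\<close>

lemma tree_deriv_pow:
  assumes S: "S \<subseteq> nodes_of H G" "tree H S"
  shows "tree H ((tree_deriv ^^ n) S) \<and> (tree_deriv ^^ n) S \<subseteq> S \<and>
    (\<forall>j. hat ((tree_deriv ^^ n) S) j = {x \<in> G. \<exists>y\<in>hat S (j + n). cg (level H G (Suc j)) x y})"
proof (induction n)
  case 0
  have "hat S j = {x \<in> G. \<exists>y\<in>hat S j. cg (level H G (Suc j)) x y}" for j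
  proof (intro equalityI subsetI)
    fix x assume "x \<in> hat S j"
    then show "x \<in> {x \<in> G. \<exists>y\<in>hat S j. cg (level H G (Suc j)) x y}"
      using hat_closed by (auto simp: cg_level intro!: bexI[of _ x])
  next
    fix x assume "x \<in> {x \<in> G. \<exists>y\<in>hat S j. cg (level H G (Suc j)) x y}"
    then obtain y where y: "y \<in> hat S j" "cg (level H G (Suc j)) x y" and xG: "x \<in> G" by blast
    then have "map x [0..<Suc j] = map y [0..<Suc j]" by (simp add: cg_level map_upt_eq_iff del: upt_Suc)
    then show "x \<in> hat S j" using y(1) xG by (simp add: hat_def del: upt_Suc map_eq_conv)
  qed
  then show ?case using S by simp
next
  case (Suc n)
  let ?S = "(tree_deriv ^^ n) S"
  have sub: "?S \<subseteq> nodes_of H G" using Suc S by blast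
  have "hat (tree_deriv ?S) j = {x \<in> G. \<exists>y\<in>hat S (j + Suc n). cg (level H G (Suc j)) x y}" for j
  proof -
    have "(\<exists>y\<in>hat ?S (Suc j). cg (level H G (Suc j)) x y) \<longleftrightarrow>
        (\<exists>y\<in>hat S (j + Suc n). cg (level H G (Suc j)) x y)" if xG: "x \<in> G" for x
    proof
      assume "\<exists>y\<in>hat ?S (Suc j). cg (level H G (Suc j)) x y"
      then obtain y z where y: "cg (level H G (Suc j)) x y" and
        z: "z \<in> hat S (Suc j + n)" "cg (level H G (Suc (Suc j))) y z" using Suc.IH by blast
      then show "\<exists>y\<in>hat S (j + Suc n). cg (level H G (Suc j)) x y"
        by (intro bexI[of _ z]) (auto simp: cg_level)
    next
      assume "\<exists>y\<in>hat S (j + Suc n). cg (level H G (Suc j)) x y"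
      then obtain y where y: "y \<in> hat S (j + Suc n)" "cg (level H G (Suc j)) x y" by blast
      then have "y \<in> hat ?S (Suc j)" using Suc.IH by (auto simp: cg_level)
      then show "\<exists>y\<in>hat ?S (Suc j). cg (level H G (Suc j)) x y" using y(2) by blast
    qed
    then show ?thesis using hat_tree_deriv[OF sub] Suc.IH by auto
  qed
  moreover have "tree H (tree_deriv ?S)" using Suc.IH tree_tree_deriv by blast
  moreover have "tree_deriv ?S \<subseteq> S" using Suc.IH tree_deriv_subset[of ?S] by blast
  ultimately show ?case by simp
qed

lemma tree_Inter:
  assumes "\<And>n. tree H (S n)"
  shows "tree H (\<Inter>n::nat. S n)"
  unfolding tree_def
proof (intro conjI ballI impI INT_I)
  show "(\<Inter>n. S n) \<subseteq> nodes H" using assms[of 0] unfolding tree_def by blast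
  fix \<tau> \<sigma> n assume "\<tau> \<in> (\<Inter>n. S n)" "\<sigma> \<in> nodes H" "prefix \<sigma> \<tau>"
  then show "\<sigma> \<in> S n" using assms[of n] unfolding tree_def by blast
qed

lemma hat_tree_deriv_omega:
  assumes S: "S \<subseteq> nodes_of H G" "tree H S"
  shows "hat (\<Inter>n. (tree_deriv ^^ n) S) = lim_seq (hat S)"
proof (rule ext, intro equalityI subsetI)
  fix j x assume x: "x \<in> hat (\<Inter>n. (tree_deriv ^^ n) S) j"
  then have "x \<in> hat ((tree_deriv ^^ n) S) j" for n by (simp add: hat_def)
  then show "x \<in> lim_seq (hat S) j"
    using tree_deriv_pow[OF S] x by (auto simp: lim_seq_def)
next
  fix j x assume x: "x \<in> lim_seq (hat S) j"
  then have "x \<in> hat ((tree_deriv ^^ n) S) j" for n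
    using tree_deriv_pow[OF S] by (auto simp: lim_seq_def)
  then show "x \<in> hat (\<Inter>n. (tree_deriv ^^ n) S) j" by (simp add: hat_def)
qed

end

section \<open>Derivatives at multiples of omega\<close>

lemma tree_deriv_iter_pow:
  "tree_deriv_iter ((ord_suc ^^ n) \<alpha>) S = (tree_deriv ^^ n) (tree_deriv_iter \<alpha> S)"
  by (induction n) (simp_all add: tree_deriv_iter_suc)

declare omega_times.simps [simp del]

lemma less_omega_times_Suc:
  assumes "\<beta> < omega_times (Suc k)"
  shows "\<exists>n. \<beta> < (ord_suc ^^ n) (omega_times k)"
proof (rule ccontr)
  assume "\<not> ?thesis"
  then have "\<forall>n. (ord_suc ^^ n) (omega_times k) \<le> \<beta>" by (meson not_less)
  then have "omega_times (Suc k) \<le> \<beta>" unfolding omega_times.simps by (rule Least_le)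
  then show False using assms by (meson not_less)
qed

lemma ord_suc_pow_less_omega_times: "(ord_suc ^^ n) (omega_times k) < omega_times (Suc k)"
  using less_ord_suc[of "(ord_suc ^^ n) (omega_times k)"] omega_times_Suc_upper[of "Suc n" k] by simp

text \<open>The finite successors of \<open>omega_times k\<close> are cofinal in the limit ordinal
  \<open>omega_times (Suc k)\<close>, and the derivatives decrease.\<close>

lemma tree_deriv_iter_omega_times_Suc:
  "tree_deriv_iter (omega_times (Suc k)) S = (\<Inter>n. (tree_deriv ^^ n) (tree_deriv_iter (omega_times k) S))"
proof -
  let ?L = "omega_times (Suc k)"
  have ne: "?L \<noteq> 0" using ord_suc_pow_less_omega_times[of 0 k] by (metis not_less zero_le_ctble_ord)
  have nsuc: "\<nexists>\<beta>. ?L = ord_suc \<beta>"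
  proof
    assume "\<exists>\<beta>. ?L = ord_suc \<beta>"
    then obtain \<beta> where b: "?L = ord_suc \<beta>" by blast
    then obtain n where "\<beta> < (ord_suc ^^ n) (omega_times k)"
      using less_omega_times_Suc less_ord_suc by metis
    then have "ord_suc \<beta> \<le> (ord_suc ^^ n) (omega_times k)" unfolding ord_suc_def by (rule Least_le)
    then show False using ord_suc_pow_less_omega_times[of n k] b by simp
  qed
  show ?thesis
    unfolding tree_deriv_iter_limit[OF ne nsuc] tree_deriv_iter_pow[symmetric]
  proof (intro equalityI subsetI INT_I)
    fix \<sigma> n assume "\<sigma> \<in> (\<Inter>\<beta>\<in>{..<?L}. tree_deriv_iter \<beta> S)"
    then show "\<sigma> \<in> tree_deriv_iter ((ord_suc ^^ n) (omega_times k)) S"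
      using ord_suc_pow_less_omega_times by blast
  next
    fix \<sigma> \<beta> assume s: "\<sigma> \<in> (\<Inter>n. tree_deriv_iter ((ord_suc ^^ n) (omega_times k)) S)" and "\<beta> \<in> {..<?L}"
    then have "\<beta> < ?L" by simp
    then obtain n where "\<beta> < (ord_suc ^^ n) (omega_times k)" using less_omega_times_Suc by blast
    then have "tree_deriv_iter ((ord_suc ^^ n) (omega_times k)) S \<subseteq> tree_deriv_iter \<beta> S"
      by (intro tree_deriv_iter_antimono) simp
    then show "\<sigma> \<in> tree_deriv_iter \<beta> S" using s by blast
  qed
qed

lemma ht_le:
  assumes "tree_deriv (tree_deriv_iter \<alpha> S) = tree_deriv_iter \<alpha> S"
  shows "ht S \<le> \<alpha>"
  unfolding ht_def by (rule Least_le) (simp add: tree_deriv_iter_suc assms)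

context closed_filtered_subgroup
begin

lemma hat_tree_deriv_iter_omega_times:
  assumes S: "S \<subseteq> nodes_of H G" "tree H S"
  shows "tree_deriv_iter (omega_times k) S \<subseteq> nodes_of H G \<and> tree H (tree_deriv_iter (omega_times k) S) \<and>
    hat (tree_deriv_iter (omega_times k) S) = (lim_seq ^^ k) (hat S)"
proof (induction k)
  case 0
  then show ?case using S by (simp add: tree_deriv_iter_0 omega_times.simps)
next
  case (Suc k)
  let ?U = "tree_deriv_iter (omega_times k) S"
  have U: "?U \<subseteq> nodes_of H G" "tree H ?U" using Suc by auto
  have "(\<Inter>n. (tree_deriv ^^ n) ?U) \<subseteq> (tree_deriv ^^ 0) ?U" by blast
  then show ?case
    unfolding tree_deriv_iter_omega_times_Suc
    using U tree_Inter[of "\<lambda>n. (tree_deriv ^^ n) ?U"] tree_deriv_pow[OF U] hat_tree_deriv_omega[OF U] Suc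
    by auto
qed

lemma tree_deriv_of_pruned:
  assumes S: "S \<subseteq> nodes_of H G" "tree H S" and "pruned (hat S)"
  shows "tree_deriv S = S"
proof (rule hat_inject)
  show "hat (tree_deriv S) = hat S"
  proof (rule ext, intro equalityI subsetI)
    fix j x assume "x \<in> hat (tree_deriv S) j"
    then show "x \<in> hat S j" using tree_deriv_subset by (auto simp: hat_def)
  next
    fix j x assume "x \<in> hat S j"
    then show "x \<in> hat (tree_deriv S) j"
      using assms(3) hat_tree_deriv[OF S] hat_closed unfolding pruned_def by blast
  qed
qed (use S tree_deriv_subset in auto)

lemma ht_le_of_pruned:
  assumes S: "S \<subseteq> nodes_of H G" "tree H S" and "pruned ((lim_seq ^^ k) (hat S))"
  shows "ht S \<le> omega_times k"
  using hat_tree_deriv_iter_omega_times[OF S, of k] assms(3)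
  by (intro ht_le tree_deriv_of_pruned) auto

text \<open>An empty level with index \<open>m\<close> means that no node is longer than
  \<open>m\<close>; then \<open>m\<close> further derivatives leave the empty tree, which is stable,
  and the height stays strictly below the next multiple of omega.\<close>

lemma ht_less_of_empty:
  assumes S: "S \<subseteq> nodes_of H G" "tree H S" and "(lim_seq ^^ k) (hat S) m = {}"
  shows "ht S < omega_times (Suc k)"
proof -
  let ?U = "tree_deriv_iter (omega_times k) S"
  have U: "?U \<subseteq> nodes_of H G" "tree H ?U" "hat ?U m = {}"
    using hat_tree_deriv_iter_omega_times[OF S, of k] assms(3) by auto
  have "hat ?U (j + m) = {}" for j
    using U(3) lift_Suc_antimono_le[of "hat ?U" m "j + m"] hat_Suc[OF U(2)] by auto
  then have "hat ((tree_deriv ^^ m) ?U) j = hat {} j" for j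
    using tree_deriv_pow[OF U(1,2), of m] by (simp add: hat_def[of "{}"])
  then have "(tree_deriv ^^ m) ?U = {}"
    using hat_inject[of "(tree_deriv ^^ m) ?U" "{}"] tree_deriv_pow[OF U(1,2), of m] U(1) by blast
  then have "ht S \<le> (ord_suc ^^ m) (omega_times k)"
    by (intro ht_le) (simp add: tree_deriv_iter_pow tree_deriv_def)
  then show ?thesis using ord_suc_pow_less_omega_times by (rule le_less_trans)
qed

section \<open>The sequences of group trees and coset trees\<close>

lemma restrict_hom: "(\<lambda>x. map x [0..<m]) \<in> hom GG (fin_prod H m)"
proof (rule homI)
  fix x assume "x \<in> carrier GG"
  then show "map x [0..<m] \<in> carrier (fin_prod H m)" using G_carrier by (simp add: carrier_fin_prod)
next
  fix x y assume "x \<in> carrier GG" "y \<in> carrier GG"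
  then show "map (x \<otimes>\<^bsub>GG\<^esub> y) [0..<m] = map x [0..<m] \<otimes>\<^bsub>fin_prod H m\<^esub> map y [0..<m]"
    using map_mult_fin_prod[OF G_PiE G_PiE, of x y m] by (simp add: mult_GG)
qed

lemma fin_prod_group: "group (fin_prod H m)"
  unfolding fin_prod_def by (rule DirProd_list_is_group) (use H_group in simp)

lemma restrict_group_hom: "group_hom GG (fin_prod H m) (\<lambda>x. map x [0..<m])"
  unfolding group_hom_def group_hom_axioms_def using fin_prod_group restrict_hom is_group by blast

lemma hat_eq: "hat S j = {x \<in> G. map x [0..<Suc j] \<in> S \<inter> carrier (fin_prod H (Suc j))}"
  using G_carrier by (auto simp: hat_def carrier_fin_prod simp del: upt_Suc)

lemma hat_saturated:
  assumes "x \<in> hat S j" "cg (level H G (Suc j)) x y"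
  shows "y \<in> hat S j"
proof -
  have "map x [0..<Suc j] = map y [0..<Suc j]"
    using assms(2) by (simp add: cg_level map_upt_eq_iff del: upt_Suc)
  then show ?thesis using assms by (simp add: hat_def cg_level del: upt_Suc map_eq_conv)
qed

lemma group_seq_hat:
  assumes "group_tree H S"
  shows "group_seq (hat S)"
  unfolding group_seq_def
proof (intro allI conjI)
  fix j
  interpret r: group_hom "GG" "fin_prod H (Suc j)" "\<lambda>x. map x [0..<Suc j]"
    by (rule restrict_group_hom)
  have T: "tree H S" and sub: "subgroup (S \<inter> carrier (fin_prod H (Suc j))) (fin_prod H (Suc j))"
    using assms by (auto simp: group_tree_def)
  show "hat S (Suc j) \<subseteq> hat S j" by (rule hat_Suc[OF T])
  show s: "subgroup (hat S j) GG"
  proof (rule subgroupI)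
    show "hat S j \<subseteq> carrier GG" using hat_closed by simp
    have "map \<one>\<^bsub>GG\<^esub> [0..<Suc j] \<in> S \<inter> carrier (fin_prod H (Suc j))"
      unfolding r.hom_one by (rule subgroup.one_closed[OF sub])
    then have "\<one>\<^bsub>GG\<^esub> \<in> hat S j"
      using one_closed unfolding hat_eq by simp
    then show "hat S j \<noteq> {}" by blast
    fix x assume x: "x \<in> hat S j"
    have xc: "x \<in> carrier GG" using x hat_closed by auto
    have "map (inv\<^bsub>GG\<^esub> x) [0..<Suc j] \<in> S \<inter> carrier (fin_prod H (Suc j))"
      unfolding r.hom_inv[OF xc]
      by (rule subgroup.m_inv_closed[OF sub]) (use x in \<open>simp add: hat_eq del: upt_Suc\<close>)
    then show "inv\<^bsub>GG\<^esub> x \<in> hat S j"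
      using inv_closed[OF xc] unfolding hat_eq by simp
    fix y assume y: "y \<in> hat S j"
    have yc: "y \<in> carrier GG" using y hat_closed by auto
    have "map (x \<otimes>\<^bsub>GG\<^esub> y) [0..<Suc j] \<in> S \<inter> carrier (fin_prod H (Suc j))"
      unfolding r.hom_mult[OF xc yc]
      by (rule subgroup.m_closed[OF sub]) (use x y in \<open>simp_all add: hat_eq del: upt_Suc\<close>)
    then show "x \<otimes>\<^bsub>GG\<^esub> y \<in> hat S j"
      using m_closed[OF xc yc] unfolding hat_eq by simp
  qed
  show "level H G (Suc j) \<subseteq> hat S j"
  proof
    fix x assume "x \<in> level H G (Suc j)"
    then have "cg (level H G (Suc j)) \<one>\<^bsub>GG\<^esub> x"
      using cg_one[OF level_subgroup] cg_sym[OF level_subgroup] by blast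
    then show "x \<in> hat S j" using hat_saturated subgroup.one_closed[OF s] by blast
  qed
qed

text \<open>In a right coset of \<open>K\<close> with representative \<open>a\<close>, the
  combination of the elements \<open>k1 a\<close>, \<open>k2 a\<close> and \<open>k3 a\<close> has
  \<open>k1 (inv k2) k3\<close> in front of \<open>a\<close>, so it stays in the coset and the
  differences form a subgroup at each level.\<close>

lemma coset_tree_seq:
  assumes S: "coset_tree H S" and ne: "\<And>j. hat S j \<noteq> {}"
  shows "\<exists>A. group_seq A \<and> coset_seq A (hat S)"
proof (rule ex_group_seq_of_heap)
  show "hat S m \<subseteq> carrier GG" for m using hat_closed by simp
  show "hat S m \<noteq> {}" for m by (rule ne)
  show "hat S (Suc m) \<subseteq> hat S m" for m using S by (intro hat_Suc) (simp add: coset_tree_def)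
  show "y \<in> hat S m" if "x \<in> hat S m" "cg (level H G (Suc m)) x y" for m x y using that by (rule hat_saturated)
  fix m x y w assume xyw: "x \<in> hat S m" "y \<in> hat S m" "w \<in> hat S m"
  define F where "F = fin_prod H (Suc m)"
  let ?r = "\<lambda>x. map x [0..<Suc m]" and ?C = "S \<inter> carrier F"
  interpret r: group_hom GG F ?r unfolding F_def by (rule restrict_group_hom)
  have c: "x \<in> carrier GG" "y \<in> carrier GG" "w \<in> carrier GG" using xyw hat_closed by auto
  have C: "?r x \<in> ?C" "?r y \<in> ?C" "?r w \<in> ?C" using xyw unfolding hat_eq F_def by blast+
  have "?C = {} \<or> (\<exists>K. subgroup K F \<and> ?C \<in> rcosets\<^bsub>F\<^esub> K)"
    using S unfolding coset_tree_def F_def by simp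
  then obtain K a where K: "subgroup K F" "a \<in> carrier F" "?C = K #>\<^bsub>F\<^esub> a"
    using C(1) unfolding RCOSETS_def by blast
  obtain k1 k2 k3 where k: "k1 \<in> K" "k2 \<in> K" "k3 \<in> K"
    "?r x = k1 \<otimes>\<^bsub>F\<^esub> a" "?r y = k2 \<otimes>\<^bsub>F\<^esub> a" "?r w = k3 \<otimes>\<^bsub>F\<^esub> a"
    using C unfolding K(3) r_coset_def by blast
  have kc: "k1 \<in> carrier F" "k2 \<in> carrier F" "k3 \<in> carrier F"
    using k(1-3) subgroup.mem_carrier[OF K(1)] by auto
  have "?r (x \<otimes>\<^bsub>GG\<^esub> inv\<^bsub>GG\<^esub> y \<otimes>\<^bsub>GG\<^esub> w) = ?r x \<otimes>\<^bsub>F\<^esub> inv\<^bsub>F\<^esub> ?r y \<otimes>\<^bsub>F\<^esub> ?r w"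
    using c by (simp only: r.hom_mult r.hom_inv m_closed inv_closed)
  also have "\<dots> = (k1 \<otimes>\<^bsub>F\<^esub> inv\<^bsub>F\<^esub> k2 \<otimes>\<^bsub>F\<^esub> k3) \<otimes>\<^bsub>F\<^esub> a"
  proof -
    have "a \<otimes>\<^bsub>F\<^esub> (inv\<^bsub>F\<^esub> a \<otimes>\<^bsub>F\<^esub> b) = b" if "b \<in> carrier F" for b
      using that K(2) by (simp add: r.H.m_assoc[symmetric])
    then show ?thesis
      unfolding k(4-6) using kc K(2) by (simp add: r.H.inv_mult_group r.H.m_assoc)
  qed
  also have "\<dots> \<in> ?C"
  proof -
    have "k1 \<otimes>\<^bsub>F\<^esub> inv\<^bsub>F\<^esub> k2 \<otimes>\<^bsub>F\<^esub> k3 \<in> K"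
      by (intro subgroup.m_closed[OF K(1)] subgroup.m_inv_closed[OF K(1)] k(1-3))
    then show ?thesis unfolding K(3) r_coset_def by blast
  qed
  finally have "?r (x \<otimes>\<^bsub>GG\<^esub> inv\<^bsub>GG\<^esub> y \<otimes>\<^bsub>GG\<^esub> w) \<in> ?C" .
  moreover have "x \<otimes>\<^bsub>GG\<^esub> inv\<^bsub>GG\<^esub> y \<otimes>\<^bsub>GG\<^esub> w \<in> carrier GG"
    by (intro m_closed inv_closed c)
  ultimately show "x \<otimes>\<^bsub>GG\<^esub> inv\<^bsub>GG\<^esub> y \<otimes>\<^bsub>GG\<^esub> w \<in> hat S m"
    unfolding hat_eq F_def carrier_GG by blast
qed

lemma lim_seq_empty:
  assumes "C m = {}"
  shows "lim_seq C m = {}"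
proof -
  have "\<not> (\<exists>y\<in>C (m + 0). cg (level H G (Suc m)) x y)" for x using assms by simp
  then show ?thesis unfolding lim_seq_def by blast
qed

end

theorem theorem5p5:
  fixes H :: "nat \<Rightarrow> 'a monoid" and G :: "(nat \<Rightarrow> 'a) set"
  assumes "\<And>n. comm_group (H n)"
    and "\<And>n. countable (carrier (H n))"
    and "subgroup G (product_group UNIV H)"
    and "closedin (prod_discrete H) G"
    and "tame (subgroup_of_prod H G) (subtopology (prod_discrete H) G)"
    and "\<And>n. n \<ge> 1 \<Longrightarrow>
           torsion_group (subgroup_of_prod H (level H G n) Mod level H G (n + 1))"
  shows "(\<forall>S. S \<subseteq> nodes_of H G \<and> group_tree H S \<longrightarrow> ht S \<le> omega_times 3) \<and>
         (\<forall>S. S \<subseteq> nodes_of H G \<and> coset_tree H S \<longrightarrow> ht S < omega_times 4)"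
proof (intro conjI allI impI)
  interpret closed_filtered_subgroup H G
    by (rule closed_filtered_subgroup.intro) (rule assms; assumption)+
  have fin: "eventually_fin_socle p" if "prime p" for p
    using eventually_fin_socle_of_tame assms(5) that by (simp add: GG_def)
  have lim3: "(lim_seq ^^ 3) (hat S) = lim_seq (lim_seq (lim_seq (hat S)))" for S
    by (simp add: numeral_3_eq_3)
  {
    fix S assume S: "S \<subseteq> nodes_of H G \<and> group_tree H S"
    then show "ht S \<le> omega_times 3"
      using pruned_lim3[OF fin group_seq_hat, of S]
      by (intro ht_le_of_pruned) (auto simp: lim3 group_tree_def)
  }
  fix S assume S: "S \<subseteq> nodes_of H G \<and> coset_tree H S"
  then have T: "S \<subseteq> nodes_of H G" "tree H S" by (auto simp: coset_tree_def)
  \<comment> \<open>A level that is empty at the start stays empty under \<open>lim_seq\<close>;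
    otherwise the tree is a coset sequence over a group sequence and the pruning theorem
    applies.\<close>
  have "(\<exists>m. (lim_seq ^^ 3) (hat S) m = {}) \<or> pruned ((lim_seq ^^ 3) (hat S))"
  proof (cases "\<exists>j. hat S j = {}")
    case True
    then show ?thesis unfolding lim3 using lim_seq_empty by metis
  next
    case False
    then obtain A where "group_seq A" "coset_seq A (hat S)" using coset_tree_seq[of S] S by blast
    then show ?thesis unfolding lim3 using pruned_lim3_coset[OF fin] by blast
  qed
  then have "ht S < omega_times (Suc 3)"
  proof
    assume "\<exists>m. (lim_seq ^^ 3) (hat S) m = {}"
    then show ?thesis using ht_less_of_empty[OF T] by blast
  next
    assume "pruned ((lim_seq ^^ 3) (hat S))"
    then have "ht S \<le> (ord_suc ^^ 0) (omega_times 3)" using ht_le_of_pruned[OF T] by simp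
    then show ?thesis using ord_suc_pow_less_omega_times by (rule le_less_trans)
  qed
  moreover have "Suc 3 = 4" by simp
  ultimately show "ht S < omega_times 4" by (simp only:)
qed

end
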